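(* Let $\Gamma,\Lambda$ be countable groups and let $\Gamma\curvearrowright (X,\mu_X)$ and $\Lambda\curvearrowright (Y,\mu_Y)$ be essentially free measure preserving actions on standard Borel probability spaces. Put $\mathcal{G}=\Gamma\ltimes X$ and $\mathcal{H}=\Lambda\ltimes Y$. (1) Let $T:X\to Y$ be a measurable isomorphism defining an orbit equivalence between the two actions, with associated cocycle $\sigma_T:\Gamma\times X\to\Lambda$ (so $T(\gamma x)=\sigma_T(\gamma,x)T(x)$). Then for every measurable coefficient $\mathcal{H}$-module $E$, regarded as a $\mathcal{G}$-module by pullback along $f_T(\gamma,x)=(\sigma_T(\gamma,x),T(x))$, there are isometric isomorphisms in every degree $$\mathrm{H}_b^{\bullet}(\Lambda,L^\infty_{w^*}(Y,E))\cong \mathrm{H}_b^{\bullet}(\Gamma,L^\infty_{w^*}(X,E))$$ induced by the cochain maps $\mathcal{J}^{\bullet+1}:L^\infty_{w^*}(\Lambda^{\bullet+1},L^\infty_{w^*}(Y,E))^\Lambda\to L^\infty_{w^*}(\Gamma^{\bullet+1},L^\infty_{w^*}(X,E))^\Gamma$, $$\mathcal{J}^{\bullet+1}\theta(\gamma_1,\dots,\gamma_{\bullet+1})(x)=\theta\big(\sigma_T(\gamma_1,\gamma_1^{-1}x),\dots,\sigma_T(\gamma_{\bullet+1},\gamma_{\bullet+1}^{-1}x)\big)(T(x)).$$ (2) If the actions are moreover ergodic but only weakly orbit equivalent, then for every measurable coefficient $\mathcal{H}$-module $E$, regarded as a $\mathcal{G}$-module via the weak orbit equivalence, there are isomorphisms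 $$\mathrm{H}_b^{\bullet}(\Lambda,L^\infty_{w^*}(Y,E))\cong \mathrm{H}_b^{\bullet}(\Gamma,L^\infty_{w^*}(X,E)).$$
   Context: **Semidirect groupoid.** For a countable group $\Gamma$ acting on a standard Borel probability space $(X,\mu)$ preserving the measure, $\Gamma\ltimes X$ is the groupoid with underlying set $\Gamma\times X$, unit space $X$, source $s(\gamma,x)=x$, target $t(\gamma,x)=\gamma x$, product $(\gamma',\gamma x)(\gamma,x)=(\gamma'\gamma,x)$, inverse $(\gamma,x)^{-1}=(\gamma^{-1},\gamma x)$, and measure class of (counting)$\times\mu$. For a groupoid $\mathcal{G}$ with unit space $X$ and $U\subset X$ Borel, $\mathcal{G}_{|U}=\{g: s(g),t(g)\in U\}$. **Coefficients.** A measurable coefficient module $(E,L)$ over such a groupoid $\mathcal{H}$: $E=(E^\flat)^*$, $E^\flat$ separable Banach, with $L^\flat:\mathcal{H}\to\mathrm{Isom}(E^\flat)$ such that $L^\flat(gh)=L^\flat(g)L^\flat(h)$ for almost every composable pair and $g\mapsto L^\flat(g)v$ is measurable for every $v$; $L$ is the contragredient, $\langle L(g)\lambda,v\rangle=\langle\lambda,L^\flat(g^{-1})v\rangle$. If $f:\mathcal{G}\to\mathcal{H}$ is a measurable a.e. groupoid homomorphism respecting null sets (preimages of null sets are null), the pullback $f^*E$ is $E$ with $\mathcal{G}$-action $f^*L(g)=L(f(g))$. **Twisted coefficients.** If $(E,L)$ is a measurable coefficient $(\Gamma\ltimes X)$-module, $L^\infty_{w^*}(X,E)$ is the space of weak$^*$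 measurable essentially bounded functions modulo null sets, with $\Gamma$-action $(\gamma\cdot\lambda)(x)=L(\gamma,\gamma^{-1}x)\lambda(\gamma^{-1}x)$. $\mathrm{H}_b^\bullet(\Gamma,V)$ is the bounded cohomology of the discrete group $\Gamma$: the cohomology of the complex of $\Gamma$-invariant bounded functions $\Gamma^{\bullet+1}\to V$ with homogeneous coboundary, with the seminorm induced by the sup norm. For $\Gamma$ countable discrete, $L^\infty_{w^*}(\Gamma^{n},V)$ is simply the space of bounded functions $\Gamma^n\to V$. **Orbit equivalence.** An orbit equivalence is a Borel map $T:X\to Y$ with $T_*\mu_X=\mu_Y$ restricting to a Borel isomorphism between conull Borel sets $X'\subset X$, $Y'\subset Y$ with $T(\Gamma x\cap X')=\Lambda T(x)\cap Y'$ for all $x\in X'$. By essential freeness it defines a.e. a cocycle $\sigma_T:\Gamma\times X\to\Lambda$ with $T(\gamma x)=\sigma_T(\gamma,x)T(x)$. A weak orbit equivalence is an orbit equivalence $T:U\to V$ between positive measure subsets $U\subset X$, $V\subset Y$ with normalized restricted measures (orbits intersected with $U$ and $V$ respectively); it induces an isomorphism of measured groupoids $f_T:\mathcal{G}_{|U}\to\mathcal{H}_{|V}$ (after discarding null sets). When the actions are ergodic, there is a Borel map $\vartheta$ defined a.e. on $X$ with values in $\mathcal{G}$ with $s(\vartheta(x))=x$, $t(\vartheta(x))\in U$; the $\mathcal{G}$-module structure on $E$ "via the weak orbit equivalence" is the pullback of the $\mathcal{H}$-structure along $g\mapsto f_T\big(\vartheta(t(g))\,g\,\vartheta(s(g))^{-1}\big)\in\mathcal{H}_{|V}\subset\mathcal{H}$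 (different choices of $\vartheta$ give isomorphic modules). *)

theory Defs
  imports "HOL-Probability.Probability_Measure" "HOL-Algebra.Group_Action"
begin

section \<open>Probability measure preserving actions\<close>

definition standard_borel :: "'x measure \<Rightarrow> bool" where
  "standard_borel M \<longleftrightarrow>
     (\<exists>S. completely_metrizable_space S \<and> second_countable S \<and> topspace S = space M \<and>
          sets M = sigma_sets (space M) {A. openin S A})"

definition pmp_action ::
    "('g, 'm) monoid_scheme \<Rightarrow> 'x measure \<Rightarrow> ('g \<Rightarrow> 'x \<Rightarrow> 'x) \<Rightarrow> bool" where
  "pmp_action \<Gamma> M a \<longleftrightarrow>
     group \<Gamma> \<and> countable (carrier \<Gamma>) \<and> standard_borel M \<and> prob_space M \<and>
     group_action \<Gamma> (space M) a \<and>
     (\<forall>\<gamma>\<in>carrier \<Gamma>. a \<gamma> \<in> measurable M M \<and> distr M M (a \<gamma>) = M)"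

definition essentially_free ::
    "('g, 'm) monoid_scheme \<Rightarrow> 'x measure \<Rightarrow> ('g \<Rightarrow> 'x \<Rightarrow> 'x) \<Rightarrow> bool" where
  "essentially_free \<Gamma> M a \<longleftrightarrow> (AE x in M. stabilizer \<Gamma> a x = {\<one>\<^bsub>\<Gamma>\<^esub>})"

definition ergodic ::
    "('g, 'm) monoid_scheme \<Rightarrow> 'x measure \<Rightarrow> ('g \<Rightarrow> 'x \<Rightarrow> 'x) \<Rightarrow> bool" where
  "ergodic \<Gamma> M a \<longleftrightarrow>
     (\<forall>A\<in>sets M. (\<forall>\<gamma>\<in>carrier \<Gamma>. a \<gamma> ` A = A) \<longrightarrow> measure M A = 0 \<or> measure M A = 1)"


section \<open>The semidirect groupoid of an action\<close>

text \<open>An arrow is a pair \<open>(\<gamma>, x)\<close> with source \<open>x\<close> and target \<open>a \<gamma> x\<close>. In \<open>gd_mult \<Gamma> g h\<close> the arrows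
  are meant to be composable, that is, \<open>gd_source g = gd_target a h\<close>.\<close>

definition gd_source :: "'g \<times> 'x \<Rightarrow> 'x" where
  "gd_source g = snd g"

definition gd_target :: "('g \<Rightarrow> 'x \<Rightarrow> 'x) \<Rightarrow> 'g \<times> 'x \<Rightarrow> 'x" where
  "gd_target a g = a (fst g) (snd g)"

definition gd_mult :: "('g, 'm) monoid_scheme \<Rightarrow> 'g \<times> 'x \<Rightarrow> 'g \<times> 'x \<Rightarrow> 'g \<times> 'x" where
  "gd_mult \<Gamma> g h = (fst g \<otimes>\<^bsub>\<Gamma>\<^esub> fst h, snd h)"

definition gd_inv ::
    "('g, 'm) monoid_scheme \<Rightarrow> ('g \<Rightarrow> 'x \<Rightarrow> 'x) \<Rightarrow> 'g \<times> 'x \<Rightarrow> 'g \<times> 'x" where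
  "gd_inv \<Gamma> a g = (inv\<^bsub>\<Gamma>\<^esub> (fst g), a (fst g) (snd g))"

definition gd_measure :: "('g, 'm) monoid_scheme \<Rightarrow> 'x measure \<Rightarrow> ('g \<times> 'x) measure" where
  "gd_measure \<Gamma> M = count_space (carrier \<Gamma>) \<Otimes>\<^sub>M M"


section \<open>Measurable coefficient modules\<close>

definition linear_isometries :: "('e::real_normed_vector \<Rightarrow>\<^sub>L 'e) set" where
  "linear_isometries = {A. (\<forall>v. norm (blinfun_apply A v) = norm v) \<and> surj (blinfun_apply A)}"

text \<open>The predual is the whole type \<open>'e\<close> (separability is second countability) and the coefficient
  space is its dual \<open>'e \<Rightarrow>\<^sub>L real\<close>. The composable pairs are parametrised by
  \<open>(\<gamma>', \<gamma>, x) \<mapsto> ((\<gamma>', \<gamma>x), (\<gamma>, x))\<close> and carry the measure counting times counting times \<open>M\<close>.\<close>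

definition coefficient_module ::
    "('g, 'm) monoid_scheme \<Rightarrow> 'x measure \<Rightarrow> ('g \<Rightarrow> 'x \<Rightarrow> 'x) \<Rightarrow>
     ('g \<times> 'x \<Rightarrow> 'e::{banach, second_countable_topology} \<Rightarrow>\<^sub>L 'e) \<Rightarrow> bool" where
  "coefficient_module \<Gamma> M a Lf \<longleftrightarrow>
     (\<forall>g\<in>carrier \<Gamma> \<times> space M. Lf g \<in> linear_isometries) \<and>
     (AE (\<gamma>', \<gamma>, x) in count_space (carrier \<Gamma>) \<Otimes>\<^sub>M gd_measure \<Gamma> M.
        Lf (gd_mult \<Gamma> (\<gamma>', a \<gamma> x) (\<gamma>, x)) = Lf (\<gamma>', a \<gamma> x) o\<^sub>L Lf (\<gamma>, x)) \<and>
     (\<forall>v. (\<lambda>g. blinfun_apply (Lf g) v) \<in> borel_measurable (gd_measure \<Gamma> M))"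

definition contragredient ::
    "('g, 'm) monoid_scheme \<Rightarrow> ('g \<Rightarrow> 'x \<Rightarrow> 'x) \<Rightarrow>
     ('g \<times> 'x \<Rightarrow> 'e::real_normed_vector \<Rightarrow>\<^sub>L 'e) \<Rightarrow>
     'g \<times> 'x \<Rightarrow> ('e \<Rightarrow>\<^sub>L real) \<Rightarrow> ('e \<Rightarrow>\<^sub>L real)" where
  "contragredient \<Gamma> a Lf g \<xi> = \<xi> o\<^sub>L Lf (gd_inv \<Gamma> a g)"

definition pullback :: "('h \<Rightarrow> 'w \<Rightarrow> 'w) \<Rightarrow> ('g \<Rightarrow> 'h) \<Rightarrow> 'g \<Rightarrow> 'w \<Rightarrow> 'w" where
  "pullback L f g = L (f g)"


section \<open>Seminormed spaces on explicit carriers\<close>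

record 'v seminormed_space =
  pts :: "'v set"
  vzero :: 'v
  vadd :: "'v \<Rightarrow> 'v \<Rightarrow> 'v"
  vscale :: "real \<Rightarrow> 'v \<Rightarrow> 'v"
  vnorm :: "'v \<Rightarrow> real"

record ('g, 'v) normed_module = "'v seminormed_space" +
  gact :: "'g \<Rightarrow> 'v \<Rightarrow> 'v"

definition vcoset :: "('v, 'm) seminormed_space_scheme \<Rightarrow> 'v set \<Rightarrow> 'v \<Rightarrow> 'v set" where
  "vcoset V W v = {vadd V v w | w. w \<in> W}"

definition quotient_space ::
    "('v, 'm) seminormed_space_scheme \<Rightarrow> 'v set \<Rightarrow> 'v set seminormed_space" where
  "quotient_space V W =
     \<lparr> pts = vcoset V W ` pts V,
       vzero = vcoset V W (vzero V),
       vadd = (\<lambda>A B. \<Union>u\<in>A. \<Union>v\<in>B. vcoset V W (vadd V u v)),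
       vscale = (\<lambda>r A. \<Union>u\<in>A. vcoset V W (vscale V r u)),
       vnorm = (\<lambda>A. Inf (vnorm V ` A)) \<rparr>"

definition linear_between ::
    "('v, 'm) seminormed_space_scheme \<Rightarrow> ('w, 'n) seminormed_space_scheme \<Rightarrow> ('v \<Rightarrow> 'w) \<Rightarrow> bool"
  where
  "linear_between V W f \<longleftrightarrow>
     f \<in> pts V \<rightarrow> pts W \<and>
     (\<forall>u\<in>pts V. \<forall>v\<in>pts V. f (vadd V u v) = vadd W (f u) (f v)) \<and>
     (\<forall>r. \<forall>v\<in>pts V. f (vscale V r v) = vscale W r (f v))"

definition isometric_isomorphism ::
    "('v, 'm) seminormed_space_scheme \<Rightarrow> ('w, 'n) seminormed_space_scheme \<Rightarrow> ('v \<Rightarrow> 'w) \<Rightarrow> bool"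
  where
  "isometric_isomorphism V W f \<longleftrightarrow>
     linear_between V W f \<and> bij_betw f (pts V) (pts W) \<and>
     (\<forall>v\<in>pts V. vnorm W (f v) = vnorm V v)"

text \<open>An isomorphism of seminormed spaces is a linear bijection that is bounded together with its
  inverse.\<close>

definition seminormed_isomorphism ::
    "('v, 'm) seminormed_space_scheme \<Rightarrow> ('w, 'n) seminormed_space_scheme \<Rightarrow> ('v \<Rightarrow> 'w) \<Rightarrow> bool"
  where
  "seminormed_isomorphism V W f \<longleftrightarrow>
     linear_between V W f \<and> bij_betw f (pts V) (pts W) \<and>
     (\<exists>C. \<forall>v\<in>pts V. vnorm W (f v) \<le> C * vnorm V v \<and> vnorm V v \<le> C * vnorm W (f v))"


section \<open>Bounded cohomology of a discrete group\<close>

definition tuples :: "('g, 'm) monoid_scheme \<Rightarrow> nat \<Rightarrow> 'g list set" where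
  "tuples \<Gamma> k = {t. length t = k \<and> set t \<subseteq> carrier \<Gamma>}"

text \<open>The \<open>\<Gamma>\<close>-invariant bounded functions \<open>\<Gamma>\<^sup>n\<^sup>+\<^sup>1 \<rightarrow> V\<close>, with the sup norm. The action on cochains
  is \<open>(\<gamma> \<cdot> c)(t) = \<gamma> \<cdot> c(\<gamma>\<^sup>-\<^sup>1 t)\<close>.\<close>

definition bcochains ::
    "('g, 'm) monoid_scheme \<Rightarrow> ('g, 'v, 'n) normed_module_scheme \<Rightarrow> nat \<Rightarrow>
     ('g list \<Rightarrow> 'v) seminormed_space" where
  "bcochains \<Gamma> V n =
     \<lparr> pts = {c \<in> tuples \<Gamma> (n + 1) \<rightarrow>\<^sub>E pts V.
               (\<exists>C. \<forall>t\<in>tuples \<Gamma> (n + 1). vnorm V (c t) \<le> C) \<and>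
               (\<forall>\<gamma>\<in>carrier \<Gamma>. \<forall>t\<in>tuples \<Gamma> (n + 1).
                  gact V \<gamma> (c (map (\<lambda>h. inv\<^bsub>\<Gamma>\<^esub> \<gamma> \<otimes>\<^bsub>\<Gamma>\<^esub> h) t)) = c t)},
       vzero = (\<lambda>t\<in>tuples \<Gamma> (n + 1). vzero V),
       vadd = (\<lambda>c d. \<lambda>t\<in>tuples \<Gamma> (n + 1). vadd V (c t) (d t)),
       vscale = (\<lambda>r c. \<lambda>t\<in>tuples \<Gamma> (n + 1). vscale V r (c t)),
       vnorm = (\<lambda>c. SUP t\<in>tuples \<Gamma> (n + 1). vnorm V (c t)) \<rparr>"

definition coboundary ::
    "('g, 'm) monoid_scheme \<Rightarrow> ('g, 'v, 'n) normed_module_scheme \<Rightarrow> nat \<Rightarrow>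
     ('g list \<Rightarrow> 'v) \<Rightarrow> 'g list \<Rightarrow> 'v" where
  "coboundary \<Gamma> V n c =
     (\<lambda>t\<in>tuples \<Gamma> (n + 2).
        foldr (\<lambda>i s. vadd V (vscale V ((-1) ^ i) (c (take i t @ drop (Suc i) t))) s)
              [0..<n + 2] (vzero V))"

definition bcocycles ::
    "('g, 'm) monoid_scheme \<Rightarrow> ('g, 'v, 'n) normed_module_scheme \<Rightarrow> nat \<Rightarrow> ('g list \<Rightarrow> 'v) set" where
  "bcocycles \<Gamma> V n =
     {c \<in> pts (bcochains \<Gamma> V n). coboundary \<Gamma> V n c = vzero (bcochains \<Gamma> V (Suc n))}"

definition bcoboundaries ::
    "('g, 'm) monoid_scheme \<Rightarrow> ('g, 'v, 'n) normed_module_scheme \<Rightarrow> nat \<Rightarrow> ('g list \<Rightarrow> 'v) set" where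
  "bcoboundaries \<Gamma> V n =
     (case n of 0 \<Rightarrow> {vzero (bcochains \<Gamma> V 0)}
              | Suc m \<Rightarrow> coboundary \<Gamma> V m ` pts (bcochains \<Gamma> V m))"

definition bounded_cohomology ::
    "('g, 'm) monoid_scheme \<Rightarrow> ('g, 'v, 'n) normed_module_scheme \<Rightarrow> nat \<Rightarrow>
     ('g list \<Rightarrow> 'v) set seminormed_space" where
  "bounded_cohomology \<Gamma> V n =
     quotient_space ((bcochains \<Gamma> V n)\<lparr>pts := bcocycles \<Gamma> V n\<rparr>) (bcoboundaries \<Gamma> V n)"

definition cohomology_class ::
    "('g, 'm) monoid_scheme \<Rightarrow> ('g, 'v, 'n) normed_module_scheme \<Rightarrow> nat \<Rightarrow>
     ('g list \<Rightarrow> 'v) \<Rightarrow> ('g list \<Rightarrow> 'v) set" where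
  "cohomology_class \<Gamma> V n z = vcoset (bcochains \<Gamma> V n) (bcoboundaries \<Gamma> V n) z"

definition cochain_map ::
    "('l, 'm) monoid_scheme \<Rightarrow> ('l, 'v, 'n) normed_module_scheme \<Rightarrow>
     ('g, 'p) monoid_scheme \<Rightarrow> ('g, 'w, 'q) normed_module_scheme \<Rightarrow>
     (nat \<Rightarrow> ('l list \<Rightarrow> 'v) \<Rightarrow> 'g list \<Rightarrow> 'w) \<Rightarrow> bool" where
  "cochain_map \<Lambda> V \<Gamma> W J \<longleftrightarrow>
     (\<forall>n. linear_between (bcochains \<Lambda> V n) (bcochains \<Gamma> W n) (J n)) \<and>
     (\<forall>n. \<forall>c\<in>pts (bcochains \<Lambda> V n).
        coboundary \<Gamma> W n (J n c) = J (Suc n) (coboundary \<Lambda> V n c))"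

definition induced_in_cohomology ::
    "('l, 'm) monoid_scheme \<Rightarrow> ('l, 'v, 'n) normed_module_scheme \<Rightarrow>
     ('g, 'p) monoid_scheme \<Rightarrow> ('g, 'w, 'q) normed_module_scheme \<Rightarrow>
     (nat \<Rightarrow> ('l list \<Rightarrow> 'v) \<Rightarrow> 'g list \<Rightarrow> 'w) \<Rightarrow> nat \<Rightarrow>
     (('l list \<Rightarrow> 'v) set \<Rightarrow> ('g list \<Rightarrow> 'w) set) \<Rightarrow> bool" where
  "induced_in_cohomology \<Lambda> V \<Gamma> W J n \<Phi> \<longleftrightarrow>
     (\<forall>z\<in>bcocycles \<Lambda> V n. \<Phi> (cohomology_class \<Lambda> V n z) = cohomology_class \<Gamma> W n (J n z))"


section \<open>Weak-star measurable essentially bounded functions\<close>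

definition linf_fun :: "'x measure \<Rightarrow> ('x \<Rightarrow> 'e::real_normed_vector \<Rightarrow>\<^sub>L real) set" where
  "linf_fun M = {f. (\<forall>v. (\<lambda>x. blinfun_apply (f x) v) \<in> borel_measurable M) \<and>
                    (\<exists>C. AE x in M. norm (f x) \<le> C)}"

definition ae_class ::
    "'x measure \<Rightarrow> ('x \<Rightarrow> 'e::real_normed_vector \<Rightarrow>\<^sub>L real) \<Rightarrow> ('x \<Rightarrow> 'e \<Rightarrow>\<^sub>L real) set" where
  "ae_class M f = {g \<in> linf_fun M. AE x in M. g x = f x}"

definition rep :: "'a set \<Rightarrow> 'a" where
  "rep A = (SOME f. f \<in> A)"

definition linf_module ::
    "('g, 'm) monoid_scheme \<Rightarrow> 'x measure \<Rightarrow> ('g \<Rightarrow> 'x \<Rightarrow> 'x) \<Rightarrow>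
     ('g \<times> 'x \<Rightarrow> ('e::real_normed_vector \<Rightarrow>\<^sub>L real) \<Rightarrow> ('e \<Rightarrow>\<^sub>L real)) \<Rightarrow>
     ('g, ('x \<Rightarrow> 'e \<Rightarrow>\<^sub>L real) set) normed_module" where
  "linf_module \<Gamma> M a L =
     \<lparr> pts = ae_class M ` linf_fun M,
       vzero = ae_class M (\<lambda>x. 0),
       vadd = (\<lambda>A B. ae_class M (\<lambda>x. rep A x + rep B x)),
       vscale = (\<lambda>r A. ae_class M (\<lambda>x. r *\<^sub>R rep A x)),
       vnorm = (\<lambda>A. Inf {C. 0 \<le> C \<and> (AE x in M. norm (rep A x) \<le> C)}),
       gact = (\<lambda>\<gamma> A. ae_class M (\<lambda>x.
                 L (\<gamma>, a (inv\<^bsub>\<Gamma>\<^esub> \<gamma>) x) (rep A (a (inv\<^bsub>\<Gamma>\<^esub> \<gamma>) x)))) \<rparr>"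


section \<open>Orbit equivalence\<close>

text \<open>The measures may live on subsets of the spaces acted upon: since \<open>X'\<close> and \<open>Y'\<close> are contained in
  the spaces of \<open>M\<close> and \<open>N\<close>, the orbits are then automatically intersected with these subsets.\<close>

definition orbit_equivalence ::
    "('g, 'm) monoid_scheme \<Rightarrow> 'x measure \<Rightarrow> ('g \<Rightarrow> 'x \<Rightarrow> 'x) \<Rightarrow>
     ('l, 'n) monoid_scheme \<Rightarrow> 'y measure \<Rightarrow> ('l \<Rightarrow> 'y \<Rightarrow> 'y) \<Rightarrow> ('x \<Rightarrow> 'y) \<Rightarrow> bool" where
  "orbit_equivalence \<Gamma> M a \<Lambda> N b T \<longleftrightarrow>
     T \<in> measurable M N \<and> distr M N T = N \<and>
     (\<exists>X'\<in>sets M. \<exists>Y'\<in>sets N.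
        (AE x in M. x \<in> X') \<and> (AE y in N. y \<in> Y') \<and>
        bij_betw T X' Y' \<and>
        the_inv_into X' T \<in> measurable (restrict_space N Y') (restrict_space M X') \<and>
        (\<forall>x\<in>X'. T ` (orbit \<Gamma> a x \<inter> X') = orbit \<Lambda> b (T x) \<inter> Y'))"

definition normalized_restriction :: "'x measure \<Rightarrow> 'x set \<Rightarrow> 'x measure" where
  "normalized_restriction M U = scale_measure (1 / emeasure M U) (restrict_space M U)"

definition weak_orbit_equivalence ::
    "('g, 'm) monoid_scheme \<Rightarrow> 'x measure \<Rightarrow> ('g \<Rightarrow> 'x \<Rightarrow> 'x) \<Rightarrow> 'x set \<Rightarrow>
     ('l, 'n) monoid_scheme \<Rightarrow> 'y measure \<Rightarrow> ('l \<Rightarrow> 'y \<Rightarrow> 'y) \<Rightarrow> 'y set \<Rightarrow> ('x \<Rightarrow> 'y) \<Rightarrow> bool" where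
  "weak_orbit_equivalence \<Gamma> M a U \<Lambda> N b V T \<longleftrightarrow>
     U \<in> sets M \<and> V \<in> sets N \<and> emeasure M U > 0 \<and> emeasure N V > 0 \<and>
     orbit_equivalence \<Gamma> (normalized_restriction M U) a \<Lambda> (normalized_restriction N V) b T"

text \<open>The cocycle is determined up to null sets; where no unique value exists it is set to the unit.\<close>

definition oe_cocycle ::
    "('g \<Rightarrow> 'x \<Rightarrow> 'x) \<Rightarrow> ('l, 'n) monoid_scheme \<Rightarrow> ('l \<Rightarrow> 'y \<Rightarrow> 'y) \<Rightarrow> ('x \<Rightarrow> 'y) \<Rightarrow>
     'g \<Rightarrow> 'x \<Rightarrow> 'l" where
  "oe_cocycle a \<Lambda> b T \<gamma> x =
     (if \<exists>!l. l \<in> carrier \<Lambda> \<and> T (a \<gamma> x) = b l (T x)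
      then THE l. l \<in> carrier \<Lambda> \<and> T (a \<gamma> x) = b l (T x) else \<one>\<^bsub>\<Lambda>\<^esub>)"

definition oe_groupoid_map ::
    "('g \<Rightarrow> 'x \<Rightarrow> 'x) \<Rightarrow> ('l, 'n) monoid_scheme \<Rightarrow> ('l \<Rightarrow> 'y \<Rightarrow> 'y) \<Rightarrow> ('x \<Rightarrow> 'y) \<Rightarrow>
     'g \<times> 'x \<Rightarrow> 'l \<times> 'y" where
  "oe_groupoid_map a \<Lambda> b T g = (oe_cocycle a \<Lambda> b T (fst g) (snd g), T (snd g))"

definition oe_cochain_map ::
    "('g, 'm) monoid_scheme \<Rightarrow> 'x measure \<Rightarrow> ('g \<Rightarrow> 'x \<Rightarrow> 'x) \<Rightarrow>
     ('l, 'n) monoid_scheme \<Rightarrow> ('l \<Rightarrow> 'y \<Rightarrow> 'y) \<Rightarrow> ('x \<Rightarrow> 'y) \<Rightarrow> nat \<Rightarrow>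
     ('l list \<Rightarrow> ('y \<Rightarrow> 'e::real_normed_vector \<Rightarrow>\<^sub>L real) set) \<Rightarrow>
     'g list \<Rightarrow> ('x \<Rightarrow> 'e \<Rightarrow>\<^sub>L real) set" where
  "oe_cochain_map \<Gamma> M a \<Lambda> b T n \<theta> =
     (\<lambda>t\<in>tuples \<Gamma> (n + 1). ae_class M (\<lambda>x.
        rep (\<theta> (map (\<lambda>\<gamma>. oe_cocycle a \<Lambda> b T \<gamma> (a (inv\<^bsub>\<Gamma>\<^esub> \<gamma>) x)) t)) (T x)))"

definition return_map ::
    "('g, 'm) monoid_scheme \<Rightarrow> 'x measure \<Rightarrow> ('g \<Rightarrow> 'x \<Rightarrow> 'x) \<Rightarrow> 'x set \<Rightarrow> ('x \<Rightarrow> 'g \<times> 'x) \<Rightarrow> bool"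
  where
  "return_map \<Gamma> M a U \<theta> \<longleftrightarrow>
     \<theta> \<in> measurable M (gd_measure \<Gamma> M) \<and>
     (AE x in M. gd_source (\<theta> x) = x \<and> gd_target a (\<theta> x) \<in> U)"

definition weak_oe_groupoid_map ::
    "('g, 'm) monoid_scheme \<Rightarrow> ('g \<Rightarrow> 'x \<Rightarrow> 'x) \<Rightarrow>
     ('l, 'n) monoid_scheme \<Rightarrow> ('l \<Rightarrow> 'y \<Rightarrow> 'y) \<Rightarrow> ('x \<Rightarrow> 'y) \<Rightarrow> ('x \<Rightarrow> 'g \<times> 'x) \<Rightarrow>
     'g \<times> 'x \<Rightarrow> 'l \<times> 'y" where
  "weak_oe_groupoid_map \<Gamma> a \<Lambda> b T \<theta> g =
     oe_groupoid_map a \<Lambda> b T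
       (gd_mult \<Gamma> (gd_mult \<Gamma> (\<theta> (gd_target a g)) g) (gd_inv \<Gamma> a (\<theta> (gd_source g))))"

end

theory Submission
  imports Defs
begin

text \<open>By essential freeness, an invariant bounded cochain \<open>c\<close> is an equivariant family
  \<open>F(x; x\<^sub>0, \<dots>, x\<^sub>n)\<close> indexed by points of one orbit, via
  \<open>c(\<gamma>\<^sub>0, \<dots>, \<gamma>\<^sub>n)(x) = F(x; \<gamma>\<^sub>0\<^sup>-\<^sup>1 x, \<dots>, \<gamma>\<^sub>n\<^sup>-\<^sup>1 x)\<close>. Hence a nonsingular
  map \<open>q\<close> sending orbits into orbits induces a norm nonincreasing cochain map
  \<open>J F(x; x\<^sub>0, \<dots>) = F(q x; q x\<^sub>0, \<dots>)\<close>. Given a map \<open>q'\<close> in the other direction such that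
  \<open>q q' y\<close> and \<open>q' q x\<close> stay in the orbits of \<open>y\<close> and \<open>x\<close>, transporting values along the arrow from
  \<open>q q' y\<close> to \<open>y\<close> gives a cochain map \<open>K\<close> backwards with \<open>K J F(y; y\<^sub>0, \<dots>) = F(y; q q' y\<^sub>0, \<dots>)\<close>,
  which the prism operator contracts to the identity; the same holds for \<open>J K\<close>. So \<open>J\<close> is an
  isometric isomorphism in cohomology. For an orbit equivalence take \<open>q = T\<close> and \<open>q' = T\<^sup>-\<^sup>1\<close>; for a
  weak orbit equivalence \<open>U \<rightarrow> V\<close>, precompose them with maps moving each point within its orbit into
  \<open>U\<close> resp. \<open>V\<close>, the latter provided by ergodicity.\<close>

section \<open>Alternating sums and the prism operator\<close>

text \<open>The picture of points in an orbit makes sense only off a null set, whereas cochains take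
  values in classes of functions and \<open>J\<close> evaluates them at a tuple that itself varies
  with the point. Countability of the groups reconciles the two: one null set serves all tuples and
  all group elements at once and can be made invariant, and a tuple depending measurably on the
  point selects among countably many functions. So everything is computed on representatives at a
  fixed good point, where only algebra remains. Why the isomorphism is isometric: \<open>J\<close>
  is an evaluation, \<open>K\<close> is an evaluation followed by precomposition with an isometry,
  and mutually inverse norm nonincreasing maps preserve the norm. The measures of \<open>U\<close>
  and \<open>V\<close> never enter an essential supremum. The homotopy must respect invariance. It
  replaces an entry \<open>h\<close>, which stands for the point \<open>inv h\<close> applied to
  \<open>y\<close>, by one standing for the image of that same point under \<open>q\<close> after
  \<open>q'\<close>; the rule depends on the point and not on \<open>y\<close>, hence is
  equivariant.\<close>

primrec altsum :: "('a list \<Rightarrow> 'v::real_vector) \<Rightarrow> 'a list \<Rightarrow> 'v" where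
  "altsum F [] = 0"
| "altsum F (x # xs) = F xs - altsum (\<lambda>s. F (x # s)) xs"

text \<open>The usual triangulation of the prism between the identity and \<open>p\<close>: term
  \<open>i\<close> keeps the entries up to \<open>i\<close>, repeats entry \<open>i\<close> under
  \<open>p\<close> and applies \<open>p\<close> to the rest. Like \<open>altsum\<close>, which is
  the simplicial coboundary expanded along the first entry, it is recursive so that linearity,
  bounds and the homotopy identity are inductions on the list.\<close>

primrec prism :: "('a \<Rightarrow> 'a) \<Rightarrow> ('a list \<Rightarrow> 'v::real_vector) \<Rightarrow> 'a list \<Rightarrow> 'v" where
  "prism p F [] = 0"
| "prism p F (x # xs) = F (x # p x # map p xs) - prism p (\<lambda>s. F (x # s)) xs"

lemma altsum_linear:
  assumes "linear A"
  shows "A (altsum F t) = altsum (\<lambda>s. A (F s)) t"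
  by (induction t arbitrary: F) (simp_all add: linear_0[OF assms] linear_diff[OF assms])

lemma prism_linear:
  assumes "linear A"
  shows "A (prism p F t) = prism p (\<lambda>s. A (F s)) t"
  by (induction t arbitrary: F) (simp_all add: linear_0[OF assms] linear_diff[OF assms])

lemma altsum_zero: "altsum (\<lambda>s. 0) t = 0"
  by (induction t) simp_all

lemma prism_zero: "prism p (\<lambda>s. 0) t = 0"
  by (induction t) simp_all

lemma altsum_add: "altsum (\<lambda>s. F s + G s) t = altsum F t + altsum G t"
  by (induction t arbitrary: F G) simp_all

lemma altsum_diff: "altsum (\<lambda>s. F s - G s) t = altsum F t - altsum G t"
  by (induction t arbitrary: F G) simp_all

lemma prism_diff: "prism p (\<lambda>s. F s - G s) t = prism p F t - prism p G t"
  by (induction t arbitrary: F G) simp_all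

lemma altsum_scaleR: "altsum (\<lambda>s. r *\<^sub>R F s) t = r *\<^sub>R altsum F t"
  by (induction t arbitrary: F) (simp_all add: scaleR_diff_right)

lemma altsum_cong:
  assumes "\<And>s. Suc (length s) = length t \<Longrightarrow> set s \<subseteq> set t \<Longrightarrow> F s = G s"
  shows "altsum F t = altsum G t"
  using assms
proof (induction t arbitrary: F G)
  case (Cons x t)
  have "F t = G t"
    by (rule Cons.prems) auto
  moreover have "altsum (\<lambda>s. F (x # s)) t = altsum (\<lambda>s. G (x # s)) t"
    by (rule Cons.IH, rule Cons.prems) auto
  ultimately show ?case
    by simp
qed simp

lemma prism_cong:
  assumes "\<And>s. length s = Suc (length t) \<Longrightarrow> set s \<subseteq> set t \<union> p ` set t \<Longrightarrow> F s = G s"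
  shows "prism p F t = prism p G t"
  using assms
proof (induction t arbitrary: F G)
  case (Cons x t)
  have "F (x # p x # map p t) = G (x # p x # map p t)"
    by (rule Cons.prems) auto
  moreover have "prism p (\<lambda>s. F (x # s)) t = prism p (\<lambda>s. G (x # s)) t"
    by (rule Cons.IH, rule Cons.prems) auto
  ultimately show ?case
    by simp
qed simp

lemma prism_eq_sum:
  "prism p F t = (\<Sum>i<length t. (-1) ^ i *\<^sub>R F (take (Suc i) t @ map p (drop i t)))"
proof (induction t arbitrary: F)
  case (Cons x t)
  have "(\<Sum>i<length (x # t). (-1) ^ i *\<^sub>R F (take (Suc i) (x # t) @ map p (drop i (x # t)))) =
      F (x # p x # map p t) - (\<Sum>i<length t. (-1) ^ i *\<^sub>R F (x # take (Suc i) t @ map p (drop i t)))"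
    by (simp add: sum.lessThan_Suc_shift sum_negf del: sum.lessThan_Suc)
  then show ?case
    by (simp add: Cons.IH)
qed simp

lemma altsum_map: "altsum F (map f t) = altsum (\<lambda>s. F (map f s)) t"
  by (induction t arbitrary: F) simp_all

text \<open>Turns equivariance of the moving map under a translation \<open>m\<close> into
  invariance of the prism operator. Two maps \<open>p\<close> and \<open>p'\<close> occur because
  the moving map will depend on the base point.\<close>

lemma prism_map:
  assumes "\<And>h. h \<in> set t \<Longrightarrow> p' (m h) = m (p h)"
  shows "prism p' F (map m t) = prism p (\<lambda>s. F (map m s)) t"
  using assms by (induction t arbitrary: F) (simp_all add: comp_def cong: map_cong)

lemma altsum_eq_sum:
  "altsum F t = (\<Sum>i<length t. (-1) ^ i *\<^sub>R F (take i t @ drop (Suc i) t))"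
proof (induction t arbitrary: F)
  case (Cons x t)
  have "(\<Sum>i<length (x # t). (-1) ^ i *\<^sub>R F (take i (x # t) @ drop (Suc i) (x # t))) =
      F t - (\<Sum>i<length t. (-1) ^ i *\<^sub>R F (x # take i t @ drop (Suc i) t))"
    by (simp add: sum.lessThan_Suc_shift sum_negf del: sum.lessThan_Suc)
  then show ?case
    by (simp add: Cons.IH)
qed simp

lemma norm_altsum_le:
  fixes F :: "'a list \<Rightarrow> 'v::real_normed_vector"
  assumes "\<And>s. Suc (length s) = length t \<Longrightarrow> set s \<subseteq> set t \<Longrightarrow> norm (F s) \<le> C"
  shows "norm (altsum F t) \<le> real (length t) * C"
  using assms
proof (induction t arbitrary: F)
  case (Cons x t)
  have "norm (F t) \<le> C"
    by (rule Cons.prems) auto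
  moreover have "norm (altsum (\<lambda>s. F (x # s)) t) \<le> real (length t) * C"
    by (rule Cons.IH, rule Cons.prems) auto
  ultimately show ?case
    using norm_triangle_ineq4[of "F t" "altsum (\<lambda>s. F (x # s)) t"] by (simp add: algebra_simps)
qed simp

lemma norm_prism_le:
  fixes F :: "'a list \<Rightarrow> 'v::real_normed_vector"
  assumes "\<And>s. length s = Suc (length t) \<Longrightarrow> set s \<subseteq> set t \<union> p ` set t \<Longrightarrow> norm (F s) \<le> C"
  shows "norm (prism p F t) \<le> real (length t) * C"
  using assms
proof (induction t arbitrary: F)
  case (Cons x t)
  have "norm (F (x # p x # map p t)) \<le> C"
    by (rule Cons.prems) auto
  moreover have "norm (prism p (\<lambda>s. F (x # s)) t) \<le> real (length t) * C"
    by (rule Cons.IH, rule Cons.prems) auto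
  ultimately show ?case
    using norm_triangle_ineq4[of "F (x # p x # map p t)" "prism p (\<lambda>s. F (x # s)) t"]
    by (simp add: algebra_simps)
qed simp

text \<open>In the induction step the hypothesis for \<open>F\<close> with \<open>x\<close> put in
  front contributes \<open>F (x # map p t) - F (x # t)\<close>. The two copies of
  \<open>prism p F t\<close> cancel, and so do the two alternating sums over lists starting with
  \<open>x # p x\<close>, by \<open>altsum_map\<close>.\<close>

lemma prism_homotopy:
  "altsum (prism p F) t + prism p (altsum F) t = F (map p t) - F t"
proof (induction t arbitrary: F)
  case (Cons x t)
  show ?case
    using Cons.IH[of "\<lambda>s. F (x # s)"]
    by (simp add: altsum_diff prism_diff altsum_map algebra_simps)
qed simp


section \<open>Quotients of seminormed spaces\<close>

text \<open>The vector space laws behind coset arithmetic. Non-negativity bounds from below the sets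
  whose \<open>Inf\<close> is the quotient norm.\<close>

locale seminormed_carrier =
  fixes V :: "('v, 'm) seminormed_space_scheme"
  assumes zero_closed: "vzero V \<in> pts V"
    and add_closed: "\<lbrakk>u \<in> pts V; v \<in> pts V\<rbrakk> \<Longrightarrow> vadd V u v \<in> pts V"
    and scale_closed: "u \<in> pts V \<Longrightarrow> vscale V r u \<in> pts V"
    and add_assoc: "\<lbrakk>u \<in> pts V; v \<in> pts V; w \<in> pts V\<rbrakk> \<Longrightarrow>
      vadd V (vadd V u v) w = vadd V u (vadd V v w)"
    and add_comm: "\<lbrakk>u \<in> pts V; v \<in> pts V\<rbrakk> \<Longrightarrow> vadd V u v = vadd V v u"
    and add_zero: "u \<in> pts V \<Longrightarrow> vadd V u (vzero V) = u"
    and add_neg: "u \<in> pts V \<Longrightarrow> vadd V u (vscale V (-1) u) = vzero V"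
    and scale_add: "\<lbrakk>u \<in> pts V; v \<in> pts V\<rbrakk> \<Longrightarrow>
      vscale V r (vadd V u v) = vadd V (vscale V r u) (vscale V r v)"
    and norm_nonneg: "u \<in> pts V \<Longrightarrow> 0 \<le> vnorm V u"
begin

definition subspace_of :: "'v set \<Rightarrow> bool" where
  "subspace_of W \<longleftrightarrow> W \<subseteq> pts V \<and> vzero V \<in> W \<and>
     (\<forall>u\<in>W. \<forall>v\<in>W. vadd V u v \<in> W) \<and> (\<forall>r. \<forall>u\<in>W. vscale V r u \<in> W)"

lemma vcoset_self: "\<lbrakk>subspace_of W; u \<in> pts V\<rbrakk> \<Longrightarrow> u \<in> vcoset V W u"
  unfolding vcoset_def subspace_of_def using add_zero by (metis (mono_tags, lifting) mem_Collect_eq)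

lemma vcoset_add_right:
  assumes W: "subspace_of W" and u: "u \<in> pts V" and w: "w \<in> W"
  shows "vcoset V W (vadd V u w) = vcoset V W u"
proof -
  have wV: "w \<in> pts V" and WV: "W \<subseteq> pts V"
    using W w by (auto simp: subspace_of_def)
  have "vadd V (vadd V u w) w' \<in> vcoset V W u" if "w' \<in> W" for w'
    using add_assoc[OF u wV, of w'] that W WV w unfolding vcoset_def subspace_of_def by auto
  moreover have "vadd V u w' \<in> vcoset V W (vadd V u w)" if "w' \<in> W" for w'
  proof -
    define w'' where "w'' = vadd V (vscale V (-1) w) w'"
    have n: "vscale V (-1) w \<in> W"
      using W w by (auto simp: subspace_of_def)
    then have "w'' \<in> W"
      using W that unfolding w''_def subspace_of_def by blast
    moreover have "vadd V (vadd V u w) w'' = vadd V u w'"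
    proof -
      have w'V: "w' \<in> pts V" and nV: "vscale V (-1) w \<in> pts V"
        using that n WV by auto
      have "vadd V w w'' = vadd V (vadd V w (vscale V (-1) w)) w'"
        unfolding w''_def by (rule add_assoc[OF wV nV w'V, symmetric])
      also have "\<dots> = w'"
        using add_neg[OF wV] add_comm[OF zero_closed w'V] add_zero[OF w'V] by simp
      finally show ?thesis
        using add_assoc[OF u wV, of w''] \<open>w'' \<in> W\<close> WV by auto
    qed
    ultimately show ?thesis
      unfolding vcoset_def by (metis (mono_tags, lifting) mem_Collect_eq)
  qed
  ultimately show ?thesis
    by (auto simp: vcoset_def)
qed

text \<open>The left side is how \<open>quotient_space\<close> adds two cosets without choosing
  representatives: all members of the union are the same coset, and the union is not empty.\<close>

lemma vcoset_add:
  assumes W: "subspace_of W" and u: "u \<in> pts V" and v: "v \<in> pts V"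
  shows "(\<Union>x\<in>vcoset V W u. \<Union>y\<in>vcoset V W v. vcoset V W (vadd V x y)) = vcoset V W (vadd V u v)"
proof -
  have "vcoset V W (vadd V x y) = vcoset V W (vadd V u v)"
    if "x \<in> vcoset V W u" "y \<in> vcoset V W v" for x y
  proof -
    from that obtain w w' where w: "w \<in> W" "x = vadd V u w" and w': "w' \<in> W" "y = vadd V v w'"
      unfolding vcoset_def by blast
    have V: "w \<in> pts V" "w' \<in> pts V" and ww': "vadd V w w' \<in> W"
      using w w' W by (auto simp: subspace_of_def)
    have "vadd V x y = vadd V u (vadd V w (vadd V v w'))"
      unfolding w w' using u v V by (simp add: add_assoc add_closed)
    also have "vadd V w (vadd V v w') = vadd V (vadd V w v) w'"
      using v V by (simp add: add_assoc)
    also have "\<dots> = vadd V v (vadd V w w')"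
      using v V by (simp add: add_comm[of w v] add_assoc)
    also have "vadd V u \<dots> = vadd V (vadd V u v) (vadd V w w')"
      using u v V by (simp add: add_assoc add_closed)
    finally show ?thesis
      using vcoset_add_right[OF W add_closed[OF u v] ww'] by simp
  qed
  then show ?thesis
    using vcoset_self[OF W u] vcoset_self[OF W v] by blast
qed

lemma vcoset_scale:
  assumes W: "subspace_of W" and u: "u \<in> pts V"
  shows "(\<Union>x\<in>vcoset V W u. vcoset V W (vscale V r x)) = vcoset V W (vscale V r u)"
proof -
  have "vcoset V W (vscale V r x) = vcoset V W (vscale V r u)" if "x \<in> vcoset V W u" for x
  proof -
    from that obtain w where w: "w \<in> W" "x = vadd V u w"
      unfolding vcoset_def by blast
    then have "w \<in> pts V" "vscale V r w \<in> W"
      using W by (auto simp: subspace_of_def)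
    then show ?thesis
      using w vcoset_add_right[OF W scale_closed[OF u]] by (simp add: scale_add u)
  qed
  then show ?thesis
    using vcoset_self[OF W u] by blast
qed

end

text \<open>\<open>J\<close> sends every representative of a class to a representative of the image
  class with no larger norm, so the induced map does not increase the infimum. The same holds for
  \<open>K\<close>, and the two induced maps are mutually inverse; hence both preserve the
  seminorm.\<close>

lemma homotopy_inverse_isometric:
  fixes V :: "'v seminormed_space" and V' :: "'w seminormed_space"
  assumes V: "seminormed_carrier V" and V': "seminormed_carrier V'"
    and Z: "seminormed_carrier.subspace_of V Z" and B: "seminormed_carrier.subspace_of V B"
    and Z': "seminormed_carrier.subspace_of V' Z'" and B': "seminormed_carrier.subspace_of V' B'"
    and J: "linear_between V V' J" "J ` Z \<subseteq> Z'" "J ` B \<subseteq> B'"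
      "\<And>v. v \<in> pts V \<Longrightarrow> vnorm V' (J v) \<le> vnorm V v"
    and K: "linear_between V' V K" "K ` Z' \<subseteq> Z" "K ` B' \<subseteq> B"
      "\<And>v. v \<in> pts V' \<Longrightarrow> vnorm V (K v) \<le> vnorm V' v"
    and KJ: "\<And>z. z \<in> Z \<Longrightarrow> K (J z) \<in> vcoset V B z"
    and JK: "\<And>z. z \<in> Z' \<Longrightarrow> J (K z) \<in> vcoset V' B' z"
  shows "\<exists>\<Phi>. isometric_isomorphism (quotient_space (V\<lparr>pts := Z\<rparr>) B)
                 (quotient_space (V'\<lparr>pts := Z'\<rparr>) B') \<Phi> \<and>
             (\<forall>z\<in>Z. \<Phi> (vcoset V B z) = vcoset V' B' (J z))"
proof -
  interpret V: seminormed_carrier V by fact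
  interpret V': seminormed_carrier V' by fact
  have ZV: "Z \<subseteq> pts V" and BV: "B \<subseteq> pts V" and ZV': "Z' \<subseteq> pts V'" and BV': "B' \<subseteq> pts V'"
    using Z B Z' B' by (auto simp: V.subspace_of_def V'.subspace_of_def)
  have JV: "J v \<in> pts V'" if "v \<in> pts V" for v
    using J(1) that by (auto simp: linear_between_def)
  have KV: "K v \<in> pts V" if "v \<in> pts V'" for v
    using K(1) that by (auto simp: linear_between_def)
  have Jcos: "J x \<in> vcoset V' B' (J z)" if "z \<in> pts V" "x \<in> vcoset V B z" for x z
  proof -
    from that obtain w where w: "w \<in> B" "x = vadd V z w"
      unfolding vcoset_def by blast
    then have "J x = vadd V' (J z) (J w)"
      using that J(1) BV by (auto simp: linear_between_def)
    then show ?thesis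
      using J(3) w by (auto simp: vcoset_def)
  qed
  have Kcos: "K x \<in> vcoset V B (K z)" if "z \<in> pts V'" "x \<in> vcoset V' B' z" for x z
  proof -
    from that obtain w where w: "w \<in> B'" "x = vadd V' z w"
      unfolding vcoset_def by blast
    then have "K x = vadd V (K z) (K w)"
      using that K(1) BV' by (auto simp: linear_between_def)
    then show ?thesis
      using K(3) w by (auto simp: vcoset_def)
  qed
  have eqV: "vcoset V B x = vcoset V B z" if "z \<in> pts V" "x \<in> vcoset V B z" for x z
  proof -
    from that obtain w where "w \<in> B" "x = vadd V z w"
      unfolding vcoset_def by blast
    then show ?thesis
      using V.vcoset_add_right[OF B that(1)] by simp
  qed
  have eqV': "vcoset V' B' x = vcoset V' B' z" if "z \<in> pts V'" "x \<in> vcoset V' B' z" for x z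
  proof -
    from that obtain w where "w \<in> B'" "x = vadd V' z w"
      unfolding vcoset_def by blast
    then show ?thesis
      using V'.vcoset_add_right[OF B' that(1)] by simp
  qed
  \<comment> \<open>Taking the union over the whole coset gives the induced map with no choice of
    representative; \<open>Jcos\<close> shows that all members of the union agree.\<close>
  define \<Phi> where "\<Phi> A = (\<Union>z\<in>A. vcoset V' B' (J z))" for A
  define \<Psi> where "\<Psi> A = (\<Union>z\<in>A. vcoset V B (K z))" for A
  have \<Phi>: "\<Phi> (vcoset V B z) = vcoset V' B' (J z)" if "z \<in> pts V" for z
    unfolding \<Phi>_def using eqV'[OF JV[OF that] Jcos[OF that]] V.vcoset_self[OF B that] by blast
  have \<Psi>: "\<Psi> (vcoset V' B' z) = vcoset V B (K z)" if "z \<in> pts V'" for z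
    unfolding \<Psi>_def using eqV[OF KV[OF that] Kcos[OF that]] V'.vcoset_self[OF B' that] by blast
  let ?Q = "quotient_space (V\<lparr>pts := Z\<rparr>) B" and ?Q' = "quotient_space (V'\<lparr>pts := Z'\<rparr>) B'"
  have cosV: "vcoset (V\<lparr>pts := Z\<rparr>) B = vcoset V B"
    by (rule ext) (simp add: vcoset_def)
  have cosV': "vcoset (V'\<lparr>pts := Z'\<rparr>) B' = vcoset V' B'"
    by (rule ext) (simp add: vcoset_def)
  have pQ: "pts ?Q = vcoset V B ` Z" and pQ': "pts ?Q' = vcoset V' B' ` Z'"
    by (simp_all add: quotient_space_def cosV cosV')
  have addQ: "vadd ?Q (vcoset V B u) (vcoset V B v) = vcoset V B (vadd V u v)"
    if "u \<in> pts V" "v \<in> pts V" for u v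
    using V.vcoset_add[OF B that] by (simp add: quotient_space_def cosV)
  have addQ': "vadd ?Q' (vcoset V' B' u) (vcoset V' B' v) = vcoset V' B' (vadd V' u v)"
    if "u \<in> pts V'" "v \<in> pts V'" for u v
    using V'.vcoset_add[OF B' that] by (simp add: quotient_space_def cosV')
  have scQ: "vscale ?Q r (vcoset V B u) = vcoset V B (vscale V r u)" if "u \<in> pts V" for r u
    using V.vcoset_scale[OF B that] by (simp add: quotient_space_def cosV)
  have scQ': "vscale ?Q' r (vcoset V' B' u) = vcoset V' B' (vscale V' r u)" if "u \<in> pts V'" for r u
    using V'.vcoset_scale[OF B' that] by (simp add: quotient_space_def cosV')
  have \<Psi>\<Phi>: "\<Psi> (\<Phi> A) = A" if "A \<in> pts ?Q" for A
  proof -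
    from that pQ obtain z where z: "z \<in> Z" "A = vcoset V B z"
      by auto
    then show ?thesis
      using ZV JV[of z] eqV[OF _ KJ[of z]] by (auto simp: \<Phi> \<Psi>)
  qed
  have \<Phi>\<Psi>: "\<Phi> (\<Psi> A) = A" if "A \<in> pts ?Q'" for A
  proof -
    from that pQ' obtain z where z: "z \<in> Z'" "A = vcoset V' B' z"
      by auto
    then show ?thesis
      using ZV' KV[of z] eqV'[OF _ JK[of z]] by (auto simp: \<Phi> \<Psi>)
  qed
  have \<Phi>Q: "\<Phi> A \<in> pts ?Q'" if "A \<in> pts ?Q" for A
    using that J(2) ZV unfolding pQ pQ' by (auto simp: \<Phi> subset_eq)
  have \<Psi>Q: "\<Psi> A \<in> pts ?Q" if "A \<in> pts ?Q'" for A
    using that K(2) ZV' unfolding pQ pQ' by (auto simp: \<Psi> subset_eq)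
  have lin: "linear_between ?Q ?Q' \<Phi>"
    unfolding linear_between_def
  proof (intro conjI ballI allI)
    show "\<Phi> \<in> pts ?Q \<rightarrow> pts ?Q'"
      using \<Phi>Q by auto
    fix A assume "A \<in> pts ?Q"
    then obtain u where u: "u \<in> pts V" "A = vcoset V B u"
      using pQ ZV by auto
    show "\<Phi> (vscale ?Q r A) = vscale ?Q' r (\<Phi> A)" for r
      using u J(1) by (simp add: scQ scQ' \<Phi> JV V.scale_closed linear_between_def)
    fix A' assume "A' \<in> pts ?Q"
    then obtain v where v: "v \<in> pts V" "A' = vcoset V B v"
      using pQ ZV by auto
    show "\<Phi> (vadd ?Q A A') = vadd ?Q' (\<Phi> A) (\<Phi> A')"
      using u v J(1) by (simp add: addQ addQ' \<Phi> JV V.add_closed linear_between_def)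
  qed
  have bij: "bij_betw \<Phi> (pts ?Q) (pts ?Q')"
    by (rule bij_betwI[where g = \<Psi>]) (use \<Phi>Q \<Psi>Q \<Psi>\<Phi> \<Phi>\<Psi> in auto)
  have nQ: "vnorm ?Q A = Inf (vnorm V ` A)" and nQ': "vnorm ?Q' A' = Inf (vnorm V' ` A')" for A A'
    by (simp_all add: quotient_space_def)
  have cosV_sub: "vcoset V B z \<subseteq> pts V" if "z \<in> pts V" for z
    using that BV by (auto simp: vcoset_def V.add_closed)
  have cosV'_sub: "vcoset V' B' z \<subseteq> pts V'" if "z \<in> pts V'" for z
    using that BV' by (auto simp: vcoset_def V'.add_closed)
  have le1: "vnorm ?Q' (\<Phi> A) \<le> vnorm ?Q A" if A: "A \<in> pts ?Q" for A
  proof -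
    obtain z where z: "z \<in> pts V" "A = vcoset V B z"
      using A pQ ZV by auto
    have bdd: "bdd_below (vnorm V' ` vcoset V' B' (J z))"
      by (rule bdd_belowI[of _ 0]) (use cosV'_sub[OF JV[OF z(1)]] V'.norm_nonneg in auto)
    show ?thesis
      unfolding nQ nQ' z(2) \<Phi>[OF z(1)]
    proof (rule cInf_greatest)
      show "vnorm V ` vcoset V B z \<noteq> {}"
        using V.vcoset_self[OF B z(1)] by auto
      fix r assume "r \<in> vnorm V ` vcoset V B z"
      then obtain x where x: "x \<in> vcoset V B z" "r = vnorm V x"
        by auto
      have "Inf (vnorm V' ` vcoset V' B' (J z)) \<le> vnorm V' (J x)"
        by (rule cInf_lower[OF _ bdd]) (use Jcos[OF z(1) x(1)] in auto)
      also have "\<dots> \<le> r"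
        using J(4)[of x] cosV_sub[OF z(1)] x by auto
      finally show "Inf (vnorm V' ` vcoset V' B' (J z)) \<le> r" .
    qed
  qed
  have le2: "vnorm ?Q (\<Psi> A) \<le> vnorm ?Q' A" if A: "A \<in> pts ?Q'" for A
  proof -
    obtain z where z: "z \<in> pts V'" "A = vcoset V' B' z"
      using A pQ' ZV' by auto
    have bdd: "bdd_below (vnorm V ` vcoset V B (K z))"
      by (rule bdd_belowI[of _ 0]) (use cosV_sub[OF KV[OF z(1)]] V.norm_nonneg in auto)
    show ?thesis
      unfolding nQ nQ' z(2) \<Psi>[OF z(1)]
    proof (rule cInf_greatest)
      show "vnorm V' ` vcoset V' B' z \<noteq> {}"
        using V'.vcoset_self[OF B' z(1)] by auto
      fix r assume "r \<in> vnorm V' ` vcoset V' B' z"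
      then obtain x where x: "x \<in> vcoset V' B' z" "r = vnorm V' x"
        by auto
      have "Inf (vnorm V ` vcoset V B (K z)) \<le> vnorm V (K x)"
        by (rule cInf_lower[OF _ bdd]) (use Kcos[OF z(1) x(1)] in auto)
      also have "\<dots> \<le> r"
        using K(4)[of x] cosV'_sub[OF z(1)] x by auto
      finally show "Inf (vnorm V ` vcoset V B (K z)) \<le> r" .
    qed
  qed
  \<comment> \<open>The reverse inequality is \<open>le2\<close> at \<open>\<Phi> A\<close>, because
    \<open>\<Psi>\<close> brings \<open>\<Phi> A\<close> back to \<open>A\<close>.\<close>
  have "vnorm ?Q' (\<Phi> A) = vnorm ?Q A" if "A \<in> pts ?Q" for A
    using le1[OF that] le2[OF \<Phi>Q[OF that]] \<Psi>\<Phi>[OF that] by simp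
  then have "isometric_isomorphism ?Q ?Q' \<Phi>"
    using lin bij by (simp add: isometric_isomorphism_def)
  then show ?thesis
    using \<Phi> ZV by auto
qed

section \<open>Bounded cochains and their representatives\<close>

lemma linf_fun_zero: "(\<lambda>x. 0) \<in> linf_fun M"
  by (auto simp: linf_fun_def)

lemma linf_fun_add:
  assumes "f \<in> linf_fun M" "g \<in> linf_fun M"
  shows "(\<lambda>x. f x + g x) \<in> linf_fun M"
proof -
  obtain C D where "AE x in M. norm (f x) \<le> C" "AE x in M. norm (g x) \<le> D"
    using assms unfolding linf_fun_def by blast
  then have "AE x in M. norm (f x + g x) \<le> C + D"
    by eventually_elim (meson add_mono norm_triangle_ineq order_trans)
  then show ?thesis
    using assms unfolding linf_fun_def by (fastforce simp: plus_blinfun.rep_eq intro: borel_measurable_add)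
qed

lemma linf_fun_scaleR:
  assumes "f \<in> linf_fun M"
  shows "(\<lambda>x. r *\<^sub>R f x) \<in> linf_fun M"
proof -
  obtain C where "AE x in M. norm (f x) \<le> C"
    using assms unfolding linf_fun_def by blast
  then have "AE x in M. norm (r *\<^sub>R f x) \<le> \<bar>r\<bar> * C"
    by eventually_elim (simp add: mult_left_mono)
  then show ?thesis
    using assms unfolding linf_fun_def by (fastforce simp: scaleR_blinfun.rep_eq intro: borel_measurable_times)
qed

lemma linf_fun_sum:
  assumes "\<And>i. i \<in> I \<Longrightarrow> f i \<in> linf_fun M"
  shows "(\<lambda>x. \<Sum>i\<in>I. f i x) \<in> linf_fun M"
  using assms by (induction I rule: infinite_finite_induct) (auto intro: linf_fun_zero linf_fun_add)

lemma ae_class_cong: "AE x in M. f x = g x \<Longrightarrow> ae_class M f = ae_class M g"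
proof -
  assume eq: "AE x in M. f x = g x"
  have "(AE x in M. h x = f x) \<longleftrightarrow> (AE x in M. h x = g x)" for h
    by (rule eventually_subst) (use eq in \<open>auto elim: eventually_mono\<close>)
  then show ?thesis
    by (simp add: ae_class_def)
qed

lemma ae_class_eq_iff:
  assumes "f \<in> linf_fun M"
  shows "ae_class M g = ae_class M f \<longleftrightarrow> (AE x in M. g x = f x)"
proof
  assume "ae_class M g = ae_class M f"
  moreover have "f \<in> ae_class M f"
    using assms by (simp add: ae_class_def)
  ultimately have "f \<in> ae_class M g"
    by simp
  then show "AE x in M. g x = f x"
    by (auto simp: ae_class_def elim: eventually_mono)
qed (rule ae_class_cong)

lemma rep_ae_class:
  assumes "f \<in> linf_fun M"
  shows "rep (ae_class M f) \<in> linf_fun M" and "AE x in M. rep (ae_class M f) x = f x"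
proof -
  have "f \<in> ae_class M f"
    using assms by (simp add: ae_class_def)
  then have "rep (ae_class M f) \<in> ae_class M f"
    unfolding rep_def by (rule someI[of "\<lambda>h. h \<in> ae_class M f"])
  then show "rep (ae_class M f) \<in> linf_fun M" "AE x in M. rep (ae_class M f) x = f x"
    by (auto simp: ae_class_def)
qed

lemma ae_class_rep:
  assumes "A \<in> ae_class M ` linf_fun M"
  shows "rep A \<in> linf_fun M" and "ae_class M (rep A) = A"
proof -
  obtain f where f: "f \<in> linf_fun M" "A = ae_class M f"
    using assms by blast
  show "rep A \<in> linf_fun M" "ae_class M (rep A) = A"
    using rep_ae_class[OF f(1)] ae_class_eq_iff[OF f(1)] unfolding f(2) by auto
qed

text \<open>The infimum of the essential bounds is itself one: the bounds
  \<open>\<nu> + inverse (real (Suc k))\<close> are countably many, so they hold simultaneously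
  almost everywhere and pass to the limit. Together the three claims characterise the essential
  supremum on any representative.\<close>

lemma linf_module_norm:
  fixes \<Gamma> :: "('g, 'm) monoid_scheme" and M :: "'x measure" and a :: "'g \<Rightarrow> 'x \<Rightarrow> 'x"
    and L :: "'g \<times> 'x \<Rightarrow> ('e::real_normed_vector \<Rightarrow>\<^sub>L real) \<Rightarrow> ('e \<Rightarrow>\<^sub>L real)"
  assumes f: "f \<in> linf_fun M"
  defines "\<nu> \<equiv> vnorm (linf_module \<Gamma> M a L) (ae_class M f)"
  shows "0 \<le> \<nu>" and "AE x in M. norm (f x) \<le> \<nu>"
    and "\<And>C. 0 \<le> C \<Longrightarrow> AE x in M. norm (f x) \<le> C \<Longrightarrow> \<nu> \<le> C"
proof -
  let ?S = "{C. 0 \<le> C \<and> (AE x in M. norm (f x) \<le> C)}"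
  have eq: "AE x in M. rep (ae_class M f) x = f x"
    by (rule rep_ae_class[OF f])
  have "(AE x in M. norm (rep (ae_class M f) x) \<le> C) \<longleftrightarrow> (AE x in M. norm (f x) \<le> C)" for C
    by (rule eventually_subst) (use eq in \<open>auto elim: eventually_mono\<close>)
  then have \<nu>: "\<nu> = Inf ?S"
    by (simp add: \<nu>_def linf_module_def)
  obtain C where "AE x in M. norm (f x) \<le> C"
    using f unfolding linf_fun_def by blast
  then have "AE x in M. norm (f x) \<le> \<bar>C\<bar>"
    by eventually_elim simp
  then have ne: "?S \<noteq> {}"
    by (intro ex_in_conv[THEN iffD1] exI[of _ "\<bar>C\<bar>"]) simp
  have bdd: "bdd_below ?S"
    by (rule bdd_belowI[of _ 0]) auto
  show "0 \<le> \<nu>"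
    unfolding \<nu> by (rule cInf_greatest[OF ne]) auto
  show "\<nu> \<le> C" if "0 \<le> C" "AE x in M. norm (f x) \<le> C" for C
    unfolding \<nu> by (rule cInf_lower[OF _ bdd]) (use that in auto)
  have "AE x in M. norm (f x) \<le> \<nu> + inverse (real (Suc k))" for k
  proof -
    have "Inf ?S < \<nu> + inverse (real (Suc k))"
      by (simp add: \<nu>)
    then obtain C where "C \<in> ?S" "C < \<nu> + inverse (real (Suc k))"
      using cInf_lessD[OF ne] by blast
    then have "AE x in M. norm (f x) \<le> C" and "C < \<nu> + inverse (real (Suc k))"
      by auto
    then show ?thesis
      by (auto elim: eventually_mono)
  qed
  then have "AE x in M. \<forall>k. norm (f x) \<le> \<nu> + inverse (real (Suc k))"
    by (simp add: AE_all_countable)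
  then show "AE x in M. norm (f x) \<le> \<nu>"
  proof eventually_elim
    case (elim x)
    have "(\<lambda>k. \<nu> + inverse (real (Suc k))) \<longlonglongrightarrow> \<nu> + 0"
      by (intro tendsto_intros LIMSEQ_inverse_real_of_nat)
    then show ?case
      using elim by (auto intro: LIMSEQ_le_const)
  qed
qed


section \<open>Actions of countable groups and simultaneous null sets\<close>

locale pmp =
  fixes \<Gamma> :: "('g, 'm) monoid_scheme" (structure) and M :: "'x measure" and a :: "'g \<Rightarrow> 'x \<Rightarrow> 'x"
  assumes pmp: "pmp_action \<Gamma> M a"
begin

sublocale group \<Gamma> + act: group_action \<Gamma> "space M" a + prob_space M
  using pmp by (auto simp: pmp_action_def)

lemma countable_carrier: "countable (carrier \<Gamma>)"
  using pmp by (simp add: pmp_action_def)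

lemma act_measurable: "\<gamma> \<in> carrier \<Gamma> \<Longrightarrow> a \<gamma> \<in> measurable M M"
  using pmp by (simp add: pmp_action_def)

lemma act_closed: "\<lbrakk>\<gamma> \<in> carrier \<Gamma>; x \<in> space M\<rbrakk> \<Longrightarrow> a \<gamma> x \<in> space M"
  using act.element_image by blast

lemma act_mult: "\<lbrakk>\<gamma> \<in> carrier \<Gamma>; \<gamma>' \<in> carrier \<Gamma>; x \<in> space M\<rbrakk> \<Longrightarrow> a (\<gamma> \<otimes> \<gamma>') x = a \<gamma> (a \<gamma>' x)"
  by (rule act.composition_rule)

lemma act_one: "x \<in> space M \<Longrightarrow> a \<one> x = x"
  by (metis act.id_eq_one restrict_apply')

lemma act_inv: "\<lbrakk>\<gamma> \<in> carrier \<Gamma>; x \<in> space M\<rbrakk> \<Longrightarrow> a (inv \<gamma>) (a \<gamma> x) = x"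
  by (rule act.orbit_sym_aux) auto

lemma act_inv': "\<lbrakk>\<gamma> \<in> carrier \<Gamma>; x \<in> space M\<rbrakk> \<Longrightarrow> a \<gamma> (a (inv \<gamma>) x) = x"
  using act_inv[of "inv \<gamma>" x] by simp

lemma AE_act:
  assumes "\<gamma> \<in> carrier \<Gamma>" "AE x in M. P x"
  shows "AE x in M. P (a \<gamma> x)"
proof -
  have "distr M M (a \<gamma>) = M"
    using pmp assms by (simp add: pmp_action_def)
  then have "AE x in distr M M (a \<gamma>). P x"
    using assms by metis
  then show ?thesis
    by (rule AE_distrD[OF act_measurable[OF assms(1)]])
qed

text \<open>Each translation preserves null sets and there are countably many, so a property valid
  almost everywhere is valid along the whole orbit of almost every point. This is how almost
  everywhere hypotheses become invariant ones below.\<close>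

lemma AE_all_act:
  assumes "AE x in M. P x"
  shows "AE x in M. \<forall>\<gamma>\<in>carrier \<Gamma>. P (a \<gamma> x)"
  using assms by (intro AE_ball_countable[THEN iffD2] countable_carrier ballI AE_act)

lemma countable_tuples: "countable (tuples \<Gamma> n)"
  by (rule countable_subset[OF _ countable_lists[OF countable_carrier]]) (auto simp: tuples_def)

lemma AE_all_tuples:
  "(AE x in M. \<forall>t\<in>tuples \<Gamma> n. P t x) \<longleftrightarrow> (\<forall>t\<in>tuples \<Gamma> n. AE x in M. P t x)"
  by (rule AE_ball_countable[OF countable_tuples])

lemma tuples_nonempty: "tuples \<Gamma> n \<noteq> {}"
proof -
  have "replicate n \<one> \<in> tuples \<Gamma> n"
    by (auto simp: tuples_def)
  then show ?thesis
    by blast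
qed

lemma tuples_translate:
  "\<lbrakk>\<gamma> \<in> carrier \<Gamma>; t \<in> tuples \<Gamma> n\<rbrakk> \<Longrightarrow> map (\<lambda>h. \<gamma> \<otimes> h) t \<in> tuples \<Gamma> n"
  by (auto simp: tuples_def)

lemma tuples_map:
  "\<lbrakk>t \<in> tuples H n; \<And>h. h \<in> carrier H \<Longrightarrow> f h \<in> carrier \<Gamma>\<rbrakk> \<Longrightarrow> map f t \<in> tuples \<Gamma> n"
  by (auto simp: tuples_def)

lemma tuples_prism:
  assumes "length s = Suc (length t)" "set s \<subseteq> set t \<union> p ` set t" "t \<in> tuples \<Gamma> n"
    and "\<And>h. h \<in> carrier \<Gamma> \<Longrightarrow> p h \<in> carrier \<Gamma>"
  shows "s \<in> tuples \<Gamma> (Suc n)"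
proof -
  have "set t \<union> p ` set t \<subseteq> carrier \<Gamma>"
    using assms(3,4) by (auto simp: tuples_def)
  then have "set s \<subseteq> carrier \<Gamma>"
    using assms(2) by (rule order_trans[rotated])
  then show ?thesis
    using assms(1,3) by (simp add: tuples_def)
qed

text \<open>Tuples that vary with the point are treated as measurable maps into a countable discrete
  space. Prepending an entry is measurable because a product of two countable discrete spaces is
  again discrete.\<close>

lemma measurable_map_tuples:
  assumes "\<And>h. h \<in> set t \<Longrightarrow> (\<lambda>y. f y h) \<in> measurable N (count_space (carrier \<Gamma>))"
  shows "(\<lambda>y. map (f y) t) \<in> measurable N (count_space (tuples \<Gamma> (length t)))"
  using assms
proof (induction t)
  case Nil
  then show ?case
    by (auto simp: tuples_def)
next
  case (Cons h t)
  have 1: "(\<lambda>y. map (f y) t) \<in> measurable N (count_space (tuples \<Gamma> (length t)))"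
    using Cons by auto
  have "(\<lambda>(g, s). g # s) \<in> measurable (count_space (carrier \<Gamma>) \<Otimes>\<^sub>M count_space (tuples \<Gamma> (length t)))
      (count_space (tuples \<Gamma> (length (h # t))))"
    by (subst pair_measure_countable[OF countable_carrier countable_tuples])
      (auto simp: tuples_def)
  from measurable_compose[OF measurable_Pair[OF Cons.prems[of h] 1] this] show ?case
    by (simp add: comp_def)
qed

end


section \<open>Invariant bounded cochains computed on representatives\<close>

locale pmp_coefficients = pmp \<Gamma> M a
  for \<Gamma> :: "('g, 'm) monoid_scheme" (structure) and M :: "'x measure" and a +
  fixes L :: "'g \<times> 'x \<Rightarrow> ('e::real_normed_vector \<Rightarrow>\<^sub>L real) \<Rightarrow> ('e \<Rightarrow>\<^sub>L real)"
  assumes linear_L: "linear (L g)"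
begin

abbreviation "mdl \<equiv> linf_module \<Gamma> M a L"

text \<open>The counterpart of \<open>bcochains\<close> for honest functions: boundedness and
  invariance are asked almost everywhere for each tuple and group element. \<open>cls\<close> passes
  from here to classes, and \<open>bcochains_cls\<close> shows that every cochain arises in this
  way.\<close>

definition cochain_fun :: "nat \<Rightarrow> ('g list \<Rightarrow> 'x \<Rightarrow> 'e \<Rightarrow>\<^sub>L real) \<Rightarrow> bool" where
  "cochain_fun n f \<longleftrightarrow>
     (\<forall>t\<in>tuples \<Gamma> (Suc n). f t \<in> linf_fun M) \<and>
     (\<exists>C. \<forall>t\<in>tuples \<Gamma> (Suc n). AE x in M. norm (f t x) \<le> C) \<and>
     (\<forall>\<gamma>\<in>carrier \<Gamma>. \<forall>t\<in>tuples \<Gamma> (Suc n). AE x in M.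
        L (\<gamma>, a (inv \<gamma>) x) (f (map (\<lambda>h. inv \<gamma> \<otimes> h) t) (a (inv \<gamma>) x)) = f t x)"

definition cls :: "nat \<Rightarrow> ('g list \<Rightarrow> 'x \<Rightarrow> 'e \<Rightarrow>\<^sub>L real) \<Rightarrow> 'g list \<Rightarrow> ('x \<Rightarrow> 'e \<Rightarrow>\<^sub>L real) set" where
  "cls n f = (\<lambda>t\<in>tuples \<Gamma> (Suc n). ae_class M (f t))"

lemma cochain_fun_linf: "\<lbrakk>cochain_fun n f; t \<in> tuples \<Gamma> (Suc n)\<rbrakk> \<Longrightarrow> f t \<in> linf_fun M"
  by (simp add: cochain_fun_def)

lemma cochain_fun_invariant:
  assumes "cochain_fun n f"
  shows "AE x in M. \<forall>\<gamma>\<in>carrier \<Gamma>. \<forall>t\<in>tuples \<Gamma> (Suc n).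
    L (\<gamma>, a (inv \<gamma>) x) (f (map (\<lambda>h. inv \<gamma> \<otimes> h) t) (a (inv \<gamma>) x)) = f t x"
  using assms unfolding cochain_fun_def
  by (intro AE_ball_countable[THEN iffD2] countable_carrier ballI countable_tuples) auto

lemma cochain_fun_bounded:
  assumes "cochain_fun n f"
  obtains C where "0 \<le> C" "AE x in M. \<forall>t\<in>tuples \<Gamma> (Suc n). norm (f t x) \<le> C"
proof -
  obtain C where C: "\<forall>t\<in>tuples \<Gamma> (Suc n). AE x in M. norm (f t x) \<le> C"
    using assms unfolding cochain_fun_def by blast
  then have "AE x in M. \<forall>t\<in>tuples \<Gamma> (Suc n). norm (f t x) \<le> C"
    by (simp add: AE_all_tuples)
  then have "AE x in M. \<forall>t\<in>tuples \<Gamma> (Suc n). norm (f t x) \<le> \<bar>C\<bar>"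
    by eventually_elim auto
  then show thesis
    using that[of "\<bar>C\<bar>"] by simp
qed

lemma cochain_funI:
  assumes "\<And>t. t \<in> tuples \<Gamma> (Suc n) \<Longrightarrow> f t \<in> linf_fun M"
    and "\<And>t. t \<in> tuples \<Gamma> (Suc n) \<Longrightarrow> AE x in M. norm (f t x) \<le> C"
    and "\<And>\<gamma> t. \<lbrakk>\<gamma> \<in> carrier \<Gamma>; t \<in> tuples \<Gamma> (Suc n)\<rbrakk> \<Longrightarrow> AE x in M.
        L (\<gamma>, a (inv \<gamma>) x) (f (map (\<lambda>h. inv \<gamma> \<otimes> h) t) (a (inv \<gamma>) x)) = f t x"
  shows "cochain_fun n f"
  using assms unfolding cochain_fun_def by blast

lemma cochain_fun_zero: "cochain_fun n (\<lambda>t x. 0)"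
  by (rule cochain_funI[of _ _ 0]) (auto simp: linf_fun_zero linear_0[OF linear_L])

lemma cochain_fun_add:
  assumes f: "cochain_fun n f" and g: "cochain_fun n g"
  shows "cochain_fun n (\<lambda>t x. f t x + g t x)"
proof -
  obtain C where C: "AE x in M. \<forall>t\<in>tuples \<Gamma> (Suc n). norm (f t x) \<le> C"
    using cochain_fun_bounded[OF f] by blast
  obtain D where D: "AE x in M. \<forall>t\<in>tuples \<Gamma> (Suc n). norm (g t x) \<le> D"
    using cochain_fun_bounded[OF g] by blast
  show ?thesis
  proof (rule cochain_funI[of _ _ "C + D"])
    fix t assume t: "t \<in> tuples \<Gamma> (Suc n)"
    show "(\<lambda>x. f t x + g t x) \<in> linf_fun M"
      using t f g by (intro linf_fun_add cochain_fun_linf)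
    from C D show "AE x in M. norm (f t x + g t x) \<le> C + D"
      by eventually_elim (meson t add_mono norm_triangle_ineq order_trans)
    fix \<gamma> assume \<gamma>: "\<gamma> \<in> carrier \<Gamma>"
    from cochain_fun_invariant[OF f] cochain_fun_invariant[OF g]
    show "AE x in M. L (\<gamma>, a (inv \<gamma>) x) (f (map (\<lambda>h. inv \<gamma> \<otimes> h) t) (a (inv \<gamma>) x) +
        g (map (\<lambda>h. inv \<gamma> \<otimes> h) t) (a (inv \<gamma>) x)) = f t x + g t x"
      by eventually_elim (use t \<gamma> in \<open>simp add: linear_add[OF linear_L]\<close>)
  qed
qed

lemma cochain_fun_scaleR:
  assumes f: "cochain_fun n f"
  shows "cochain_fun n (\<lambda>t x. r *\<^sub>R f t x)"
proof -
  obtain C where C: "AE x in M. \<forall>t\<in>tuples \<Gamma> (Suc n). norm (f t x) \<le> C"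
    using cochain_fun_bounded[OF f] by blast
  show ?thesis
  proof (rule cochain_funI[of _ _ "\<bar>r\<bar> * C"])
    fix t assume t: "t \<in> tuples \<Gamma> (Suc n)"
    show "(\<lambda>x. r *\<^sub>R f t x) \<in> linf_fun M"
      using t f by (intro linf_fun_scaleR cochain_fun_linf)
    from C show "AE x in M. norm (r *\<^sub>R f t x) \<le> \<bar>r\<bar> * C"
      by eventually_elim (simp add: t mult_left_mono)
    fix \<gamma> assume \<gamma>: "\<gamma> \<in> carrier \<Gamma>"
    from cochain_fun_invariant[OF f]
    show "AE x in M. L (\<gamma>, a (inv \<gamma>) x) (r *\<^sub>R f (map (\<lambda>h. inv \<gamma> \<otimes> h) t) (a (inv \<gamma>) x)) =
        r *\<^sub>R f t x"
      by eventually_elim (use t \<gamma> in \<open>simp add: linear_scale[OF linear_L]\<close>)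
  qed
qed

lemma tuples_delete:
  "\<lbrakk>t \<in> tuples \<Gamma> (Suc (Suc n)); i < Suc (Suc n)\<rbrakk> \<Longrightarrow> take i t @ drop (Suc i) t \<in> tuples \<Gamma> (Suc n)"
  by (auto simp: tuples_def dest: in_set_takeD in_set_dropD)

lemma cochain_fun_altsum:
  assumes f: "cochain_fun n f"
  shows "cochain_fun (Suc n) (\<lambda>t x. altsum (\<lambda>s. f s x) t)"
proof -
  obtain C where C: "AE x in M. \<forall>t\<in>tuples \<Gamma> (Suc n). norm (f t x) \<le> C"
    using cochain_fun_bounded[OF f] by blast
  show ?thesis
  proof (rule cochain_funI[of _ _ "real (Suc (Suc n)) * C"])
    fix t assume t: "t \<in> tuples \<Gamma> (Suc (Suc n))"
    show "(\<lambda>x. altsum (\<lambda>s. f s x) t) \<in> linf_fun M"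
      unfolding altsum_eq_sum
      by (intro linf_fun_sum linf_fun_scaleR cochain_fun_linf[OF f] tuples_delete[OF t])
        (use t in \<open>auto simp: tuples_def\<close>)
    from C show "AE x in M. norm (altsum (\<lambda>s. f s x) t) \<le> real (Suc (Suc n)) * C"
    proof eventually_elim
      case (elim x)
      have "norm (altsum (\<lambda>s. f s x) t) \<le> real (length t) * C"
        by (rule norm_altsum_le) (use t elim in \<open>auto simp: tuples_def\<close>)
      then show ?case
        using t by (simp add: tuples_def)
    qed
    fix \<gamma> assume \<gamma>: "\<gamma> \<in> carrier \<Gamma>"
    from cochain_fun_invariant[OF f]
    show "AE x in M. L (\<gamma>, a (inv \<gamma>) x)
        (altsum (\<lambda>s. f s (a (inv \<gamma>) x)) (map (\<lambda>h. inv \<gamma> \<otimes> h) t)) = altsum (\<lambda>s. f s x) t"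
      by eventually_elim
        (use t \<gamma> in \<open>auto simp: altsum_linear[OF linear_L] altsum_map tuples_def intro!: altsum_cong\<close>)
  qed
qed

text \<open>The entry \<open>h\<close> stands for the point \<open>a (inv h) x\<close>, and
  \<open>h \<otimes> \<kappa> (a (inv h) x)\<close> for that point moved by the inverse of its
  \<open>\<kappa>\<close>. The moved point depends only on the old one, so the rule commutes with
  simultaneous translation of \<open>h\<close> and \<open>x\<close>, and the prism operator
  preserves invariance.\<close>

lemma cochain_fun_prism:
  assumes f: "cochain_fun (Suc n) f" and \<kappa>: "\<kappa> \<in> measurable M (count_space (carrier \<Gamma>))"
  shows "cochain_fun n (\<lambda>t x. prism (\<lambda>h. h \<otimes> \<kappa> (a (inv h) x)) (\<lambda>s. f s x) t)"
proof -
  obtain C where C: "AE x in M. \<forall>t\<in>tuples \<Gamma> (Suc (Suc n)). norm (f t x) \<le> C"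
    using cochain_fun_bounded[OF f] by blast
  have \<kappa>c: "\<kappa> x \<in> carrier \<Gamma>" if "x \<in> space M" for x
    using measurable_space[OF \<kappa> that] by simp
  define p where "p x h = h \<otimes> \<kappa> (a (inv h) x)" for x h
  have p: "p x h \<in> carrier \<Gamma>" if "h \<in> carrier \<Gamma>" "x \<in> space M" for x h
    using that \<kappa>c act_closed by (simp add: p_def)
  have p_meas: "(\<lambda>x. p x h) \<in> measurable M (count_space (carrier \<Gamma>))" if "h \<in> carrier \<Gamma>" for h
  proof -
    have 1: "(\<lambda>x. \<kappa> (a (inv h) x)) \<in> measurable M (count_space (carrier \<Gamma>))"
      by (rule measurable_compose[OF act_measurable \<kappa>]) (use that in auto)
    have 2: "(\<otimes>) h \<in> measurable (count_space (carrier \<Gamma>)) (count_space (carrier \<Gamma>))"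
      using that by auto
    show ?thesis
      unfolding p_def by (rule measurable_compose[OF 1 2])
  qed
  have "cochain_fun n (\<lambda>t x. prism (p x) (\<lambda>s. f s x) t)"
  proof (rule cochain_funI[of _ _ "real (Suc n) * C"])
    fix t assume t: "t \<in> tuples \<Gamma> (Suc n)"
    \<comment> \<open>The tuple now varies with \<open>x\<close>, but it is a measurable choice from
      a countable set, so each summand is glued from countably many measurable functions.\<close>
    have "(\<lambda>x. f (take (Suc i) t @ map (p x) (drop i t)) x) \<in> linf_fun M" if i: "i < length t" for i
    proof -
      have tc: "take (Suc i) t @ u \<in> tuples \<Gamma> (Suc (Suc n))" if "u \<in> tuples \<Gamma> (length (drop i t))" for u
        using that i t by (auto simp: tuples_def dest: in_set_takeD)
      have m1: "(\<lambda>x. map (p x) (drop i t)) \<in> measurable M (count_space (tuples \<Gamma> (length (drop i t))))"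
        by (rule measurable_map_tuples, rule p_meas) (use t in \<open>auto simp: tuples_def dest: in_set_dropD\<close>)
      have m2: "(\<lambda>u. take (Suc i) t @ u) \<in> measurable (count_space (tuples \<Gamma> (length (drop i t))))
          (count_space (tuples \<Gamma> (Suc (Suc n))))"
        using tc by auto
      note m = measurable_compose[OF m1 m2]
      have "(\<lambda>x. f (take (Suc i) t @ map (p x) (drop i t)) x v) \<in> borel_measurable M" for v
        by (rule measurable_compose_countable'[OF _ m countable_tuples])
          (use cochain_fun_linf[OF f] in \<open>auto simp: linf_fun_def\<close>)
      moreover have "AE x in M. norm (f (take (Suc i) t @ map (p x) (drop i t)) x) \<le> C"
        using C AE_space
      proof eventually_elim
        case (elim x)
        then show ?case
          using measurable_space[OF m] by auto
      qed
      ultimately show ?thesis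
        by (auto simp: linf_fun_def)
    qed
    then show "(\<lambda>x. prism (p x) (\<lambda>s. f s x) t) \<in> linf_fun M"
      unfolding prism_eq_sum by (intro linf_fun_sum linf_fun_scaleR) auto
    from C AE_space show "AE x in M. norm (prism (p x) (\<lambda>s. f s x) t) \<le> real (Suc n) * C"
    proof eventually_elim
      case (elim x)
      have "norm (prism (p x) (\<lambda>s. f s x) t) \<le> real (length t) * C"
      proof (rule norm_prism_le)
        fix s assume "length s = Suc (length t)" "set s \<subseteq> set t \<union> p x ` set t"
        then have "s \<in> tuples \<Gamma> (Suc (Suc n))"
          by (rule tuples_prism[OF _ _ t]) (use elim p in auto)
        then show "norm (f s x) \<le> C"
          using elim by blast
      qed
      then show ?case
        using t by (simp add: tuples_def)
    qed
    fix \<gamma> assume \<gamma>: "\<gamma> \<in> carrier \<Gamma>"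
    from cochain_fun_invariant[OF f] AE_space
    show "AE x in M. L (\<gamma>, a (inv \<gamma>) x)
        (prism (p (a (inv \<gamma>) x)) (\<lambda>s. f s (a (inv \<gamma>) x)) (map (\<lambda>h. inv \<gamma> \<otimes> h) t)) =
        prism (p x) (\<lambda>s. f s x) t"
    proof eventually_elim
      case (elim x)
      have eqv: "p (a (inv \<gamma>) x) (inv \<gamma> \<otimes> h) = inv \<gamma> \<otimes> p x h" if "h \<in> carrier \<Gamma>" for h
      proof -
        have "a (inv (inv \<gamma> \<otimes> h)) (a (inv \<gamma>) x) = a (inv h) (a \<gamma> (a (inv \<gamma>) x))"
          using \<gamma> that elim by (simp add: inv_mult_group act_mult act_closed)
        also have "\<dots> = a (inv h) x"
          using \<gamma> elim by (simp add: act_inv')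
        finally show ?thesis
          using \<gamma> that elim by (simp add: p_def m_assoc \<kappa>c act_closed)
      qed
      have "L (\<gamma>, a (inv \<gamma>) x)
          (prism (p (a (inv \<gamma>) x)) (\<lambda>s. f s (a (inv \<gamma>) x)) (map (\<lambda>h. inv \<gamma> \<otimes> h) t)) =
          prism (p (a (inv \<gamma>) x)) (\<lambda>s. L (\<gamma>, a (inv \<gamma>) x) (f s (a (inv \<gamma>) x))) (map (\<lambda>h. inv \<gamma> \<otimes> h) t)"
        by (rule prism_linear[OF linear_L])
      also have "\<dots> = prism (p x) (\<lambda>s. L (\<gamma>, a (inv \<gamma>) x) (f (map (\<lambda>h. inv \<gamma> \<otimes> h) s) (a (inv \<gamma>) x))) t"
        by (rule prism_map) (use t eqv in \<open>auto simp: tuples_def\<close>)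
      also have "\<dots> = prism (p x) (\<lambda>s. f s x) t"
      proof (rule prism_cong)
        fix s assume "length s = Suc (length t)" "set s \<subseteq> set t \<union> p x ` set t"
        then have "s \<in> tuples \<Gamma> (Suc (Suc n))"
          by (rule tuples_prism[OF _ _ t]) (use elim p in auto)
        then show "L (\<gamma>, a (inv \<gamma>) x) (f (map (\<lambda>h. inv \<gamma> \<otimes> h) s) (a (inv \<gamma>) x)) = f s x"
          using elim \<gamma> by blast
      qed
      finally show ?case .
    qed
  qed
  then show ?thesis
    by (simp add: p_def[abs_def])
qed

lemma cls_apply: "t \<in> tuples \<Gamma> (Suc n) \<Longrightarrow> cls n f t = ae_class M (f t)"
  by (simp add: cls_def)

lemma cls_eq_iff:
  assumes "cochain_fun n f"
  shows "cls n g = cls n f \<longleftrightarrow> (AE x in M. \<forall>t\<in>tuples \<Gamma> (Suc n). g t x = f t x)"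
proof -
  have "cls n g = cls n f \<longleftrightarrow> (\<forall>t\<in>tuples \<Gamma> (Suc n). ae_class M (g t) = ae_class M (f t))"
    unfolding cls_def by (metis (no_types, lifting) restrict_apply' restrict_ext)
  also have "\<dots> \<longleftrightarrow> (\<forall>t\<in>tuples \<Gamma> (Suc n). AE x in M. g t x = f t x)"
    using ae_class_eq_iff cochain_fun_linf[OF assms] by blast
  finally show ?thesis
    by (simp add: AE_all_tuples)
qed

lemma gact_ae_class:
  assumes "\<gamma> \<in> carrier \<Gamma>" "f \<in> linf_fun M" "g \<in> linf_fun M"
  shows "gact mdl \<gamma> (ae_class M f) = ae_class M g \<longleftrightarrow>
    (AE x in M. L (\<gamma>, a (inv \<gamma>) x) (f (a (inv \<gamma>) x)) = g x)"
proof -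
  \<comment> \<open>The action in \<open>linf_module\<close> uses an arbitrary representative;
    translation preserves null sets, so it may be exchanged for \<open>f\<close>.\<close>
  have eq: "AE x in M. rep (ae_class M f) (a (inv \<gamma>) x) = f (a (inv \<gamma>) x)"
    by (rule AE_act[OF _ rep_ae_class(2)]) (use assms in auto)
  have "gact mdl \<gamma> (ae_class M f) = ae_class M g \<longleftrightarrow>
      (AE x in M. L (\<gamma>, a (inv \<gamma>) x) (rep (ae_class M f) (a (inv \<gamma>) x)) = g x)"
    by (simp add: linf_module_def ae_class_eq_iff[OF assms(3)])
  also have "\<dots> \<longleftrightarrow> (AE x in M. L (\<gamma>, a (inv \<gamma>) x) (f (a (inv \<gamma>) x)) = g x)"
    by (rule eventually_subst) (use eq in \<open>auto elim: eventually_mono\<close>)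
  finally show ?thesis .
qed

lemma cls_in_bcochains:
  assumes f: "cochain_fun n f"
  shows "cls n f \<in> pts (bcochains \<Gamma> mdl n)"
proof -
  obtain C where C: "0 \<le> C" "AE x in M. \<forall>t\<in>tuples \<Gamma> (Suc n). norm (f t x) \<le> C"
    by (rule cochain_fun_bounded[OF f])
  note lin = cochain_fun_linf[OF f]
  have "vnorm mdl (cls n f t) \<le> C" if "t \<in> tuples \<Gamma> (Suc n)" for t
    unfolding cls_apply[OF that]
    by (rule linf_module_norm(3)[OF lin[OF that] C(1)]) (use C that in \<open>auto elim: eventually_mono\<close>)
  moreover have "gact mdl \<gamma> (cls n f (map (\<lambda>h. inv \<gamma> \<otimes> h) t)) = cls n f t"
    if "\<gamma> \<in> carrier \<Gamma>" "t \<in> tuples \<Gamma> (Suc n)" for \<gamma> t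
  proof -
    have t': "map (\<lambda>h. inv \<gamma> \<otimes> h) t \<in> tuples \<Gamma> (Suc n)"
      using that by (simp add: tuples_translate)
    show ?thesis
      unfolding cls_apply[OF that(2)] cls_apply[OF t'] gact_ae_class[OF that(1) lin[OF t'] lin[OF that(2)]]
      using f that by (simp add: cochain_fun_def)
  qed
  moreover have "cls n f \<in> tuples \<Gamma> (Suc n) \<rightarrow>\<^sub>E pts mdl"
    using lin by (auto simp: cls_def linf_module_def)
  ultimately show ?thesis
    unfolding bcochains_def by auto
qed

text \<open>Choosing representatives inverts \<open>cls\<close>. A uniform bound on the norms of the
  classes becomes an almost everywhere bound with the same constant, since the essential supremum is
  attained.\<close>

lemma bcochains_cls:
  assumes c: "c \<in> pts (bcochains \<Gamma> mdl n)"
  shows "cochain_fun n (\<lambda>t. rep (c t))" and "cls n (\<lambda>t. rep (c t)) = c"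
proof -
  have cE: "c \<in> tuples \<Gamma> (Suc n) \<rightarrow>\<^sub>E pts mdl"
    using c by (simp add: bcochains_def)
  then have ct: "c t \<in> ae_class M ` linf_fun M" if "t \<in> tuples \<Gamma> (Suc n)" for t
    using that by (auto simp: linf_module_def)
  note r = ae_class_rep[OF ct]
  obtain C where C: "\<forall>t\<in>tuples \<Gamma> (Suc n). vnorm mdl (c t) \<le> C"
    using c by (auto simp: bcochains_def)
  show "cochain_fun n (\<lambda>t. rep (c t))"
  proof (rule cochain_funI[of _ _ C])
    fix t assume t: "t \<in> tuples \<Gamma> (Suc n)"
    show "rep (c t) \<in> linf_fun M"
      by (rule r[OF t])
    have "AE x in M. norm (rep (c t) x) \<le> vnorm mdl (ae_class M (rep (c t)))"
      by (rule linf_module_norm[OF r(1)[OF t]])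
    then show "AE x in M. norm (rep (c t) x) \<le> C"
      by eventually_elim (use C t r(2)[OF t] in force)
    fix \<gamma> assume \<gamma>: "\<gamma> \<in> carrier \<Gamma>"
    have t': "map (\<lambda>h. inv \<gamma> \<otimes> h) t \<in> tuples \<Gamma> (Suc n)"
      using t \<gamma> by (simp add: tuples_translate)
    have "gact mdl \<gamma> (c (map (\<lambda>h. inv \<gamma> \<otimes> h) t)) = c t"
      using c t \<gamma> by (simp add: bcochains_def)
    then show "AE x in M. L (\<gamma>, a (inv \<gamma>) x)
        (rep (c (map (\<lambda>h. inv \<gamma> \<otimes> h) t)) (a (inv \<gamma>) x)) = rep (c t) x"
      using gact_ae_class[OF \<gamma> r(1)[OF t'] r(1)[OF t]] r(2)[OF t] r(2)[OF t'] by simp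
  qed
  show "cls n (\<lambda>t. rep (c t)) = c"
    unfolding cls_def
    by (rule extensionalityI[of _ "tuples \<Gamma> (Suc n)"]) (use cE r in \<open>auto simp: PiE_def\<close>)
qed

lemma bcochainsE:
  assumes "c \<in> pts (bcochains \<Gamma> mdl n)"
  obtains f where "cochain_fun n f" "c = cls n f"
  using bcochains_cls[OF assms] by metis

lemma vadd_ae_class:
  assumes "f \<in> linf_fun M" "g \<in> linf_fun M"
  shows "vadd mdl (ae_class M f) (ae_class M g) = ae_class M (\<lambda>x. f x + g x)"
proof -
  have "AE x in M. rep (ae_class M f) x + rep (ae_class M g) x = f x + g x"
    using rep_ae_class(2)[OF assms(1)] rep_ae_class(2)[OF assms(2)] by eventually_elim simp
  then show ?thesis
    using ae_class_eq_iff[OF linf_fun_add[OF assms]] by (simp add: linf_module_def)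
qed

lemma vscale_ae_class:
  assumes "f \<in> linf_fun M"
  shows "vscale mdl r (ae_class M f) = ae_class M (\<lambda>x. r *\<^sub>R f x)"
proof -
  have "AE x in M. r *\<^sub>R rep (ae_class M f) x = r *\<^sub>R f x"
    using rep_ae_class(2)[OF assms] by eventually_elim simp
  then show ?thesis
    using ae_class_eq_iff[OF linf_fun_scaleR[OF assms]] by (simp add: linf_module_def)
qed

lemma vadd_cls:
  assumes "cochain_fun n f" "cochain_fun n g"
  shows "vadd (bcochains \<Gamma> mdl n) (cls n f) (cls n g) = cls n (\<lambda>t x. f t x + g t x)"
  unfolding bcochains_def cls_def
  using assms by (auto simp: vadd_ae_class cochain_fun_linf intro!: restrict_ext)

lemma vscale_cls:
  assumes "cochain_fun n f"
  shows "vscale (bcochains \<Gamma> mdl n) r (cls n f) = cls n (\<lambda>t x. r *\<^sub>R f t x)"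
  unfolding bcochains_def cls_def
  using assms by (auto simp: vscale_ae_class cochain_fun_linf intro!: restrict_ext)

lemma vzero_cls: "vzero (bcochains \<Gamma> mdl n) = cls n (\<lambda>t x. 0)"
  by (simp add: bcochains_def cls_def linf_module_def)

lemma coboundary_cls:
  assumes f: "cochain_fun n f"
  shows "coboundary \<Gamma> mdl n (cls n f) = cls (Suc n) (\<lambda>t x. altsum (\<lambda>s. f s x) t)"
proof -
  have "foldr (\<lambda>i s. vadd mdl (vscale mdl ((-1) ^ i) (cls n f (take i t @ drop (Suc i) t))) s)
      [0..<n + 2] (vzero mdl) = ae_class M (\<lambda>x. altsum (\<lambda>s. f s x) t)"
    if t: "t \<in> tuples \<Gamma> (Suc (Suc n))" for t
  proof -
    have l: "f (take i t @ drop (Suc i) t) \<in> linf_fun M" if "i < Suc (Suc n)" for i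
      by (rule cochain_fun_linf[OF f tuples_delete[OF t that]])
    let ?g = "\<lambda>i x. (-1) ^ i *\<^sub>R f (take i t @ drop (Suc i) t) x"
    \<comment> \<open>The induction carries membership in \<open>linf_fun\<close> along with the
      equation: \<open>vadd_ae_class\<close> applies only to partial sums already known to be
      essentially bounded.\<close>
    have "(\<lambda>x. \<Sum>i\<leftarrow>is. ?g i x) \<in> linf_fun M \<and>
        foldr (\<lambda>i s. vadd mdl (vscale mdl ((-1) ^ i) (cls n f (take i t @ drop (Suc i) t))) s)
          is (vzero mdl) = ae_class M (\<lambda>x. \<Sum>i\<leftarrow>is. ?g i x)"
      if "set is \<subseteq> {..<Suc (Suc n)}" for "is"
      using that
    proof (induction "is")
      case Nil
      then show ?case
        by (simp add: linf_fun_zero linf_module_def)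
    next
      case (Cons i "is")
      have "?g i \<in> linf_fun M"
        using Cons.prems by (intro linf_fun_scaleR l) auto
      moreover have "cls n f (take i t @ drop (Suc i) t) = ae_class M (f (take i t @ drop (Suc i) t))"
        using Cons.prems by (intro cls_apply tuples_delete[OF t]) auto
      ultimately show ?case
        using Cons l[of i] by (simp add: vscale_ae_class vadd_ae_class linf_fun_add)
    qed
    from this[of "[0..<n + 2]"] show ?thesis
      using t by (simp add: altsum_eq_sum tuples_def interv_sum_list_conv_sum_set_nat
          atLeast0LessThan del: upt_Suc)
  qed
  then show ?thesis
    unfolding coboundary_def cls_def by (auto intro!: restrict_ext)
qed

text \<open>The supremum over tuples and the essential supremum over points may be exchanged because
  there are countably many tuples.\<close>

lemma vnorm_cls:
  assumes f: "cochain_fun n f"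
  defines "\<nu> \<equiv> vnorm (bcochains \<Gamma> mdl n) (cls n f)"
  shows "0 \<le> \<nu>" and "AE x in M. \<forall>t\<in>tuples \<Gamma> (Suc n). norm (f t x) \<le> \<nu>"
    and "\<And>C. 0 \<le> C \<Longrightarrow> AE x in M. \<forall>t\<in>tuples \<Gamma> (Suc n). norm (f t x) \<le> C \<Longrightarrow> \<nu> \<le> C"
proof -
  note lin = cochain_fun_linf[OF f]
  have \<nu>: "\<nu> = (SUP t\<in>tuples \<Gamma> (Suc n). vnorm mdl (cls n f t))"
    by (simp add: \<nu>_def bcochains_def)
  have bdd: "bdd_above ((\<lambda>t. vnorm mdl (cls n f t)) ` tuples \<Gamma> (Suc n))"
    using cls_in_bcochains[OF f] by (auto simp: bcochains_def bdd_above_def)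
  have up: "vnorm mdl (ae_class M (f t)) \<le> \<nu>" if "t \<in> tuples \<Gamma> (Suc n)" for t
    using cSUP_upper[OF that bdd] by (simp add: \<nu> cls_apply[OF that])
  obtain t where t: "t \<in> tuples \<Gamma> (Suc n)"
    using tuples_nonempty by blast
  show "0 \<le> \<nu>"
    using linf_module_norm(1)[OF lin[OF t]] up[OF t] order_trans by blast
  have "AE x in M. norm (f t x) \<le> \<nu>" if "t \<in> tuples \<Gamma> (Suc n)" for t
    using linf_module_norm(2)[OF lin[OF that]] by eventually_elim (use up[OF that] order_trans in blast)
  then show "AE x in M. \<forall>t\<in>tuples \<Gamma> (Suc n). norm (f t x) \<le> \<nu>"
    by (simp add: AE_all_tuples)
  fix C :: real assume C: "0 \<le> C" "AE x in M. \<forall>t\<in>tuples \<Gamma> (Suc n). norm (f t x) \<le> C"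
  show "\<nu> \<le> C"
    unfolding \<nu>
  proof (rule cSUP_least[OF tuples_nonempty])
    fix t assume t: "t \<in> tuples \<Gamma> (Suc n)"
    show "vnorm mdl (cls n f t) \<le> C"
      unfolding cls_apply[OF t]
      by (rule linf_module_norm(3)[OF lin[OF t] C(1)]) (use C(2) t in \<open>auto elim: eventually_mono\<close>)
  qed
qed

lemma seminormed_carrier_bcochains: "seminormed_carrier (bcochains \<Gamma> mdl n)"
proof
  show "vzero (bcochains \<Gamma> mdl n) \<in> pts (bcochains \<Gamma> mdl n)"
    unfolding vzero_cls by (rule cls_in_bcochains[OF cochain_fun_zero])
  fix u assume "u \<in> pts (bcochains \<Gamma> mdl n)"
  then obtain f where f: "cochain_fun n f" "u = cls n f"
    by (rule bcochainsE)
  show "vscale (bcochains \<Gamma> mdl n) r u \<in> pts (bcochains \<Gamma> mdl n)" for r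
    using f by (simp add: vscale_cls cls_in_bcochains cochain_fun_scaleR)
  show "vadd (bcochains \<Gamma> mdl n) u (vzero (bcochains \<Gamma> mdl n)) = u"
    using f by (simp add: vzero_cls vadd_cls cochain_fun_zero)
  show "vadd (bcochains \<Gamma> mdl n) u (vscale (bcochains \<Gamma> mdl n) (-1) u) = vzero (bcochains \<Gamma> mdl n)"
    using f cochain_fun_scaleR[OF f(1), of "-1"] by (simp add: vzero_cls vadd_cls vscale_cls)
  show "0 \<le> vnorm (bcochains \<Gamma> mdl n) u"
    using f by (simp add: vnorm_cls)
  fix v assume "v \<in> pts (bcochains \<Gamma> mdl n)"
  then obtain g where g: "cochain_fun n g" "v = cls n g"
    by (rule bcochainsE)
  show "vadd (bcochains \<Gamma> mdl n) u v \<in> pts (bcochains \<Gamma> mdl n)"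
    using f g by (simp add: vadd_cls cls_in_bcochains cochain_fun_add)
  show "vadd (bcochains \<Gamma> mdl n) u v = vadd (bcochains \<Gamma> mdl n) v u"
    using f g by (simp add: vadd_cls add.commute)
  show "vscale (bcochains \<Gamma> mdl n) r (vadd (bcochains \<Gamma> mdl n) u v) =
      vadd (bcochains \<Gamma> mdl n) (vscale (bcochains \<Gamma> mdl n) r u) (vscale (bcochains \<Gamma> mdl n) r v)" for r
    using f g by (simp add: vadd_cls vscale_cls cochain_fun_add cochain_fun_scaleR scaleR_add_right)
  fix w assume "w \<in> pts (bcochains \<Gamma> mdl n)"
  then obtain h where h: "cochain_fun n h" "w = cls n h"
    by (rule bcochainsE)
  show "vadd (bcochains \<Gamma> mdl n) (vadd (bcochains \<Gamma> mdl n) u v) w =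
      vadd (bcochains \<Gamma> mdl n) u (vadd (bcochains \<Gamma> mdl n) v w)"
    using f g h by (simp add: vadd_cls cochain_fun_add add.assoc)
qed

lemma linear_coboundary:
  "linear_between (bcochains \<Gamma> mdl n) (bcochains \<Gamma> mdl (Suc n)) (coboundary \<Gamma> mdl n)"
  unfolding linear_between_def
proof (intro conjI ballI allI funcsetI)
  fix u assume "u \<in> pts (bcochains \<Gamma> mdl n)"
  then obtain f where f: "cochain_fun n f" "u = cls n f"
    by (rule bcochainsE)
  show "coboundary \<Gamma> mdl n u \<in> pts (bcochains \<Gamma> mdl (Suc n))"
    using f by (simp add: coboundary_cls cls_in_bcochains cochain_fun_altsum)
  show "coboundary \<Gamma> mdl n (vscale (bcochains \<Gamma> mdl n) r u) =
      vscale (bcochains \<Gamma> mdl (Suc n)) r (coboundary \<Gamma> mdl n u)" for r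
    using f by (simp add: coboundary_cls vscale_cls cochain_fun_scaleR cochain_fun_altsum altsum_scaleR)
  fix v assume "v \<in> pts (bcochains \<Gamma> mdl n)"
  then obtain g where g: "cochain_fun n g" "v = cls n g"
    by (rule bcochainsE)
  show "coboundary \<Gamma> mdl n (vadd (bcochains \<Gamma> mdl n) u v) =
      vadd (bcochains \<Gamma> mdl (Suc n)) (coboundary \<Gamma> mdl n u) (coboundary \<Gamma> mdl n v)"
    using f g by (simp add: coboundary_cls vadd_cls cochain_fun_add cochain_fun_altsum altsum_add)
qed

lemma subspace_bcocycles:
  "seminormed_carrier.subspace_of (bcochains \<Gamma> mdl n) (bcocycles \<Gamma> mdl n)"
proof -
  interpret C: seminormed_carrier "bcochains \<Gamma> mdl n"
    by (rule seminormed_carrier_bcochains)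
  interpret C': seminormed_carrier "bcochains \<Gamma> mdl (Suc n)"
    by (rule seminormed_carrier_bcochains)
  have "coboundary \<Gamma> mdl n (vzero (bcochains \<Gamma> mdl n)) = vzero (bcochains \<Gamma> mdl (Suc n))"
    by (simp add: vzero_cls coboundary_cls cochain_fun_zero altsum_zero)
  moreover have "vscale (bcochains \<Gamma> mdl (Suc n)) r (vzero (bcochains \<Gamma> mdl (Suc n))) =
      vzero (bcochains \<Gamma> mdl (Suc n))" for r
    by (simp add: vzero_cls vscale_cls cochain_fun_zero)
  ultimately show ?thesis
    using linear_coboundary[of n] C.zero_closed C.add_closed C.scale_closed C'.add_zero[OF C'.zero_closed]
    unfolding C.subspace_of_def bcocycles_def linear_between_def by simp
qed

lemma subspace_bcoboundaries:
  "seminormed_carrier.subspace_of (bcochains \<Gamma> mdl n) (bcoboundaries \<Gamma> mdl n)"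
proof -
  interpret C: seminormed_carrier "bcochains \<Gamma> mdl n"
    by (rule seminormed_carrier_bcochains)
  show ?thesis
  proof (cases n)
    case 0
    show ?thesis
      unfolding C.subspace_of_def using C.zero_closed C.add_zero[OF C.zero_closed] 0
      by (simp add: bcoboundaries_def vzero_cls vscale_cls cochain_fun_zero)
  next
    case (Suc m)
    interpret C': seminormed_carrier "bcochains \<Gamma> mdl m"
      by (rule seminormed_carrier_bcochains)
    note lin = linear_coboundary[of m, folded Suc, unfolded linear_between_def]
    have "coboundary \<Gamma> mdl m (vzero (bcochains \<Gamma> mdl m)) = vzero (bcochains \<Gamma> mdl n)"
      using subspace_bcocycles[of m] by (simp add: C'.subspace_of_def bcocycles_def Suc)
    then have "vzero (bcochains \<Gamma> mdl n) \<in> coboundary \<Gamma> mdl m ` pts (bcochains \<Gamma> mdl m)"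
      using C'.zero_closed by (metis imageI)
    then show ?thesis
      unfolding C.subspace_of_def bcoboundaries_def
      using lin C'.add_closed C'.scale_closed by (auto simp: Suc image_iff) metis+
  qed
qed

text \<open>\<open>prism_homotopy\<close> is applied at each fixed \<open>x\<close>. For almost
  every \<open>x\<close> the cocycle identity holds at all tuples at once, so the term
  \<open>prism (altsum f)\<close> vanishes there although the moving map depends on
  \<open>x\<close>; what remains is the coboundary of the cochain from
  \<open>cochain_fun_prism\<close>.\<close>

lemma prism_homotopic_cohomologous:
  assumes z: "cls n f \<in> bcocycles \<Gamma> mdl n" and f: "cochain_fun n f" and g: "cochain_fun n g"
    and \<kappa>: "\<kappa> \<in> measurable M (count_space (carrier \<Gamma>))"
    and g_eq: "AE x in M. \<forall>t\<in>tuples \<Gamma> (Suc n). g t x = f (map (\<lambda>h. h \<otimes> \<kappa> (a (inv h) x)) t) x"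
  shows "cls n g \<in> vcoset (bcochains \<Gamma> mdl n) (bcoboundaries \<Gamma> mdl n) (cls n f)"
proof -
  define p where "p x h = h \<otimes> \<kappa> (a (inv h) x)" for x h
  have p: "p x h \<in> carrier \<Gamma>" if "h \<in> carrier \<Gamma>" "x \<in> space M" for x h
    using measurable_space[OF \<kappa> act_closed[of "inv h" x]] that by (simp add: p_def)
  have "coboundary \<Gamma> mdl n (cls n f) = cls (Suc n) (\<lambda>t x. 0)"
    using z by (simp add: bcocycles_def vzero_cls)
  then have d0: "AE x in M. \<forall>s\<in>tuples \<Gamma> (Suc (Suc n)). altsum (\<lambda>s. f s x) s = 0"
    using f by (simp add: coboundary_cls cls_eq_iff[OF cochain_fun_zero])
  have key: "AE x in M. \<forall>t\<in>tuples \<Gamma> (Suc n).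
      g t x = f t x + altsum (prism (p x) (\<lambda>s. f s x)) t"
    using d0 g_eq AE_space
  proof eventually_elim
    case (elim x)
    show ?case
    proof
      fix t assume t: "t \<in> tuples \<Gamma> (Suc n)"
      have "prism (p x) (altsum (\<lambda>s. f s x)) t = prism (p x) (\<lambda>s. 0) t"
      proof (rule prism_cong)
        fix s assume "length s = Suc (length t)" "set s \<subseteq> set t \<union> p x ` set t"
        then have "s \<in> tuples \<Gamma> (Suc (Suc n))"
          by (rule tuples_prism[OF _ _ t]) (use elim p in auto)
        then show "altsum (\<lambda>s. f s x) s = 0"
          using elim by blast
      qed
      also have "\<dots> = 0"
        by (rule prism_zero)
      finally show "g t x = f t x + altsum (prism (p x) (\<lambda>s. f s x)) t"
        using prism_homotopy[of "p x" "\<lambda>s. f s x" t] elim t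
        by (simp add: p_def[abs_def])
    qed
  qed
  show ?thesis
  proof (cases n)
    case 0
    \<comment> \<open>In degree 0 the only coboundary is zero, so the correction has to vanish:
      deleting the single entry leaves the empty list, where \<open>prism\<close> is 0.\<close>
    have "altsum (prism (p x) F) t = 0" if "t \<in> tuples \<Gamma> (Suc 0)" for x t and F :: "_ \<Rightarrow> 'e \<Rightarrow>\<^sub>L real"
      using that by (auto simp: tuples_def length_Suc_conv)
    then have "AE x in M. \<forall>t\<in>tuples \<Gamma> (Suc n). g t x = f t x"
      using key 0 by simp
    then have "cls n g = cls n f"
      using cls_eq_iff[OF f] by simp
    also have "\<dots> = vadd (bcochains \<Gamma> mdl n) (cls n f) (vzero (bcochains \<Gamma> mdl n))"
      using f by (simp add: vzero_cls vadd_cls cochain_fun_zero)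
    finally show ?thesis
      using 0 by (auto simp: vcoset_def bcoboundaries_def)
  next
    case (Suc m)
    define h where "h t x = prism (p x) (\<lambda>s. f s x) t" for t x
    have h: "cochain_fun m h"
      unfolding h_def p_def by (rule cochain_fun_prism[OF _ \<kappa>]) (use f Suc in simp)
    have ah: "cochain_fun n (\<lambda>t x. altsum (\<lambda>s. h s x) t)"
      using cochain_fun_altsum[OF h] Suc by simp
    have "cls n g = cls n (\<lambda>t x. f t x + altsum (\<lambda>s. h s x) t)"
      using key cls_eq_iff[OF cochain_fun_add[OF f ah]] by (simp add: h_def)
    also have "\<dots> = vadd (bcochains \<Gamma> mdl n) (cls n f) (coboundary \<Gamma> mdl m (cls m h))"
      using vadd_cls[OF f ah] coboundary_cls[OF h] Suc by simp
    finally show ?thesis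
      using cls_in_bcochains[OF h] Suc by (auto simp: vcoset_def bcoboundaries_def)
  qed
qed

end

section \<open>Measurability\<close>

text \<open>The pairing \<open>(\<xi>, v) \<mapsto> \<xi> v\<close> is weak-star measurable in \<open>\<xi>\<close> and continuous in \<open>v\<close>, so it suffices to
  approximate \<open>u\<close> by simple functions.\<close>

lemma borel_measurable_weak_star_apply:
  fixes u :: "'x \<Rightarrow> 'e::{real_normed_vector, second_countable_topology}"
    and f :: "'x \<Rightarrow> 'e \<Rightarrow>\<^sub>L real"
  assumes f: "\<And>v. (\<lambda>x. blinfun_apply (f x) v) \<in> borel_measurable M"
    and u: "u \<in> borel_measurable M"
  shows "(\<lambda>x. blinfun_apply (f x) (u x)) \<in> borel_measurable M"
proof -
  obtain s where s: "\<And>i. simple_function M (s i)"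
    "\<And>x. x \<in> space M \<Longrightarrow> (\<lambda>i. s i x) \<longlonglongrightarrow> u x"
    using borel_measurable_implies_sequence_metric[OF u] by blast
  show ?thesis
  proof (rule borel_measurable_LIMSEQ_metric)
    fix i
    have fin: "finite (s i ` space M)"
      using s(1) by (simp add: simple_function_def)
    have "s i \<in> measurable M (count_space (s i ` space M))"
      using s(1)[of i] fin
      by (subst measurable_count_space_eq_countable) (auto simp: simple_function_def countable_finite)
    from measurable_compose_countable'[OF f this countable_finite[OF fin]]
    show "(\<lambda>x. blinfun_apply (f x) (s i x)) \<in> borel_measurable M" .
  next
    fix x assume "x \<in> space M"
    then show "(\<lambda>i. blinfun_apply (f x) (s i x)) \<longlonglongrightarrow> blinfun_apply (f x) (u x)"
      by (intro blinfun.tendsto tendsto_const s(2))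
  qed
qed

text \<open>The shape shared by \<open>J\<close> and \<open>K\<close>: the index \<open>s x\<close>,
  the point \<open>r x\<close> and the transport \<open>B x\<close> all vary. Measurability goes in
  two stages, first at a fixed vector, gluing over the countable \<open>S\<close>, then at the
  varying vector \<open>B x v\<close>. The bound survives since \<open>r\<close> pulls null sets
  back to null sets and \<open>B x\<close> is a contraction.\<close>

lemma linf_fun_pullback:
  fixes f :: "'s \<Rightarrow> 'y \<Rightarrow> 'e::{real_normed_vector, second_countable_topology} \<Rightarrow>\<^sub>L real"
  assumes f: "\<And>s. s \<in> S \<Longrightarrow> f s \<in> linf_fun N" and S: "countable S"
    and C: "AE y in N. \<forall>s\<in>S. norm (f s y) \<le> C"
    and s: "s \<in> measurable M (count_space S)" and r: "r \<in> measurable M N"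
    and r_ae: "\<And>P. AE y in N. P y \<Longrightarrow> AE x in M. P (r x)"
    and B: "\<And>v. (\<lambda>x. blinfun_apply (B x) v) \<in> borel_measurable M"
    and B1: "\<And>x. x \<in> space M \<Longrightarrow> norm (B x) \<le> 1"
  shows "(\<lambda>x. f (s x) (r x) o\<^sub>L B x) \<in> linf_fun M"
    and "AE x in M. norm (f (s x) (r x) o\<^sub>L B x) \<le> C"
proof -
  have "(\<lambda>x. blinfun_apply (f (s x) (r x)) v) \<in> borel_measurable M" for v
  proof (rule measurable_compose_countable'[OF _ s S])
    fix i assume "i \<in> S"
    then have "(\<lambda>y. blinfun_apply (f i y) v) \<in> borel_measurable N"
      using f by (auto simp: linf_fun_def)
    then show "(\<lambda>x. blinfun_apply (f i (r x)) v) \<in> borel_measurable M"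
      by (rule measurable_compose[OF r])
  qed
  then have meas: "(\<lambda>x. blinfun_apply (f (s x) (r x) o\<^sub>L B x) v) \<in> borel_measurable M" for v
    using borel_measurable_weak_star_apply[OF _ B] by simp
  show bound: "AE x in M. norm (f (s x) (r x) o\<^sub>L B x) \<le> C"
    using r_ae[OF C] AE_space
  proof eventually_elim
    case (elim x)
    have "norm (f (s x) (r x) o\<^sub>L B x) \<le> norm (f (s x) (r x)) * norm (B x)"
      by (rule norm_blinfun_compose)
    also have "\<dots> \<le> norm (f (s x) (r x)) * 1"
      by (intro mult_left_mono B1 elim norm_ge_zero)
    also have "\<dots> \<le> C"
      using elim measurable_space[OF s] by simp
    finally show ?case .
  qed
  show "(\<lambda>x. f (s x) (r x) o\<^sub>L B x) \<in> linf_fun M"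
    using meas bound unfolding linf_fun_def by blast
qed

text \<open>The underlying topology is Hausdorff with a countable base, so distinct values are
  separated by a basic open set containing the first but not the second. Equality is therefore a
  countable combination of measurable conditions.\<close>

lemma standard_borel_equality_measurable:
  assumes M: "standard_borel M" and f: "f \<in> measurable R M" and g: "g \<in> measurable R M"
  shows "{x \<in> space R. f x = g x} \<in> sets R"
proof -
  obtain S where S: "completely_metrizable_space S" "second_countable S" "topspace S = space M"
    "sets M = sigma_sets (space M) {A. openin S A}"
    using M by (auto simp: standard_borel_def)
  have haus: "Hausdorff_space S"
    using S(1) completely_metrizable_imp_metrizable_space metrizable_imp_Hausdorff_space by blast
  obtain \<B> where \<B>: "countable \<B>" "\<And>B. B \<in> \<B> \<Longrightarrow> openin S B"
    "\<And>U x. openin S U \<Longrightarrow> x \<in> U \<Longrightarrow> \<exists>B\<in>\<B>. x \<in> B \<and> B \<subseteq> U"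
    using S(2) unfolding second_countable_def by metis
  have \<B>M: "B \<in> sets M" if "B \<in> \<B>" for B
    unfolding S(4) using \<B>(2)[OF that] by auto
  have "{x \<in> space R. f x = g x} =
      space R - (\<Union>B\<in>\<B>. (f -` B \<inter> space R) \<inter> (space R - (g -` B \<inter> space R)))" (is "_ = ?S")
  proof -
    have "\<exists>B\<in>\<B>. f x \<in> B \<and> g x \<notin> B" if x: "x \<in> space R" and ne: "f x \<noteq> g x" for x
    proof -
      have "f x \<in> topspace S" "g x \<in> topspace S"
        using S(3) measurable_space[OF f x] measurable_space[OF g x] by auto
      then obtain U V where "openin S U" "openin S V" "f x \<in> U" "g x \<in> V" "disjnt U V"
        using haus ne unfolding Hausdorff_space_def by blast
      then show ?thesis
        using \<B>(3)[of U "f x"] by (auto simp: disjnt_def)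
    qed
    then have "f x = g x \<longleftrightarrow> (\<forall>B\<in>\<B>. f x \<in> B \<longrightarrow> g x \<in> B)" if "x \<in> space R" for x
      using that by metis
    then show ?thesis
      by auto
  qed
  also have "?S \<in> sets R"
    by (intro sets.Diff sets.top sets.countable_UN'' \<B>(1) sets.Int measurable_sets[OF f]
        measurable_sets[OF g] \<B>M)
  finally show ?thesis .
qed


section \<open>Free actions and displacements\<close>

text \<open>The arrow with target \<open>x'\<close> and source \<open>x\<close>, in this order. The
  case distinction copies that of \<open>oe_cocycle\<close>, so that cocycles are displacements
  exactly, default value included.\<close>

definition displacement ::
    "('g, 'm) monoid_scheme \<Rightarrow> ('g \<Rightarrow> 'x \<Rightarrow> 'x) \<Rightarrow> 'x \<Rightarrow> 'x \<Rightarrow> 'g" where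
  "displacement \<Gamma> a x' x =
     (if \<exists>!g. g \<in> carrier \<Gamma> \<and> x' = a g x then THE g. g \<in> carrier \<Gamma> \<and> x' = a g x else \<one>\<^bsub>\<Gamma>\<^esub>)"

lemma oe_cocycle_displacement: "oe_cocycle a \<Lambda> b T \<gamma> x = displacement \<Lambda> b (T (a \<gamma> x)) (T x)"
  by (simp add: oe_cocycle_def displacement_def)

context pmp
begin

definition free_point :: "'x \<Rightarrow> bool" where
  "free_point x \<longleftrightarrow> x \<in> space M \<and> stabilizer \<Gamma> a x = {\<one>}"

lemma displacement_closed: "displacement \<Gamma> a x' x \<in> carrier \<Gamma>"
proof (cases "\<exists>!g. g \<in> carrier \<Gamma> \<and> x' = a g x")
  case True
  then show ?thesis
    unfolding displacement_def using theI'[OF True] by auto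
qed (simp add: displacement_def)

lemma free_point_cancel:
  assumes "free_point x" "g \<in> carrier \<Gamma>" "h \<in> carrier \<Gamma>" "a g x = a h x"
  shows "g = h"
proof -
  have x: "x \<in> space M"
    using assms by (simp add: free_point_def)
  have "a (inv h \<otimes> g) x = x"
    using assms x by (simp add: act_mult act_inv)
  then have "inv h \<otimes> g \<in> stabilizer \<Gamma> a x"
    using assms by (simp add: stabilizer_def)
  then have "inv h \<otimes> g = \<one>"
    using assms(1) by (simp add: free_point_def)
  then show ?thesis
    using assms inv_equality inv_inv by (metis inv_closed)
qed

lemma displacement_eq:
  assumes "free_point x" "g \<in> carrier \<Gamma>" "a g x = x'"
  shows "displacement \<Gamma> a x' x = g"
proof -
  have *: "\<exists>!h. h \<in> carrier \<Gamma> \<and> x' = a h x"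
    using assms free_point_cancel by blast
  have "(THE h. h \<in> carrier \<Gamma> \<and> x' = a h x) = g"
    by (rule the1_equality[OF *]) (use assms in auto)
  then show ?thesis
    using * by (simp add: displacement_def)
qed

lemma displacement_act:
  assumes "free_point x" "x' \<in> orbit \<Gamma> a x"
  shows "a (displacement \<Gamma> a x' x) x = x'"
  using assms displacement_eq by (auto simp: orbit_def)

text \<open>Each level set is a countable Boolean combination of the coincidence sets of
  \<open>f\<close> with \<open>a \<gamma>\<close> after \<open>g\<close>, which are measurable in a
  standard Borel space.\<close>

lemma measurable_displacement:
  assumes f: "f \<in> measurable R M" and g: "g \<in> measurable R M"
  shows "(\<lambda>x. displacement \<Gamma> a (f x) (g x)) \<in> measurable R (count_space (carrier \<Gamma>))"
proof -
  have sb: "standard_borel M"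
    using pmp by (simp add: pmp_action_def)
  define P where "P \<gamma> x \<longleftrightarrow> f x = a \<gamma> (g x)" for \<gamma> x
  have P: "Measurable.pred R (P \<gamma>)" if "\<gamma> \<in> carrier \<Gamma>" for \<gamma>
    using standard_borel_equality_measurable[OF sb f measurable_compose[OF g act_measurable[OF that]]]
    by (simp add: pred_def P_def)
  \<comment> \<open>Unique existence, rewritten with quantifiers over the countable group so that it
    is visibly measurable.\<close>
  define E where "E x \<longleftrightarrow> (\<exists>\<gamma>\<in>carrier \<Gamma>. P \<gamma> x \<and> (\<forall>\<gamma>'\<in>carrier \<Gamma>. P \<gamma>' x \<longrightarrow> \<gamma>' = \<gamma>))" for x
  have imp: "Measurable.pred R (\<lambda>x. P \<gamma>' x \<longrightarrow> \<gamma>' = \<gamma>)" if "\<gamma>' \<in> carrier \<Gamma>" for \<gamma>' \<gamma>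
    using P[OF that] by measurable
  have "Measurable.pred R (\<lambda>x. P \<gamma> x \<and> (\<forall>\<gamma>'\<in>carrier \<Gamma>. P \<gamma>' x \<longrightarrow> \<gamma>' = \<gamma>))"
    if "\<gamma> \<in> carrier \<Gamma>" for \<gamma>
    using sets.sets_Collect_countable_All'[OF _ countable_carrier, where M = R] imp P[OF that]
    by (intro pred_intros_logic(3)) (auto simp: pred_def)
  then have E: "Measurable.pred R E"
    unfolding E_def[abs_def] pred_def by (rule sets.sets_Collect_countable_Ex'[OF _ countable_carrier])
  have E_iff: "E x \<longleftrightarrow> (\<exists>!\<gamma>. \<gamma> \<in> carrier \<Gamma> \<and> f x = a \<gamma> (g x))" for x
    unfolding E_def P_def by blast
  have eq: "displacement \<Gamma> a (f x) (g x) = \<gamma> \<longleftrightarrow> (E x \<and> P \<gamma> x) \<or> (\<not> E x \<and> \<gamma> = \<one>)"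
    if \<gamma>: "\<gamma> \<in> carrier \<Gamma>" for \<gamma> x
  proof (cases "E x")
    case True
    then have ex1: "\<exists>!\<gamma>. \<gamma> \<in> carrier \<Gamma> \<and> f x = a \<gamma> (g x)"
      by (simp add: E_iff)
    have "displacement \<Gamma> a (f x) (g x) = (THE \<gamma>. \<gamma> \<in> carrier \<Gamma> \<and> f x = a \<gamma> (g x))"
      using ex1 by (simp add: displacement_def)
    moreover have "(THE \<gamma>. \<gamma> \<in> carrier \<Gamma> \<and> f x = a \<gamma> (g x)) = \<gamma> \<longleftrightarrow> P \<gamma> x"
      using the1_equality[OF ex1, of \<gamma>] theI'[OF ex1] \<gamma> unfolding P_def by auto
    ultimately show ?thesis
      using True by simp
  next
    case False
    then have "displacement \<Gamma> a (f x) (g x) = \<one>"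
      by (simp add: displacement_def E_iff)
    then show ?thesis
      using False by auto
  qed
  show ?thesis
  proof (subst measurable_count_space_eq_countable[OF countable_carrier], intro conjI ballI)
    show "(\<lambda>x. displacement \<Gamma> a (f x) (g x)) \<in> space R \<rightarrow> carrier \<Gamma>"
      by (auto intro: displacement_closed)
    fix \<gamma> assume \<gamma>: "\<gamma> \<in> carrier \<Gamma>"
    have "Measurable.pred R (\<lambda>x. (E x \<and> P \<gamma> x) \<or> (\<not> E x \<and> \<gamma> = \<one>))"
      using E P[OF \<gamma>] by measurable
    then have "{x \<in> space R. (E x \<and> P \<gamma> x) \<or> (\<not> E x \<and> \<gamma> = \<one>)} \<in> sets R"
      by (simp add: pred_def)
    also have "{x \<in> space R. (E x \<and> P \<gamma> x) \<or> (\<not> E x \<and> \<gamma> = \<one>)} =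
        (\<lambda>x. displacement \<Gamma> a (f x) (g x)) -` {\<gamma>} \<inter> space R"
      using eq[OF \<gamma>] by auto
    finally show "(\<lambda>x. displacement \<Gamma> a (f x) (g x)) -` {\<gamma>} \<inter> space R \<in> sets R" .
  qed
qed

end

locale free_pmp = pmp +
  assumes free: "essentially_free \<Gamma> M a"
begin

lemma AE_free_point: "AE x in M. free_point x"
  using free AE_space unfolding essentially_free_def free_point_def by eventually_elim auto

end


section \<open>Orbit preserving maps\<close>

text \<open>The condition \<open>q_AE\<close> is nonsingularity: preimages of null sets are null. It
  lets \<open>q\<close> act on classes of functions even when it does not preserve the
  measure.\<close>

locale orbit_morphism = X: free_pmp \<Gamma> M a + Y: free_pmp \<Lambda> N b
  for \<Gamma> :: "('g, 'm) monoid_scheme" and M :: "'x measure" and a :: "'g \<Rightarrow> 'x \<Rightarrow> 'x"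
    and \<Lambda> :: "('l, 'n) monoid_scheme" and N :: "'y measure" and b :: "'l \<Rightarrow> 'y \<Rightarrow> 'y" +
  fixes q :: "'x \<Rightarrow> 'y"
  assumes q_measurable: "q \<in> measurable M N"
    and q_AE: "\<And>P. AE y in N. P y \<Longrightarrow> AE x in M. P (q x)"
    and q_orbit: "AE x in M. \<forall>\<gamma>\<in>carrier \<Gamma>. q (a \<gamma> x) \<in> orbit \<Lambda> b (q x)"
begin

text \<open>Freeness and the orbit condition are demanded along the entire orbit, so good points
  form an invariant set and all displacements met from such a point are uniquely determined.\<close>

definition good :: "'x \<Rightarrow> bool" where
  "good x \<longleftrightarrow> x \<in> space M \<and> (\<forall>\<gamma>\<in>carrier \<Gamma>. X.free_point (a \<gamma> x) \<and> Y.free_point (q (a \<gamma> x)) \<and>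
     (\<forall>\<delta>\<in>carrier \<Gamma>. q (a \<delta> (a \<gamma> x)) \<in> orbit \<Lambda> b (q (a \<gamma> x))))"

lemma AE_good: "AE x in M. good x"
proof -
  have "AE x in M. X.free_point x \<and> Y.free_point (q x) \<and>
      (\<forall>\<gamma>\<in>carrier \<Gamma>. q (a \<gamma> x) \<in> orbit \<Lambda> b (q x))"
    using X.AE_free_point q_AE[OF Y.AE_free_point] q_orbit by eventually_elim simp
  from X.AE_all_act[OF this] AE_space show ?thesis
    by eventually_elim (simp add: good_def)
qed

lemma good_act: "\<lbrakk>good x; \<gamma> \<in> carrier \<Gamma>\<rbrakk> \<Longrightarrow> good (a \<gamma> x)"
  unfolding good_def by (auto simp: X.act_closed simp flip: X.act_mult)

lemma good_space: "good x \<Longrightarrow> x \<in> space M"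
  by (simp add: good_def)

lemma good_free:
  assumes "good x"
  shows "X.free_point x" and "Y.free_point (q x)"
    and "\<And>\<gamma>. \<gamma> \<in> carrier \<Gamma> \<Longrightarrow> q (a \<gamma> x) \<in> orbit \<Lambda> b (q x)"
proof -
  have "X.free_point (a \<one>\<^bsub>\<Gamma>\<^esub> x) \<and> Y.free_point (q (a \<one>\<^bsub>\<Gamma>\<^esub> x)) \<and>
      (\<forall>\<delta>\<in>carrier \<Gamma>. q (a \<delta> (a \<one>\<^bsub>\<Gamma>\<^esub> x)) \<in> orbit \<Lambda> b (q (a \<one>\<^bsub>\<Gamma>\<^esub> x)))"
    using assms X.one_closed unfolding good_def by blast
  then show "X.free_point x" "Y.free_point (q x)"
    "\<And>\<gamma>. \<gamma> \<in> carrier \<Gamma> \<Longrightarrow> q (a \<gamma> x) \<in> orbit \<Lambda> b (q x)"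
    using X.act_one[OF good_space[OF assms]] by auto
qed

text \<open>This is the cocycle value at \<open>(\<gamma>, a (inv \<gamma>) x)\<close>. The entry
  \<open>\<gamma>\<close> stands for the point \<open>a (inv \<gamma>) x\<close>, and
  \<open>transl x \<gamma>\<close> is the entry that stands for its image under \<open>q\<close>,
  seen from \<open>q x\<close>.\<close>

definition transl :: "'x \<Rightarrow> 'g \<Rightarrow> 'l" where
  "transl x \<gamma> = displacement \<Lambda> b (q x) (q (a (inv\<^bsub>\<Gamma>\<^esub> \<gamma>) x))"

lemma transl_closed: "transl x \<gamma> \<in> carrier \<Lambda>"
  by (simp add: transl_def Y.displacement_closed)

lemma transl_act:
  assumes "good x" "\<gamma> \<in> carrier \<Gamma>"
  shows "b (transl x \<gamma>) (q (a (inv\<^bsub>\<Gamma>\<^esub> \<gamma>) x)) = q x"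
proof -
  let ?x = "a (inv\<^bsub>\<Gamma>\<^esub> \<gamma>) x"
  have "good ?x"
    using assms by (simp add: good_act)
  then have "q (a \<gamma> ?x) \<in> orbit \<Lambda> b (q ?x)"
    using assms(2) by (rule good_free)
  then show ?thesis
    using Y.displacement_act[OF good_free(2)[OF \<open>good ?x\<close>]] assms
    by (simp add: transl_def X.act_inv' good_space)
qed

lemma transl_act_inv:
  assumes "good x" "\<gamma> \<in> carrier \<Gamma>"
  shows "b (inv\<^bsub>\<Lambda>\<^esub> (transl x \<gamma>)) (q x) = q (a (inv\<^bsub>\<Gamma>\<^esub> \<gamma>) x)"
  using transl_act[OF assms] Y.act_inv[OF transl_closed, of "q (a (inv\<^bsub>\<Gamma>\<^esub> \<gamma>) x)" x \<gamma>]
    good_free(2)[OF good_act[OF assms(1)], of "inv\<^bsub>\<Gamma>\<^esub> \<gamma>"] assms(2)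
  by (simp add: Y.free_point_def)

text \<open>The cocycle identity. Both sides carry the image of \<open>a (inv h) x\<close> to the
  image of \<open>a (inv \<gamma>) x\<close>, and freeness leaves room for one such element.\<close>

lemma transl_equivariant:
  assumes x: "good x" and \<gamma>: "\<gamma> \<in> carrier \<Gamma>" and h: "h \<in> carrier \<Gamma>"
  shows "transl (a (inv\<^bsub>\<Gamma>\<^esub> \<gamma>) x) (inv\<^bsub>\<Gamma>\<^esub> \<gamma> \<otimes>\<^bsub>\<Gamma>\<^esub> h) = inv\<^bsub>\<Lambda>\<^esub> (transl x \<gamma>) \<otimes>\<^bsub>\<Lambda>\<^esub> transl x h"
proof -
  have fr: "Y.free_point (q (a (inv\<^bsub>\<Gamma>\<^esub> h) x))"
    using good_free(2)[OF good_act[OF x]] h by simp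
  have "a (inv\<^bsub>\<Gamma>\<^esub> (inv\<^bsub>\<Gamma>\<^esub> \<gamma> \<otimes>\<^bsub>\<Gamma>\<^esub> h)) (a (inv\<^bsub>\<Gamma>\<^esub> \<gamma>) x) = a (inv\<^bsub>\<Gamma>\<^esub> h) x"
    using \<gamma> h good_space[OF x] by (simp add: X.inv_mult_group X.act_mult X.act_closed X.act_inv')
  moreover have "b (inv\<^bsub>\<Lambda>\<^esub> (transl x \<gamma>) \<otimes>\<^bsub>\<Lambda>\<^esub> transl x h) (q (a (inv\<^bsub>\<Gamma>\<^esub> h) x)) = q (a (inv\<^bsub>\<Gamma>\<^esub> \<gamma>) x)"
    using fr by (simp add: Y.act_mult transl_closed Y.free_point_def transl_act[OF x h] transl_act_inv[OF x \<gamma>])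
  ultimately show ?thesis
    using Y.displacement_eq[OF fr] by (simp add: transl_def[of "a (inv\<^bsub>\<Gamma>\<^esub> \<gamma>) x"] transl_closed)
qed

lemma map_transl_tuples: "t \<in> tuples \<Gamma> n \<Longrightarrow> map (transl x) t \<in> tuples \<Lambda> n"
  by (rule Y.tuples_map) (auto intro: transl_closed)

lemma map_transl_equivariant:
  assumes "good x" "\<gamma> \<in> carrier \<Gamma>" "t \<in> tuples \<Gamma> n"
  shows "map (transl (a (inv\<^bsub>\<Gamma>\<^esub> \<gamma>) x)) (map (\<lambda>h. inv\<^bsub>\<Gamma>\<^esub> \<gamma> \<otimes>\<^bsub>\<Gamma>\<^esub> h) t) =
    map (\<lambda>h. inv\<^bsub>\<Lambda>\<^esub> (transl x \<gamma>) \<otimes>\<^bsub>\<Lambda>\<^esub> h) (map (transl x) t)"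
  using assms by (auto simp: tuples_def transl_equivariant)

lemma measurable_map_transl:
  assumes "t \<in> tuples \<Gamma> n"
  shows "(\<lambda>x. map (transl x) t) \<in> measurable M (count_space (tuples \<Lambda> n))"
proof -
  have "(\<lambda>x. transl x h) \<in> measurable M (count_space (carrier \<Lambda>))" if "h \<in> set t" for h
    unfolding transl_def
    using that assms
    by (intro Y.measurable_displacement q_measurable measurable_compose[OF X.act_measurable q_measurable])
      (auto simp: tuples_def)
  from Y.measurable_map_tuples[where f = transl and t = t, OF this] show ?thesis
    using assms by (simp add: tuples_def)
qed

lemma linf_fun_transl:
  fixes f :: "'l list \<Rightarrow> 'y \<Rightarrow> 'e::{real_normed_vector, second_countable_topology} \<Rightarrow>\<^sub>L real"
  assumes f: "\<And>s. s \<in> tuples \<Lambda> n \<Longrightarrow> f s \<in> linf_fun N"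
    and C: "AE y in N. \<forall>s\<in>tuples \<Lambda> n. norm (f s y) \<le> C"
    and t: "t \<in> tuples \<Gamma> n"
    and B: "\<And>v. (\<lambda>x. blinfun_apply (B x) v) \<in> borel_measurable M"
      "\<And>x. x \<in> space M \<Longrightarrow> norm (B x) \<le> 1"
  shows "(\<lambda>x. f (map (transl x) t) (q x) o\<^sub>L B x) \<in> linf_fun M"
    and "AE x in M. norm (f (map (transl x) t) (q x) o\<^sub>L B x) \<le> C"
  using linf_fun_pullback[OF f Y.countable_tuples C measurable_map_transl[OF t] q_measurable q_AE B]
  by auto

end


section \<open>Cochain operators\<close>

text \<open>An operator on representatives. \<open>Op_cong\<close> makes it descend to classes,
  \<open>Op_altsum\<close> makes it a cochain map, and \<open>Op_bound\<close> makes it norm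
  nonincreasing.\<close>

locale cochain_operator =
  A: pmp_coefficients \<Lambda> N b LA + B: pmp_coefficients \<Gamma> M a LB
  for \<Lambda> :: "('l, 'n) monoid_scheme" and N :: "'y measure" and b :: "'l \<Rightarrow> 'y \<Rightarrow> 'y"
    and LA :: "'l \<times> 'y \<Rightarrow> ('e::real_normed_vector \<Rightarrow>\<^sub>L real) \<Rightarrow> ('e \<Rightarrow>\<^sub>L real)"
    and \<Gamma> :: "('g, 'm) monoid_scheme" and M :: "'x measure" and a :: "'g \<Rightarrow> 'x \<Rightarrow> 'x"
    and LB :: "'g \<times> 'x \<Rightarrow> ('e \<Rightarrow>\<^sub>L real) \<Rightarrow> ('e \<Rightarrow>\<^sub>L real)" +
  fixes Op :: "('l list \<Rightarrow> 'y \<Rightarrow> 'e \<Rightarrow>\<^sub>L real) \<Rightarrow> 'g list \<Rightarrow> 'x \<Rightarrow> 'e \<Rightarrow>\<^sub>L real"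
  assumes cochain_fun_Op: "A.cochain_fun n f \<Longrightarrow> B.cochain_fun n (Op f)"
    and Op_add: "Op (\<lambda>t y. f t y + g t y) t x = Op f t x + Op g t x"
    and Op_scaleR: "Op (\<lambda>t y. r *\<^sub>R f t y) t x = r *\<^sub>R Op f t x"
    and Op_altsum: "Op (\<lambda>t y. altsum (\<lambda>s. f s y) t) t x = altsum (\<lambda>s. Op f s x) t"
    and Op_cong: "AE y in N. \<forall>s\<in>tuples \<Lambda> n. f s y = g s y \<Longrightarrow>
      AE x in M. \<forall>t\<in>tuples \<Gamma> n. Op f t x = Op g t x"
    and Op_bound: "\<lbrakk>A.cochain_fun n f; AE y in N. \<forall>s\<in>tuples \<Lambda> (Suc n). norm (f s y) \<le> C\<rbrakk> \<Longrightarrow>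
      AE x in M. \<forall>t\<in>tuples \<Gamma> (Suc n). norm (Op f t x) \<le> C"
begin

definition lift :: "nat \<Rightarrow> ('l list \<Rightarrow> ('y \<Rightarrow> 'e \<Rightarrow>\<^sub>L real) set) \<Rightarrow> 'g list \<Rightarrow> ('x \<Rightarrow> 'e \<Rightarrow>\<^sub>L real) set" where
  "lift n c = B.cls n (Op (\<lambda>s. rep (c s)))"

lemma lift_cls:
  assumes f: "A.cochain_fun n f"
  shows "lift n (A.cls n f) = B.cls n (Op f)"
proof -
  have "AE y in N. rep (A.cls n f s) y = f s y" if "s \<in> tuples \<Lambda> (Suc n)" for s
    unfolding A.cls_apply[OF that] by (rule rep_ae_class(2)[OF A.cochain_fun_linf[OF f that]])
  then have "AE y in N. \<forall>s\<in>tuples \<Lambda> (Suc n). rep (A.cls n f s) y = f s y"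
    by (simp add: A.AE_all_tuples)
  from Op_cong[OF this] show ?thesis
    unfolding lift_def by (simp add: B.cls_eq_iff[OF cochain_fun_Op[OF f]])
qed

lemma cochain_map_lift: "cochain_map \<Lambda> A.mdl \<Gamma> B.mdl lift"
  unfolding cochain_map_def linear_between_def
proof (intro conjI allI ballI funcsetI)
  fix n u assume "u \<in> pts (bcochains \<Lambda> A.mdl n)"
  then obtain f where f: "A.cochain_fun n f" "u = A.cls n f"
    by (rule A.bcochainsE)
  show "lift n u \<in> pts (bcochains \<Gamma> B.mdl n)"
    using f by (simp add: lift_cls B.cls_in_bcochains cochain_fun_Op)
  show "lift n (vscale (bcochains \<Lambda> A.mdl n) r u) = vscale (bcochains \<Gamma> B.mdl n) r (lift n u)" for r
    using f by (simp add: lift_cls A.vscale_cls B.vscale_cls A.cochain_fun_scaleR cochain_fun_Op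
        Op_scaleR[abs_def])
  show "coboundary \<Gamma> B.mdl n (lift n u) = lift (Suc n) (coboundary \<Lambda> A.mdl n u)"
    using f by (simp add: lift_cls A.coboundary_cls B.coboundary_cls A.cochain_fun_altsum cochain_fun_Op
        Op_altsum[abs_def])
  fix v assume "v \<in> pts (bcochains \<Lambda> A.mdl n)"
  then obtain g where g: "A.cochain_fun n g" "v = A.cls n g"
    by (rule A.bcochainsE)
  show "lift n (vadd (bcochains \<Lambda> A.mdl n) u v) = vadd (bcochains \<Gamma> B.mdl n) (lift n u) (lift n v)"
    using f g by (simp add: lift_cls A.vadd_cls B.vadd_cls A.cochain_fun_add cochain_fun_Op
        Op_add[abs_def])
qed

lemma vnorm_lift_le:
  assumes "u \<in> pts (bcochains \<Lambda> A.mdl n)"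
  shows "vnorm (bcochains \<Gamma> B.mdl n) (lift n u) \<le> vnorm (bcochains \<Lambda> A.mdl n) u"
proof -
  obtain f where f: "A.cochain_fun n f" "u = A.cls n f"
    using assms by (rule A.bcochainsE)
  show ?thesis
    unfolding f(2) lift_cls[OF f(1)]
    by (intro B.vnorm_cls(3) cochain_fun_Op f(1) A.vnorm_cls(1) Op_bound[OF f(1)] A.vnorm_cls(2))
qed

lemma lift_vzero: "lift n (vzero (bcochains \<Lambda> A.mdl n)) = vzero (bcochains \<Gamma> B.mdl n)"
proof -
  have "Op (\<lambda>t y. 0) = (\<lambda>t x. 0)"
    using Op_scaleR[of 0 "\<lambda>t y. 0"] by (simp add: fun_eq_iff)
  then show ?thesis
    by (simp add: A.vzero_cls B.vzero_cls lift_cls A.cochain_fun_zero)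
qed

lemma lift_bcocycles: "lift n ` bcocycles \<Lambda> A.mdl n \<subseteq> bcocycles \<Gamma> B.mdl n"
  using cochain_map_lift lift_vzero[of "Suc n"]
  by (auto simp: bcocycles_def cochain_map_def linear_between_def)

lemma lift_bcoboundaries: "lift n ` bcoboundaries \<Lambda> A.mdl n \<subseteq> bcoboundaries \<Gamma> B.mdl n"
proof (cases n)
  case 0
  then show ?thesis
    by (simp add: bcoboundaries_def lift_vzero)
next
  case (Suc m)
  have "lift (Suc m) (coboundary \<Lambda> A.mdl m c) \<in> coboundary \<Gamma> B.mdl m ` pts (bcochains \<Gamma> B.mdl m)"
    if c: "c \<in> pts (bcochains \<Lambda> A.mdl m)" for c
  proof -
    have "lift (Suc m) (coboundary \<Lambda> A.mdl m c) = coboundary \<Gamma> B.mdl m (lift m c)"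
      using cochain_map_lift c by (simp add: cochain_map_def)
    moreover have "lift m c \<in> pts (bcochains \<Gamma> B.mdl m)"
      using cochain_map_lift c by (auto simp: cochain_map_def linear_between_def)
    ultimately show ?thesis
      by blast
  qed
  then show ?thesis
    by (auto simp: Suc bcoboundaries_def)
qed

end

text \<open>One half of a correspondence: the round trip starting in \<open>Y\<close> stays in the
  orbit. Instantiated in both directions later, so that the displacement identities are proved
  once.\<close>

locale orbit_return =
  Q: orbit_morphism \<Gamma> M a \<Lambda> N b q + R: orbit_morphism \<Lambda> N b \<Gamma> M a q'
  for \<Gamma> :: "('g, 'm) monoid_scheme" and M :: "'x measure" and a :: "'g \<Rightarrow> 'x \<Rightarrow> 'x"
    and \<Lambda> :: "('l, 'n) monoid_scheme" and N :: "'y measure" and b :: "'l \<Rightarrow> 'y \<Rightarrow> 'y"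
    and q :: "'x \<Rightarrow> 'y" and q' :: "'y \<Rightarrow> 'x" +
  assumes return: "AE y in N. q (q' y) \<in> orbit \<Lambda> b y"
begin

definition regular :: "'y \<Rightarrow> bool" where
  "regular y \<longleftrightarrow> y \<in> space N \<and> (\<forall>l\<in>carrier \<Lambda>. R.good (b l y) \<and> Q.good (q' (b l y)) \<and>
     q (q' (b l y)) \<in> orbit \<Lambda> b (b l y))"

lemma AE_regular: "AE y in N. regular y"
proof -
  have "AE y in N. R.good y \<and> Q.good (q' y) \<and> q (q' y) \<in> orbit \<Lambda> b y"
    using R.AE_good R.q_AE[OF Q.AE_good] return by eventually_elim simp
  from Q.Y.AE_all_act[OF this] AE_space show ?thesis
    by eventually_elim (simp add: regular_def)
qed

lemma regular_act: "\<lbrakk>regular y; l \<in> carrier \<Lambda>\<rbrakk> \<Longrightarrow> regular (b l y)"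
  unfolding regular_def by (auto simp: Q.Y.act_closed simp flip: Q.Y.act_mult)

lemma regularD:
  assumes "regular y"
  shows "y \<in> space N" and "R.good y" and "Q.good (q' y)" and "q (q' y) \<in> orbit \<Lambda> b y"
proof -
  show y: "y \<in> space N"
    using assms by (simp add: regular_def)
  have "R.good (b \<one>\<^bsub>\<Lambda>\<^esub> y) \<and> Q.good (q' (b \<one>\<^bsub>\<Lambda>\<^esub> y)) \<and> q (q' (b \<one>\<^bsub>\<Lambda>\<^esub> y)) \<in> orbit \<Lambda> b (b \<one>\<^bsub>\<Lambda>\<^esub> y)"
    using assms Q.Y.one_closed unfolding regular_def by blast
  then show "R.good y" "Q.good (q' y)" "q (q' y) \<in> orbit \<Lambda> b y"
    by (simp_all add: Q.Y.act_one[OF y])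
qed

text \<open>The arrow leading from the end \<open>q (q' y)\<close> of the round trip back to
  \<open>y\<close>. Fed into the moving map of \<open>cochain_fun_prism\<close>, it replaces each
  point of an orbit by its round trip.\<close>

definition \<kappa> :: "'y \<Rightarrow> 'l" where
  "\<kappa> y = displacement \<Lambda> b y (q (q' y))"

lemma \<kappa>_closed: "\<kappa> y \<in> carrier \<Lambda>"
  by (simp add: \<kappa>_def Q.Y.displacement_closed)

lemma \<kappa>_measurable: "\<kappa> \<in> measurable N (count_space (carrier \<Lambda>))"
  unfolding \<kappa>_def[abs_def]
  by (intro Q.Y.measurable_displacement measurable_ident_sets[OF refl] measurable_compose[OF R.q_measurable Q.q_measurable])

lemma \<kappa>_act:
  assumes "regular y"
  shows "b (\<kappa> y) (q (q' y)) = y"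
proof -
  note fr = Q.good_free(2)[OF regularD(3)[OF assms]]
  have "q (q' y) \<in> space N"
    using fr by (simp add: Q.Y.free_point_def)
  then have "y \<in> orbit \<Lambda> b (q (q' y))"
    using Q.Y.act.orbit_sym regularD[OF assms] by blast
  from Q.Y.displacement_act[OF fr this] show ?thesis
    by (simp add: \<kappa>_def)
qed

lemma \<kappa>_act_inv:
  assumes "regular y"
  shows "b (inv\<^bsub>\<Lambda>\<^esub> (\<kappa> y)) y = q (q' y)"
  using Q.Y.act_inv[OF \<kappa>_closed, of "q (q' y)" y] \<kappa>_act[OF assms]
    Q.good_free(2)[OF regularD(3)[OF assms]] by (simp add: Q.Y.free_point_def)

text \<open>Write \<open>z\<close> for \<open>b (inv h) y\<close>. Both sides carry the round trip
  of \<open>z\<close> to the round trip of \<open>y\<close>; the right side does so by way of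
  \<open>z\<close> and then \<open>y\<close>, and freeness makes the two agree.\<close>

lemma transl_transl:
  assumes y: "regular y" and h: "h \<in> carrier \<Lambda>"
  shows "Q.transl (q' y) (R.transl y h) =
    inv\<^bsub>\<Lambda>\<^esub> (\<kappa> y) \<otimes>\<^bsub>\<Lambda>\<^esub> (h \<otimes>\<^bsub>\<Lambda>\<^esub> \<kappa> (b (inv\<^bsub>\<Lambda>\<^esub> h) y))"
proof (rule Q.Y.free_point_cancel)
  let ?y = "b (inv\<^bsub>\<Lambda>\<^esub> h) y"
  have y1: "regular ?y"
    using y h by (simp add: regular_act)
  show fr: "Q.Y.free_point (q (q' ?y))"
    by (rule Q.good_free(2)[OF regularD(3)[OF y1]])
  then have sp: "q (q' ?y) \<in> space N"
    by (simp add: Q.Y.free_point_def)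
  have "a (inv\<^bsub>\<Gamma>\<^esub> (R.transl y h)) (q' y) = q' ?y"
    by (rule R.transl_act_inv[OF regularD(2)[OF y] h])
  then have 1: "b (Q.transl (q' y) (R.transl y h)) (q (q' ?y)) = q (q' y)"
    using Q.transl_act[OF regularD(3)[OF y] R.transl_closed] by metis
  have 2: "b (inv\<^bsub>\<Lambda>\<^esub> (\<kappa> y) \<otimes>\<^bsub>\<Lambda>\<^esub> (h \<otimes>\<^bsub>\<Lambda>\<^esub> \<kappa> ?y)) (q (q' ?y)) = q (q' y)"
    using h sp regularD(1)[OF y] \<kappa>_act[OF y1] \<kappa>_act_inv[OF y]
    by (simp add: Q.Y.act_mult \<kappa>_closed Q.Y.act_inv' Q.Y.act_closed)
  show "b (Q.transl (q' y) (R.transl y h)) (q (q' ?y)) =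
      b (inv\<^bsub>\<Lambda>\<^esub> (\<kappa> y) \<otimes>\<^bsub>\<Lambda>\<^esub> (h \<otimes>\<^bsub>\<Lambda>\<^esub> \<kappa> ?y)) (q (q' ?y))"
    using 1 2 by simp
qed (use h in \<open>simp_all add: Q.transl_closed \<kappa>_closed\<close>)

end


section \<open>Coefficients along an orbit correspondence\<close>

lemma coefficient_moduleD:
  fixes \<Lambda> :: "('l, 'n) monoid_scheme"
  assumes "coefficient_module \<Lambda> N b Lf" and \<Lambda>: "countable (carrier \<Lambda>)" and N: "prob_space N"
  shows "\<And>l y. \<lbrakk>l \<in> carrier \<Lambda>; y \<in> space N\<rbrakk> \<Longrightarrow> norm (Lf (l, y)) \<le> 1"
    and "AE y in N. \<forall>l\<in>carrier \<Lambda>. \<forall>l'\<in>carrier \<Lambda>. Lf (l' \<otimes>\<^bsub>\<Lambda>\<^esub> l, y) = Lf (l', b l y) o\<^sub>L Lf (l, y)"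
    and "\<And>f v. f \<in> measurable N (count_space (carrier \<Lambda>)) \<Longrightarrow>
      (\<lambda>y. blinfun_apply (Lf (f y, y)) v) \<in> borel_measurable N"
proof -
  interpret N: prob_space N by fact
  have iso: "\<forall>g\<in>carrier \<Lambda> \<times> space N. Lf g \<in> linear_isometries"
    and mult: "AE (l', l, y) in count_space (carrier \<Lambda>) \<Otimes>\<^sub>M (count_space (carrier \<Lambda>) \<Otimes>\<^sub>M N).
        Lf (gd_mult \<Lambda> (l', b l y) (l, y)) = Lf (l', b l y) o\<^sub>L Lf (l, y)"
    and meas: "\<And>v. (\<lambda>g. blinfun_apply (Lf g) v) \<in> borel_measurable (count_space (carrier \<Lambda>) \<Otimes>\<^sub>M N)"
    using assms(1) unfolding coefficient_module_def gd_measure_def by blast+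
  show "norm (Lf (l, y)) \<le> 1" if "l \<in> carrier \<Lambda>" "y \<in> space N" for l y
    using iso that by (intro norm_blinfun_bound) (auto simp: linear_isometries_def)
  show "(\<lambda>y. blinfun_apply (Lf (f y, y)) v) \<in> borel_measurable N"
    if "f \<in> measurable N (count_space (carrier \<Lambda>))" for f v
    by (rule measurable_compose[OF measurable_Pair[OF that measurable_ident_sets[OF refl]] meas])
  interpret C: sigma_finite_measure "count_space (carrier \<Lambda>)"
    by (rule sigma_finite_measure_count_space_countable[OF \<Lambda>])
  interpret CN: pair_sigma_finite "count_space (carrier \<Lambda>)" N ..
  interpret S: sigma_finite_measure "count_space (carrier \<Lambda>) \<Otimes>\<^sub>M N"
    by (rule CN.P.sigma_finite_measure_axioms)
  interpret CCN: pair_sigma_finite "count_space (carrier \<Lambda>)" "count_space (carrier \<Lambda>) \<Otimes>\<^sub>M N" ..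
  \<comment> \<open>Two applications of Fubini; since almost everywhere for counting measure means
    everywhere, every pair of group elements keeps its own \<open>N\<close>-null exceptional set.
    These are then merged by countability.\<close>
  have "\<forall>l'\<in>carrier \<Lambda>. \<forall>l\<in>carrier \<Lambda>. AE y in N.
      Lf (gd_mult \<Lambda> (l', b l y) (l, y)) = Lf (l', b l y) o\<^sub>L Lf (l, y)"
    using CCN.AE_pair[OF mult] CN.AE_pair by (fastforce simp: AE_count_space)
  then show "AE y in N. \<forall>l\<in>carrier \<Lambda>. \<forall>l'\<in>carrier \<Lambda>.
      Lf (l' \<otimes>\<^bsub>\<Lambda>\<^esub> l, y) = Lf (l', b l y) o\<^sub>L Lf (l, y)"
    by (simp add: AE_ball_countable[OF \<Lambda>] gd_mult_def)
qed

lemma linear_contragredient: "linear (contragredient \<Gamma> a Lf g)"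
  unfolding contragredient_def
  by (rule linearI) (auto intro!: blinfun_eqI simp: blinfun.bilinear_simps)

text \<open>The action \<open>LX\<close> is prescribed only almost everywhere for each
  \<open>\<gamma>\<close>. Both pullbacks in the theorem fit this: they are built from the original
  \<open>T\<close>, and in the weak case also from an arbitrary return map, which behave well only
  off a null set.\<close>

locale orbit_correspondence =
  S: orbit_return \<Gamma> M a \<Lambda> N b q q' + S': orbit_return \<Lambda> N b \<Gamma> M a q' q
  for \<Gamma> :: "('g, 'm) monoid_scheme" and M :: "'x measure" and a :: "'g \<Rightarrow> 'x \<Rightarrow> 'x"
    and \<Lambda> :: "('l, 'n) monoid_scheme" and N :: "'y measure" and b :: "'l \<Rightarrow> 'y \<Rightarrow> 'y"
    and q :: "'x \<Rightarrow> 'y" and q' :: "'y \<Rightarrow> 'x" +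
  fixes Lf :: "'l \<times> 'y \<Rightarrow> 'e::{banach, second_countable_topology} \<Rightarrow>\<^sub>L 'e"
    and LX :: "'g \<times> 'x \<Rightarrow> ('e \<Rightarrow>\<^sub>L real) \<Rightarrow> ('e \<Rightarrow>\<^sub>L real)"
  assumes coeff: "coefficient_module \<Lambda> N b Lf"
    and linear_LX: "linear (LX g)"
    and LX: "\<gamma> \<in> carrier \<Gamma> \<Longrightarrow> AE x in M. \<forall>\<xi>.
      LX (\<gamma>, x) \<xi> = contragredient \<Lambda> b Lf (displacement \<Lambda> b (q (a \<gamma> x)) (q x), q x) \<xi>"
begin

abbreviation "LY \<equiv> contragredient \<Lambda> b Lf"

sublocale CX: pmp_coefficients \<Gamma> M a LX
  by (intro pmp_coefficients.intro pmp_coefficients_axioms.intro S.Q.X.pmp_axioms linear_LX)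

sublocale CY: pmp_coefficients \<Lambda> N b LY
  by (intro pmp_coefficients.intro pmp_coefficients_axioms.intro S.Q.Y.pmp_axioms linear_contragredient)

abbreviation "\<tau> \<equiv> S.Q.transl"
abbreviation "\<tau>' \<equiv> S.R.transl"

lemma coeff_norm: "\<lbrakk>l \<in> carrier \<Lambda>; y \<in> space N\<rbrakk> \<Longrightarrow> norm (Lf (l, y)) \<le> 1"
  by (rule coefficient_moduleD(1)[OF coeff S.Q.Y.countable_carrier S.Q.Y.prob_space_axioms])

lemma coeff_measurable:
  "f \<in> measurable N (count_space (carrier \<Lambda>)) \<Longrightarrow>
    (\<lambda>y. blinfun_apply (Lf (f y, y)) v) \<in> borel_measurable N"
  by (rule coefficient_moduleD(3)[OF coeff S.Q.Y.countable_carrier S.Q.Y.prob_space_axioms])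

definition multiplicative :: "'y \<Rightarrow> bool" where
  "multiplicative y \<longleftrightarrow> (\<forall>l\<in>carrier \<Lambda>. \<forall>l'\<in>carrier \<Lambda>.
     Lf (l' \<otimes>\<^bsub>\<Lambda>\<^esub> l, y) = Lf (l', b l y) o\<^sub>L Lf (l, y))"

lemma AE_multiplicative: "AE y in N. multiplicative y"
  unfolding multiplicative_def
  by (rule coefficient_moduleD(2)[OF coeff S.Q.Y.countable_carrier S.Q.Y.prob_space_axioms])

lemma LY_eq:
  assumes "l \<in> carrier \<Lambda>" "y \<in> space N"
  shows "LY (l, b (inv\<^bsub>\<Lambda>\<^esub> l) y) \<xi> = \<xi> o\<^sub>L Lf (inv\<^bsub>\<Lambda>\<^esub> l, y)"
  using assms by (simp add: contragredient_def gd_inv_def S.Q.Y.act_inv')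

text \<open>The arrow \<open>(\<gamma>, a (inv \<gamma>) x)\<close> is sent to an arrow with target
  \<open>q x\<close>, and the contragredient precomposes with \<open>Lf\<close> at its inverse,
  which therefore starts at \<open>q x\<close>.\<close>

lemma AE_LX_eq:
  "AE x in M. \<forall>\<gamma>\<in>carrier \<Gamma>. \<forall>\<xi>. LX (\<gamma>, a (inv\<^bsub>\<Gamma>\<^esub> \<gamma>) x) \<xi> = \<xi> o\<^sub>L Lf (inv\<^bsub>\<Lambda>\<^esub> (\<tau> x \<gamma>), q x)"
proof -
  have "AE x in M. \<forall>\<gamma>\<in>carrier \<Gamma>. \<forall>\<xi>. LX (\<gamma>, x) \<xi> = LY (displacement \<Lambda> b (q (a \<gamma> x)) (q x), q x) \<xi>"
    using LX by (simp add: AE_ball_countable[OF S.Q.X.countable_carrier])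
  from S.Q.X.AE_all_act[OF this] S.Q.AE_good show ?thesis
  proof eventually_elim
    case (elim x)
    show ?case
    proof (intro ballI allI)
      fix \<gamma> \<xi> assume \<gamma>: "\<gamma> \<in> carrier \<Gamma>"
      have "a \<gamma> (a (inv\<^bsub>\<Gamma>\<^esub> \<gamma>) x) = x"
        using \<gamma> S.Q.good_space[OF elim(2)] by (rule S.Q.X.act_inv')
      then have "LX (\<gamma>, a (inv\<^bsub>\<Gamma>\<^esub> \<gamma>) x) \<xi> = LY (\<tau> x \<gamma>, q (a (inv\<^bsub>\<Gamma>\<^esub> \<gamma>) x)) \<xi>"
        using elim(1) \<gamma> by (simp add: S.Q.transl_def)
      then show "LX (\<gamma>, a (inv\<^bsub>\<Gamma>\<^esub> \<gamma>) x) \<xi> = \<xi> o\<^sub>L Lf (inv\<^bsub>\<Lambda>\<^esub> (\<tau> x \<gamma>), q x)"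
        using S.Q.transl_act[OF elim(2) \<gamma>] by (simp add: contragredient_def gd_inv_def)
    qed
  qed
qed

lemma AE_invariant_X:
  assumes "CX.cochain_fun n f"
  shows "AE x in M. \<forall>\<gamma>\<in>carrier \<Gamma>. \<forall>t\<in>tuples \<Gamma> (Suc n).
    f (map (\<lambda>h. inv\<^bsub>\<Gamma>\<^esub> \<gamma> \<otimes>\<^bsub>\<Gamma>\<^esub> h) t) (a (inv\<^bsub>\<Gamma>\<^esub> \<gamma>) x) o\<^sub>L Lf (inv\<^bsub>\<Lambda>\<^esub> (\<tau> x \<gamma>), q x) = f t x"
  using CX.cochain_fun_invariant[OF assms] AE_LX_eq by eventually_elim simp

lemma AE_invariant_Y:
  assumes "CY.cochain_fun n f"
  shows "AE y in N. \<forall>l\<in>carrier \<Lambda>. \<forall>s\<in>tuples \<Lambda> (Suc n).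
    f (map (\<lambda>h. inv\<^bsub>\<Lambda>\<^esub> l \<otimes>\<^bsub>\<Lambda>\<^esub> h) s) (b (inv\<^bsub>\<Lambda>\<^esub> l) y) o\<^sub>L Lf (inv\<^bsub>\<Lambda>\<^esub> l, y) = f s y"
  using CY.cochain_fun_invariant[OF assms] AE_space by eventually_elim (simp add: LY_eq)

definition J :: "('l list \<Rightarrow> 'y \<Rightarrow> 'e \<Rightarrow>\<^sub>L real) \<Rightarrow> 'g list \<Rightarrow> 'x \<Rightarrow> 'e \<Rightarrow>\<^sub>L real" where
  "J f t x = f (map (\<tau> x) t) (q x)"

text \<open>The value at \<open>q' y\<close> lives over \<open>q (q' y)\<close>; the arrow \<open>\<kappa> y\<close> carries it back to \<open>y\<close>.\<close>

definition K :: "('g list \<Rightarrow> 'x \<Rightarrow> 'e \<Rightarrow>\<^sub>L real) \<Rightarrow> 'l list \<Rightarrow> 'y \<Rightarrow> 'e \<Rightarrow>\<^sub>L real" where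
  "K f t y = f (map (\<tau>' y) t) (q' y) o\<^sub>L Lf (inv\<^bsub>\<Lambda>\<^esub> (S.\<kappa> y), y)"

lemma blinfun_compose_id: "\<xi> o\<^sub>L id_blinfun = \<xi>"
  by (auto intro: blinfun_eqI)

lemma blinfun_compose_assoc': "\<xi> o\<^sub>L (A o\<^sub>L B) = (\<xi> o\<^sub>L A) o\<^sub>L B"
  by (auto intro: blinfun_eqI)

lemma J_linf:
  assumes f: "CY.cochain_fun n f" and t: "t \<in> tuples \<Gamma> (Suc n)"
  shows "J f t \<in> linf_fun M"
proof -
  obtain C where C: "AE y in N. \<forall>s\<in>tuples \<Lambda> (Suc n). norm (f s y) \<le> C"
    using CY.cochain_fun_bounded[OF f] by blast
  have "(\<lambda>x. f (map (\<tau> x) t) (q x) o\<^sub>L id_blinfun) \<in> linf_fun M"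
    by (rule S.Q.linf_fun_transl(1)[OF CY.cochain_fun_linf[OF f] C t])
      (auto intro!: norm_blinfun_bound)
  then show ?thesis
    by (simp add: J_def[abs_def] blinfun_compose_id)
qed

lemma J_bound:
  assumes "AE y in N. \<forall>s\<in>tuples \<Lambda> n. norm (f s y) \<le> C"
  shows "AE x in M. \<forall>t\<in>tuples \<Gamma> n. norm (J f t x) \<le> C"
  using S.Q.q_AE[OF assms] by eventually_elim (simp add: J_def S.Q.map_transl_tuples)

lemma \<kappa>_inv_measurable: "(\<lambda>y. inv\<^bsub>\<Lambda>\<^esub> (S.\<kappa> y)) \<in> measurable N (count_space (carrier \<Lambda>))"
  by (rule measurable_compose[OF S.\<kappa>_measurable]) auto

lemma K_linf:
  assumes f: "CX.cochain_fun n f" and t: "t \<in> tuples \<Lambda> (Suc n)"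
  shows "K f t \<in> linf_fun N"
proof -
  obtain C where C: "AE x in M. \<forall>s\<in>tuples \<Gamma> (Suc n). norm (f s x) \<le> C"
    using CX.cochain_fun_bounded[OF f] by blast
  show ?thesis
    unfolding K_def[abs_def]
    by (rule S.R.linf_fun_transl(1)[OF CX.cochain_fun_linf[OF f] C t])
      (auto intro!: coeff_norm coeff_measurable \<kappa>_inv_measurable simp: S.\<kappa>_closed)
qed

lemma K_bound:
  assumes f: "CX.cochain_fun n f" and C: "AE x in M. \<forall>s\<in>tuples \<Gamma> (Suc n). norm (f s x) \<le> C"
  shows "AE y in N. \<forall>t\<in>tuples \<Lambda> (Suc n). norm (K f t y) \<le> C"
  unfolding S.Q.Y.AE_all_tuples K_def
  by (intro ballI S.R.linf_fun_transl(2)[OF CX.cochain_fun_linf[OF f] C])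
    (auto intro!: coeff_norm coeff_measurable \<kappa>_inv_measurable simp: S.\<kappa>_closed)

text \<open>Translation by \<open>\<gamma>\<close> at \<open>x\<close> becomes translation by
  \<open>\<tau> x \<gamma>\<close> at \<open>q x\<close>. This element varies with \<open>x\<close>,
  so the invariance of \<open>f\<close> is used in its form valid for all group elements
  simultaneously.\<close>

lemma J_cochain_fun:
  assumes f: "CY.cochain_fun n f"
  shows "CX.cochain_fun n (J f)"
proof -
  obtain C where C: "AE y in N. \<forall>s\<in>tuples \<Lambda> (Suc n). norm (f s y) \<le> C"
    using CY.cochain_fun_bounded[OF f] by blast
  show ?thesis
  proof (rule CX.cochain_funI)
    fix t assume t: "t \<in> tuples \<Gamma> (Suc n)"
    show "J f t \<in> linf_fun M"
      by (rule J_linf[OF f t])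
    show "AE x in M. norm (J f t x) \<le> C"
      using J_bound[OF C] by eventually_elim (use t in simp)
    fix \<gamma> assume \<gamma>: "\<gamma> \<in> carrier \<Gamma>"
    from AE_LX_eq S.Q.AE_good S.Q.q_AE[OF AE_invariant_Y[OF f]]
    show "AE x in M. LX (\<gamma>, a (inv\<^bsub>\<Gamma>\<^esub> \<gamma>) x)
        (J f (map (\<lambda>h. inv\<^bsub>\<Gamma>\<^esub> \<gamma> \<otimes>\<^bsub>\<Gamma>\<^esub> h) t) (a (inv\<^bsub>\<Gamma>\<^esub> \<gamma>) x)) = J f t x"
    proof eventually_elim
      case (elim x)
      have "J f (map (\<lambda>h. inv\<^bsub>\<Gamma>\<^esub> \<gamma> \<otimes>\<^bsub>\<Gamma>\<^esub> h) t) (a (inv\<^bsub>\<Gamma>\<^esub> \<gamma>) x) =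
          f (map (\<lambda>h. inv\<^bsub>\<Lambda>\<^esub> (\<tau> x \<gamma>) \<otimes>\<^bsub>\<Lambda>\<^esub> h) (map (\<tau> x) t)) (b (inv\<^bsub>\<Lambda>\<^esub> (\<tau> x \<gamma>)) (q x))"
        unfolding J_def S.Q.map_transl_equivariant[OF elim(2) \<gamma> t] S.Q.transl_act_inv[OF elim(2) \<gamma>] ..
      then have "LX (\<gamma>, a (inv\<^bsub>\<Gamma>\<^esub> \<gamma>) x) (J f (map (\<lambda>h. inv\<^bsub>\<Gamma>\<^esub> \<gamma> \<otimes>\<^bsub>\<Gamma>\<^esub> h) t) (a (inv\<^bsub>\<Gamma>\<^esub> \<gamma>) x)) =
          f (map (\<lambda>h. inv\<^bsub>\<Lambda>\<^esub> (\<tau> x \<gamma>) \<otimes>\<^bsub>\<Lambda>\<^esub> h) (map (\<tau> x) t)) (b (inv\<^bsub>\<Lambda>\<^esub> (\<tau> x \<gamma>)) (q x))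
            o\<^sub>L Lf (inv\<^bsub>\<Lambda>\<^esub> (\<tau> x \<gamma>), q x)"
        using elim(1) \<gamma> by simp
      also have "\<dots> = f (map (\<tau> x) t) (q x)"
        using elim(3) S.Q.transl_closed S.Q.map_transl_tuples[OF t] by blast
      finally show ?case
        by (simp add: J_def)
    qed
  qed
qed

text \<open>There are two routes from \<open>y\<close> to the round trip of its translate: translate
  and then return, or make the round trip of \<open>y\<close> and then follow the image of the arrow
  in \<open>X\<close>. Freeness identifies them, multiplicativity of \<open>Lf\<close> splits each
  into its two factors, and the invariance of \<open>f\<close> at \<open>q' y\<close> absorbs the
  last one.\<close>

lemma K_cochain_fun:
  assumes f: "CX.cochain_fun n f"
  shows "CY.cochain_fun n (K f)"
proof -
  obtain C where C: "AE x in M. \<forall>s\<in>tuples \<Gamma> (Suc n). norm (f s x) \<le> C"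
    using CX.cochain_fun_bounded[OF f] by blast
  show ?thesis
  proof (rule CY.cochain_funI)
    fix t assume t: "t \<in> tuples \<Lambda> (Suc n)"
    show "K f t \<in> linf_fun N"
      by (rule K_linf[OF f t])
    show "AE y in N. norm (K f t y) \<le> C"
      using K_bound[OF f C] by eventually_elim (use t in simp)
    fix l assume l: "l \<in> carrier \<Lambda>"
    from S.AE_regular AE_multiplicative S.R.q_AE[OF AE_invariant_X[OF f]]
    show "AE y in N. LY (l, b (inv\<^bsub>\<Lambda>\<^esub> l) y)
        (K f (map (\<lambda>h. inv\<^bsub>\<Lambda>\<^esub> l \<otimes>\<^bsub>\<Lambda>\<^esub> h) t) (b (inv\<^bsub>\<Lambda>\<^esub> l) y)) = K f t y"
    proof eventually_elim
      case (elim y)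
      let ?y = "b (inv\<^bsub>\<Lambda>\<^esub> l) y" and ?\<gamma> = "\<tau>' y l"
      let ?\<sigma> = "\<tau> (q' y) ?\<gamma>"
      let ?F = "f (map (\<lambda>h. inv\<^bsub>\<Gamma>\<^esub> ?\<gamma> \<otimes>\<^bsub>\<Gamma>\<^esub> h) (map (\<tau>' y) t)) (a (inv\<^bsub>\<Gamma>\<^esub> ?\<gamma>) (q' y))"
      note y = S.regularD[OF elim(1)]
      have y1: "S.regular ?y"
        using elim(1) l by (simp add: S.regular_act)
      have q'y: "a (inv\<^bsub>\<Gamma>\<^esub> ?\<gamma>) (q' y) = q' ?y"
        by (rule S.R.transl_act_inv[OF y(2) l])
      have "K f (map (\<lambda>h. inv\<^bsub>\<Lambda>\<^esub> l \<otimes>\<^bsub>\<Lambda>\<^esub> h) t) ?y = ?F o\<^sub>L Lf (inv\<^bsub>\<Lambda>\<^esub> (S.\<kappa> ?y), ?y)"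
        unfolding K_def S.R.map_transl_equivariant[OF y(2) l t] q'y ..
      then have "LY (l, ?y) (K f (map (\<lambda>h. inv\<^bsub>\<Lambda>\<^esub> l \<otimes>\<^bsub>\<Lambda>\<^esub> h) t) ?y) =
          ?F o\<^sub>L (Lf (inv\<^bsub>\<Lambda>\<^esub> (S.\<kappa> ?y), ?y) o\<^sub>L Lf (inv\<^bsub>\<Lambda>\<^esub> l, y))"
        by (simp add: LY_eq[OF l y(1)] blinfun_compose_assoc')
      also have "Lf (inv\<^bsub>\<Lambda>\<^esub> (S.\<kappa> ?y), ?y) o\<^sub>L Lf (inv\<^bsub>\<Lambda>\<^esub> l, y) =
          Lf (inv\<^bsub>\<Lambda>\<^esub> (S.\<kappa> ?y) \<otimes>\<^bsub>\<Lambda>\<^esub> inv\<^bsub>\<Lambda>\<^esub> l, y)"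
        using elim(2) l by (simp add: multiplicative_def S.\<kappa>_closed)
      \<comment> \<open>Here the two routes are compared, as group elements acting on the free point
        \<open>y\<close>.\<close>
      also have "inv\<^bsub>\<Lambda>\<^esub> (S.\<kappa> ?y) \<otimes>\<^bsub>\<Lambda>\<^esub> inv\<^bsub>\<Lambda>\<^esub> l = inv\<^bsub>\<Lambda>\<^esub> ?\<sigma> \<otimes>\<^bsub>\<Lambda>\<^esub> inv\<^bsub>\<Lambda>\<^esub> (S.\<kappa> y)"
      proof (rule S.Q.Y.free_point_cancel)
        show "S.Q.Y.free_point y"
          by (rule S.R.good_free(1)[OF y(2)])
        have "b (inv\<^bsub>\<Lambda>\<^esub> ?\<sigma>) (q (q' y)) = q (a (inv\<^bsub>\<Gamma>\<^esub> ?\<gamma>) (q' y))"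
          by (rule S.Q.transl_act_inv[OF y(3) S.R.transl_closed])
        then show "b (inv\<^bsub>\<Lambda>\<^esub> (S.\<kappa> ?y) \<otimes>\<^bsub>\<Lambda>\<^esub> inv\<^bsub>\<Lambda>\<^esub> l) y = b (inv\<^bsub>\<Lambda>\<^esub> ?\<sigma> \<otimes>\<^bsub>\<Lambda>\<^esub> inv\<^bsub>\<Lambda>\<^esub> (S.\<kappa> y)) y"
          using l y(1) S.\<kappa>_act_inv[OF y1] S.\<kappa>_act_inv[OF elim(1)]
          by (simp add: S.Q.Y.act_mult S.\<kappa>_closed S.Q.transl_closed q'y)
      qed (use l in \<open>simp_all add: S.\<kappa>_closed S.Q.transl_closed\<close>)
      also have "Lf (inv\<^bsub>\<Lambda>\<^esub> ?\<sigma> \<otimes>\<^bsub>\<Lambda>\<^esub> inv\<^bsub>\<Lambda>\<^esub> (S.\<kappa> y), y) =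
          Lf (inv\<^bsub>\<Lambda>\<^esub> ?\<sigma>, q (q' y)) o\<^sub>L Lf (inv\<^bsub>\<Lambda>\<^esub> (S.\<kappa> y), y)"
        using elim(2) S.\<kappa>_act_inv[OF elim(1)]
        by (simp add: multiplicative_def S.\<kappa>_closed S.Q.transl_closed)
      also have "?F o\<^sub>L (Lf (inv\<^bsub>\<Lambda>\<^esub> ?\<sigma>, q (q' y)) o\<^sub>L Lf (inv\<^bsub>\<Lambda>\<^esub> (S.\<kappa> y), y)) =
          (?F o\<^sub>L Lf (inv\<^bsub>\<Lambda>\<^esub> ?\<sigma>, q (q' y))) o\<^sub>L Lf (inv\<^bsub>\<Lambda>\<^esub> (S.\<kappa> y), y)"
        by (rule blinfun_compose_assoc')
      also have "?F o\<^sub>L Lf (inv\<^bsub>\<Lambda>\<^esub> ?\<sigma>, q (q' y)) = f (map (\<tau>' y) t) (q' y)"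
        using elim(3) S.R.transl_closed S.R.map_transl_tuples[OF t] by blast
      finally show ?case
        by (simp add: K_def)
    qed
  qed
qed

text \<open>By \<open>transl_transl\<close> the tuple seen by \<open>f\<close> is the moved tuple
  with a common left factor \<open>inv (\<kappa> y)\<close>. The coefficient in \<open>K\<close> is
  precisely what the invariance of \<open>f\<close> needs to remove this factor and return the base
  point to \<open>y\<close>.\<close>

lemma K_J:
  assumes f: "CY.cochain_fun n f"
  shows "AE y in N. \<forall>t\<in>tuples \<Lambda> (Suc n).
    K (J f) t y = f (map (\<lambda>h. h \<otimes>\<^bsub>\<Lambda>\<^esub> S.\<kappa> (b (inv\<^bsub>\<Lambda>\<^esub> h) y)) t) y"
  using S.AE_regular AE_invariant_Y[OF f]
proof eventually_elim
  case (elim y)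
  show ?case
  proof
    fix t assume t: "t \<in> tuples \<Lambda> (Suc n)"
    define s where "s = map (\<lambda>h. h \<otimes>\<^bsub>\<Lambda>\<^esub> S.\<kappa> (b (inv\<^bsub>\<Lambda>\<^esub> h) y)) t"
    have s: "s \<in> tuples \<Lambda> (Suc n)"
      unfolding s_def by (rule S.Q.Y.tuples_map[OF t]) (simp add: S.\<kappa>_closed)
    have "map (\<tau> (q' y)) (map (\<tau>' y) t) = map (\<lambda>h. inv\<^bsub>\<Lambda>\<^esub> (S.\<kappa> y) \<otimes>\<^bsub>\<Lambda>\<^esub> h) s"
      using t by (auto simp: s_def tuples_def S.transl_transl[OF elim(1)])
    then have "K (J f) t y = f (map (\<lambda>h. inv\<^bsub>\<Lambda>\<^esub> (S.\<kappa> y) \<otimes>\<^bsub>\<Lambda>\<^esub> h) s) (b (inv\<^bsub>\<Lambda>\<^esub> (S.\<kappa> y)) y)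
        o\<^sub>L Lf (inv\<^bsub>\<Lambda>\<^esub> (S.\<kappa> y), y)"
      by (simp add: K_def J_def S.\<kappa>_act_inv[OF elim(1)])
    also have "\<dots> = f s y"
      using elim(2) s S.\<kappa>_closed by blast
    finally show "K (J f) t y = f s y" .
  qed
qed

lemma J_K:
  assumes f: "CX.cochain_fun n f"
  shows "AE x in M. \<forall>t\<in>tuples \<Gamma> (Suc n).
    J (K f) t x = f (map (\<lambda>h. h \<otimes>\<^bsub>\<Gamma>\<^esub> S'.\<kappa> (a (inv\<^bsub>\<Gamma>\<^esub> h) x)) t) x"
  using S'.AE_regular AE_invariant_X[OF f]
proof eventually_elim
  case (elim x)
  show ?case
  proof
    fix t assume t: "t \<in> tuples \<Gamma> (Suc n)"
    define s where "s = map (\<lambda>h. h \<otimes>\<^bsub>\<Gamma>\<^esub> S'.\<kappa> (a (inv\<^bsub>\<Gamma>\<^esub> h) x)) t"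
    have s: "s \<in> tuples \<Gamma> (Suc n)"
      unfolding s_def by (rule S.Q.X.tuples_map[OF t]) (simp add: S'.\<kappa>_closed)
    have "map (\<tau>' (q x)) (map (\<tau> x) t) = map (\<lambda>h. inv\<^bsub>\<Gamma>\<^esub> (S'.\<kappa> x) \<otimes>\<^bsub>\<Gamma>\<^esub> h) s"
      using t by (auto simp: s_def tuples_def S'.transl_transl[OF elim(1)])
    \<comment> \<open>The round trip arrow in \<open>Y\<close> at \<open>q x\<close> is the image
      under \<open>q\<close> of the round trip arrow in \<open>X\<close> at \<open>x\<close>; so the
      coefficient in \<open>K\<close> is the one in the invariance of \<open>f\<close> over
      \<open>X\<close>.\<close>
    moreover have "S.\<kappa> (q x) = \<tau> x (S'.\<kappa> x)"
      by (simp add: S.\<kappa>_def S.Q.transl_def S'.\<kappa>_act_inv[OF elim(1)])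
    ultimately have "J (K f) t x = f (map (\<lambda>h. inv\<^bsub>\<Gamma>\<^esub> (S'.\<kappa> x) \<otimes>\<^bsub>\<Gamma>\<^esub> h) s) (a (inv\<^bsub>\<Gamma>\<^esub> (S'.\<kappa> x)) x)
        o\<^sub>L Lf (inv\<^bsub>\<Lambda>\<^esub> (\<tau> x (S'.\<kappa> x)), q x)"
      by (simp add: K_def J_def S'.\<kappa>_act_inv[OF elim(1)])
    also have "\<dots> = f s x"
      using elim(2) s S'.\<kappa>_closed by blast
    finally show "J (K f) t x = f s x" .
  qed
qed

sublocale OJ: cochain_operator \<Lambda> N b LY \<Gamma> M a LX J
proof
  show "CX.cochain_fun n (J f)" if "CY.cochain_fun n f" for n f
    by (rule J_cochain_fun[OF that])
  show "J (\<lambda>t y. f t y + g t y) t x = J f t x + J g t x" for f g t x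
    by (simp add: J_def)
  show "J (\<lambda>t y. r *\<^sub>R f t y) t x = r *\<^sub>R J f t x" for r f t x
    by (simp add: J_def)
  show "J (\<lambda>t y. altsum (\<lambda>s. f s y) t) t x = altsum (\<lambda>s. J f s x) t" for f t x
    by (simp add: J_def altsum_map)
  show "AE x in M. \<forall>t\<in>tuples \<Gamma> n. J f t x = J g t x"
    if "AE y in N. \<forall>s\<in>tuples \<Lambda> n. f s y = g s y" for n f g
    using S.Q.q_AE[OF that] by eventually_elim (simp add: J_def S.Q.map_transl_tuples)
  show "AE x in M. \<forall>t\<in>tuples \<Gamma> (Suc n). norm (J f t x) \<le> C"
    if "CY.cochain_fun n f" "AE y in N. \<forall>s\<in>tuples \<Lambda> (Suc n). norm (f s y) \<le> C" for n f C
    by (rule J_bound[OF that(2)])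
qed

sublocale OK: cochain_operator \<Gamma> M a LX \<Lambda> N b LY K
proof
  have lin: "linear (\<lambda>\<xi>. \<xi> o\<^sub>L B)" for B :: "'e \<Rightarrow>\<^sub>L 'e"
    by (rule linearI) (auto intro!: blinfun_eqI simp: blinfun.bilinear_simps)
  show "CY.cochain_fun n (K f)" if "CX.cochain_fun n f" for n f
    by (rule K_cochain_fun[OF that])
  show "K (\<lambda>t y. f t y + g t y) t x = K f t x + K g t x" for f g t x
    by (simp add: K_def linear_add[OF lin])
  show "K (\<lambda>t y. r *\<^sub>R f t y) t x = r *\<^sub>R K f t x" for r f t x
    by (simp add: K_def linear_scale[OF lin])
  show "K (\<lambda>t y. altsum (\<lambda>s. f s y) t) t x = altsum (\<lambda>s. K f s x) t" for f t x
    by (simp add: K_def altsum_map altsum_linear[OF lin])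
  show "AE x in N. \<forall>t\<in>tuples \<Lambda> n. K f t x = K g t x"
    if "AE y in M. \<forall>s\<in>tuples \<Gamma> n. f s y = g s y" for n f g
    using S.R.q_AE[OF that] by eventually_elim (simp add: K_def S.R.map_transl_tuples)
  show "AE x in N. \<forall>t\<in>tuples \<Lambda> (Suc n). norm (K f t x) \<le> C"
    if "CX.cochain_fun n f" "AE y in M. \<forall>s\<in>tuples \<Gamma> (Suc n). norm (f s y) \<le> C" for n f C
    by (rule K_bound[OF that])
qed

lemma K_J_cohomologous:
  assumes "z \<in> bcocycles \<Lambda> CY.mdl n"
  shows "OK.lift n (OJ.lift n z) \<in> vcoset (bcochains \<Lambda> CY.mdl n) (bcoboundaries \<Lambda> CY.mdl n) z"
proof -
  obtain f where f: "CY.cochain_fun n f" "z = CY.cls n f"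
    using assms by (auto simp: bcocycles_def elim: CY.bcochainsE)
  show ?thesis
    unfolding f(2) OJ.lift_cls[OF f(1)] OK.lift_cls[OF J_cochain_fun[OF f(1)]]
    using CY.prism_homotopic_cohomologous[OF assms[unfolded f(2)] f(1)
        K_cochain_fun[OF J_cochain_fun[OF f(1)]] S.\<kappa>_measurable K_J[OF f(1)]] .
qed

lemma J_K_cohomologous:
  assumes "z \<in> bcocycles \<Gamma> CX.mdl n"
  shows "OJ.lift n (OK.lift n z) \<in> vcoset (bcochains \<Gamma> CX.mdl n) (bcoboundaries \<Gamma> CX.mdl n) z"
proof -
  obtain f where f: "CX.cochain_fun n f" "z = CX.cls n f"
    using assms by (auto simp: bcocycles_def elim: CX.bcochainsE)
  show ?thesis
    unfolding f(2) OK.lift_cls[OF f(1)] OJ.lift_cls[OF K_cochain_fun[OF f(1)]]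
    using CX.prism_homotopic_cohomologous[OF assms[unfolded f(2)] f(1)
        J_cochain_fun[OF K_cochain_fun[OF f(1)]] S'.\<kappa>_measurable J_K[OF f(1)]] .
qed

theorem cohomology_isomorphism:
  "\<exists>\<Phi>. isometric_isomorphism (bounded_cohomology \<Lambda> CY.mdl n) (bounded_cohomology \<Gamma> CX.mdl n) \<Phi> \<and>
       induced_in_cohomology \<Lambda> CY.mdl \<Gamma> CX.mdl OJ.lift n \<Phi>"
  unfolding bounded_cohomology_def induced_in_cohomology_def cohomology_class_def
proof (rule homotopy_inverse_isometric[where J = "OJ.lift n" and K = "OK.lift n"])
  show "linear_between (bcochains \<Lambda> CY.mdl n) (bcochains \<Gamma> CX.mdl n) (OJ.lift n)"
    using OJ.cochain_map_lift by (simp add: cochain_map_def)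
  show "linear_between (bcochains \<Gamma> CX.mdl n) (bcochains \<Lambda> CY.mdl n) (OK.lift n)"
    using OK.cochain_map_lift by (simp add: cochain_map_def)
qed (intro CX.seminormed_carrier_bcochains CY.seminormed_carrier_bcochains
    CX.subspace_bcocycles CY.subspace_bcocycles CX.subspace_bcoboundaries CY.subspace_bcoboundaries
    OJ.lift_bcocycles OK.lift_bcocycles OJ.lift_bcoboundaries OK.lift_bcoboundaries
    OJ.vnorm_lift_le OK.vnorm_lift_le K_J_cohomologous J_K_cohomologous; assumption?)+

text \<open>Since \<open>a \<gamma>\<close> undoes \<open>a (inv \<gamma>)\<close>, the cocycle in
  the explicit formula and \<open>\<tau> x \<gamma>\<close> are the same
  \<open>displacement\<close>, at every point of the space.\<close>

lemma oe_cochain_map_lift: "oe_cochain_map \<Gamma> M a \<Lambda> b q = OJ.lift"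
proof (intro ext)
  fix n \<theta> t
  have "ae_class M (\<lambda>x. rep (\<theta> (map (\<lambda>\<gamma>. oe_cocycle a \<Lambda> b q \<gamma> (a (inv\<^bsub>\<Gamma>\<^esub> \<gamma>) x)) t)) (q x)) =
      ae_class M (J (\<lambda>s. rep (\<theta> s)) t)" if t: "t \<in> tuples \<Gamma> (Suc n)"
  proof (rule ae_class_cong, rule AE_I2)
    fix x assume x: "x \<in> space M"
    have "map (\<lambda>\<gamma>. oe_cocycle a \<Lambda> b q \<gamma> (a (inv\<^bsub>\<Gamma>\<^esub> \<gamma>) x)) t = map (\<tau> x) t"
      using t x by (auto simp: tuples_def oe_cocycle_displacement S.Q.transl_def S.Q.X.act_inv')
    then show "rep (\<theta> (map (\<lambda>\<gamma>. oe_cocycle a \<Lambda> b q \<gamma> (a (inv\<^bsub>\<Gamma>\<^esub> \<gamma>) x)) t)) (q x) =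
        J (\<lambda>s. rep (\<theta> s)) t x"
      by (simp only: J_def)
  qed
  then show "oe_cochain_map \<Gamma> M a \<Lambda> b q n \<theta> t = OJ.lift n \<theta> t"
    by (simp add: oe_cochain_map_def OJ.lift_def CX.cls_def)
qed

end

section \<open>Correspondences from orbit equivalences\<close>

context pmp
begin

lemma orbit_space: "\<lbrakk>x \<in> space M; y \<in> orbit \<Gamma> a x\<rbrakk> \<Longrightarrow> y \<in> space M"
  by (auto simp: orbit_def act_closed)

lemma orbit_common:
  assumes "x \<in> space M" "y \<in> orbit \<Gamma> a x" "z \<in> orbit \<Gamma> a x"
  shows "z \<in> orbit \<Gamma> a y"
  using act.orbit_trans[OF _ assms(1) _ act.orbit_sym[OF assms(1) _ assms(2)] assms(3)]
    orbit_space[OF assms(1,2)] orbit_space[OF assms(1,3)] by blast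

text \<open>Almost every point has \<open>P\<close> on its whole orbit, in particular at
  \<open>p x\<close>. Thus moving points within their orbits pulls null sets back to null
  sets.\<close>

lemma AE_orbit:
  assumes "AE x in M. P x" and "AE x in M. p x \<in> orbit \<Gamma> a x"
  shows "AE x in M. P (p x)"
  using AE_all_act[OF assms(1)] assms(2) by eventually_elim (auto simp: orbit_def)

text \<open>The saturation of \<open>V\<close> is invariant and has positive measure, hence is
  conull. The map \<open>p\<close> applies the first group element, in a fixed enumeration, that
  brings the point into \<open>V\<close>.\<close>

lemma ergodic_return:
  assumes erg: "ergodic \<Gamma> M a" and V: "V \<in> sets M" "emeasure M V > 0"
  obtains p where "p \<in> measurable M M" "AE x in M. p x \<in> orbit \<Gamma> a x \<inter> V"
proof -
  define S where "S \<gamma> = a \<gamma> -` V \<inter> space M" for \<gamma>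
  have S: "S \<gamma> \<in> sets M" if "\<gamma> \<in> carrier \<Gamma>" for \<gamma>
    unfolding S_def by (rule measurable_sets[OF act_measurable[OF that] V(1)])
  define A where "A = (\<Union>\<gamma>\<in>carrier \<Gamma>. S \<gamma>)"
  have A: "A \<in> sets M"
    unfolding A_def by (intro sets.countable_UN'' countable_carrier S)
  have A_act: "a \<gamma> x \<in> A" if "\<gamma> \<in> carrier \<Gamma>" "x \<in> A" for \<gamma> x
  proof -
    obtain \<delta> where \<delta>: "\<delta> \<in> carrier \<Gamma>" "x \<in> space M" "a \<delta> x \<in> V"
      using \<open>x \<in> A\<close> by (auto simp: A_def S_def)
    then have "a (\<delta> \<otimes> inv \<gamma>) (a \<gamma> x) \<in> V"
      using \<open>\<gamma> \<in> carrier \<Gamma>\<close> by (simp add: act_mult act_closed act_inv)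
    moreover have "\<delta> \<otimes> inv \<gamma> \<in> carrier \<Gamma>"
      using \<delta> \<open>\<gamma> \<in> carrier \<Gamma>\<close> by simp
    ultimately show ?thesis
      using \<delta> \<open>\<gamma> \<in> carrier \<Gamma>\<close> act_closed unfolding A_def S_def by blast
  qed
  have "a \<gamma> ` A = A" if \<gamma>: "\<gamma> \<in> carrier \<Gamma>" for \<gamma>
  proof
    show "a \<gamma> ` A \<subseteq> A"
      using A_act[OF \<gamma>] by blast
    show "A \<subseteq> a \<gamma> ` A"
    proof
      fix x assume x: "x \<in> A"
      then have "a \<gamma> (a (inv \<gamma>) x) = x"
        using A sets.sets_into_space \<gamma> by (intro act_inv') auto
      then show "x \<in> a \<gamma> ` A"
        using A_act[OF _ x, of "inv \<gamma>"] \<gamma> by (metis imageI inv_closed)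
    qed
  qed
  then have "measure M A = 0 \<or> measure M A = 1"
    using erg A by (simp add: ergodic_def)
  moreover have "V \<subseteq> A"
  proof
    fix x assume "x \<in> V"
    moreover from this have "x \<in> space M"
      using sets.sets_into_space[OF V(1)] by blast
    ultimately have "x \<in> S \<one>"
      by (simp add: S_def act_one)
    then show "x \<in> A"
      unfolding A_def by blast
  qed
  then have "measure M A > 0"
    using finite_measure_mono[OF _ A, of V] V(2) by (simp add: emeasure_eq_measure)
  ultimately have "AE x in M. x \<in> A"
    using prob_eq_1[OF A] by auto
  define g where "g = from_nat_into (carrier \<Gamma>)"
  have g: "g k \<in> carrier \<Gamma>" for k
    unfolding g_def by (rule from_nat_into) auto
  define k where "k x = (LEAST k. x \<in> S (g k))" for x
  have pred: "Measurable.pred M (\<lambda>x. x \<in> S (g i))" for i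
  proof -
    have "{x \<in> space M. x \<in> S (g i)} = S (g i)"
      by (auto simp: S_def)
    then show ?thesis
      using S[OF g] by (simp add: pred_def)
  qed
  have k_meas: "k \<in> measurable M (count_space UNIV)"
    unfolding k_def[abs_def] using pred by (rule measurable_Least)
  \<comment> \<open>Off the saturation no index qualifies and the \<open>LEAST\<close> has one fixed
    unspecified value; \<open>k\<close> is still measurable there, and this set is null.\<close>
  show thesis
  proof
    show "(\<lambda>x. a (g (k x)) x) \<in> measurable M M"
      by (rule measurable_compose_countable[OF act_measurable[OF g] k_meas])
    show "AE x in M. a (g (k x)) x \<in> orbit \<Gamma> a x \<inter> V"
      using \<open>AE x in M. x \<in> A\<close>
    proof eventually_elim
      case (elim x)
      then obtain \<gamma> where "\<gamma> \<in> carrier \<Gamma>" "x \<in> S \<gamma>"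
        by (auto simp: A_def)
      then have "x \<in> S (g (to_nat_on (carrier \<Gamma>) \<gamma>))"
        using countable_carrier by (simp add: g_def)
      then have "x \<in> S (g (k x))"
        unfolding k_def by (rule LeastI)
      then show ?case
        using g by (auto simp: S_def orbit_def)
    qed
  qed
qed

end

text \<open>The form shared by full and weak equivalences: the maps are total and measurable, so
  they compose with maps moving points within orbits, but they are controlled only on
  \<open>X'\<close> and \<open>Y'\<close>, which need not be conull.\<close>

locale partial_orbit_equivalence = X: free_pmp \<Gamma> M a + Y: free_pmp \<Lambda> N b
  for \<Gamma> :: "('g, 'm) monoid_scheme" and M :: "'x measure" and a :: "'g \<Rightarrow> 'x \<Rightarrow> 'x"
    and \<Lambda> :: "('l, 'n) monoid_scheme" and N :: "'y measure" and b :: "'l \<Rightarrow> 'y \<Rightarrow> 'y" +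
  fixes T :: "'x \<Rightarrow> 'y" and T' :: "'y \<Rightarrow> 'x" and X' :: "'x set" and Y' :: "'y set"
  assumes X'_sets: "X' \<in> sets M" and Y'_sets: "Y' \<in> sets N"
    and T_measurable: "T \<in> measurable M N" and T'_measurable: "T' \<in> measurable N M"
    and T_in: "x \<in> X' \<Longrightarrow> T x \<in> Y'" and T'_in: "y \<in> Y' \<Longrightarrow> T' y \<in> X'"
    and T'_T: "x \<in> X' \<Longrightarrow> T' (T x) = x" and T_T': "y \<in> Y' \<Longrightarrow> T (T' y) = y"
    and T_AE: "\<And>P. AE y in N. P y \<Longrightarrow> AE x in M. x \<in> X' \<longrightarrow> P (T x)"
    and T'_AE: "\<And>P. AE x in M. P x \<Longrightarrow> AE y in N. y \<in> Y' \<longrightarrow> P (T' y)"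
    and T_orbit: "\<lbrakk>x \<in> X'; x1 \<in> X'; x1 \<in> orbit \<Gamma> a x\<rbrakk> \<Longrightarrow> T x1 \<in> orbit \<Lambda> b (T x)"
    and T'_orbit: "\<lbrakk>y \<in> Y'; y1 \<in> Y'; y1 \<in> orbit \<Lambda> b y\<rbrakk> \<Longrightarrow> T' y1 \<in> orbit \<Gamma> a (T' y)"
begin

lemma swap: "partial_orbit_equivalence \<Lambda> N b \<Gamma> M a T' T Y' X'"
  by unfold_locales (fact X'_sets Y'_sets T_measurable T'_measurable T_T' T'_T T_in T'_in
      T_orbit T'_orbit T_AE T'_AE)+

text \<open>Nonsingularity is that of \<open>p\<close> from \<open>AE_orbit\<close> followed by that
  of \<open>T\<close> on \<open>X'\<close>. The equation for \<open>q\<close> holds almost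
  everywhere only, so that \<open>q\<close> may be the given equivalence and not its
  modification.\<close>

lemma orbit_morphism_compose:
  assumes p: "AE x in M. p x \<in> orbit \<Gamma> a x \<inter> X'"
    and q: "q \<in> measurable M N" "AE x in M. q x = T (p x)"
  shows "orbit_morphism \<Gamma> M a \<Lambda> N b q"
proof
  have p_orbit: "AE x in M. p x \<in> orbit \<Gamma> a x"
    using p by eventually_elim simp
  show "q \<in> measurable M N"
    by (rule q)
  show "AE x in M. P (q x)" if "AE y in N. P y" for P
    using X.AE_orbit[OF T_AE[OF that] p_orbit] p q(2) by eventually_elim simp
  have pq: "AE x in M. p x \<in> orbit \<Gamma> a x \<inter> X' \<and> q x = T (p x)"
    using p q(2) by eventually_elim simp
  from pq X.AE_all_act[OF pq] AE_space
  show "AE x in M. \<forall>\<gamma>\<in>carrier \<Gamma>. q (a \<gamma> x) \<in> orbit \<Lambda> b (q x)"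
  proof eventually_elim
    case (elim x)
    show ?case
    proof
      fix \<gamma> assume \<gamma>: "\<gamma> \<in> carrier \<Gamma>"
      have "a \<gamma> x \<in> orbit \<Gamma> a x"
        using \<gamma> by (auto simp: orbit_def)
      then have "p (a \<gamma> x) \<in> orbit \<Gamma> a x"
        using X.act.orbit_trans[OF elim(3) X.act_closed[OF \<gamma> elim(3)], of "p (a \<gamma> x)"]
          X.orbit_space[OF X.act_closed[OF \<gamma> elim(3)]] elim \<gamma> by blast
      then have "p (a \<gamma> x) \<in> orbit \<Gamma> a (p x)"
        using X.orbit_common[OF elim(3)] elim(1) by blast
      then show "q (a \<gamma> x) \<in> orbit \<Lambda> b (q x)"
        using T_orbit elim \<gamma> by auto
    qed
  qed
qed

text \<open>The round trip is \<open>p'\<close>, then \<open>T'\<close>, then \<open>p\<close>, then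
  \<open>T\<close>. The inner \<open>p\<close> stays in the orbit of a point of \<open>X'\<close>,
  so \<open>T\<close> brings it back to the orbit of \<open>p' y\<close>, which is that of
  \<open>y\<close>.\<close>

lemma return_compose:
  assumes p: "AE x in M. p x \<in> orbit \<Gamma> a x \<inter> X'" and p': "AE y in N. p' y \<in> orbit \<Lambda> b y \<inter> Y'"
    and q: "AE x in M. q x = T (p x)" and q': "AE y in N. q' y = T' (p' y)"
  shows "AE y in N. q (q' y) \<in> orbit \<Lambda> b y"
proof -
  have p'_orbit: "AE y in N. p' y \<in> orbit \<Lambda> b y"
    using p' by eventually_elim simp
  have "AE x in M. p x \<in> orbit \<Gamma> a x \<inter> X' \<and> q x = T (p x)"
    using p q by eventually_elim simp
  from Y.AE_orbit[OF T'_AE[OF this] p'_orbit] p' q' AE_space show ?thesis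
  proof eventually_elim
    case (elim y)
    have p'y: "p' y \<in> Y'" "p' y \<in> orbit \<Lambda> b y" and q'y: "q' y = T' (p' y)"
      using elim by auto
    then have px: "p (q' y) \<in> orbit \<Gamma> a (q' y)" "p (q' y) \<in> X'" "q (q' y) = T (p (q' y))"
      using elim by auto
    have "T (p (q' y)) \<in> orbit \<Lambda> b (p' y)"
      using T_orbit[OF T'_in[OF p'y(1)], of "p (q' y)"] px p'y(1) by (simp add: q'y T_T')
    then show ?case
      using Y.act.orbit_trans[OF elim(4) _ _ p'y(2)] Y.orbit_space[OF elim(4) p'y(2)]
        Y.orbit_space px(3) by metis
  qed
qed

lemma orbit_return_compose:
  assumes p: "AE x in M. p x \<in> orbit \<Gamma> a x \<inter> X'" and p': "AE y in N. p' y \<in> orbit \<Lambda> b y \<inter> Y'"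
    and q: "q \<in> measurable M N" "AE x in M. q x = T (p x)"
    and q': "q' \<in> measurable N M" "AE y in N. q' y = T' (p' y)"
  shows "orbit_return \<Gamma> M a \<Lambda> N b q q'"
proof -
  interpret S: partial_orbit_equivalence \<Lambda> N b \<Gamma> M a T' T Y' X'
    by (rule swap)
  show ?thesis
    using orbit_morphism_compose[OF p q] S.orbit_morphism_compose[OF p' q']
      return_compose[OF p p' q(2) q'(2)]
    by (simp add: orbit_return_def orbit_return_axioms_def)
qed

end

text \<open>Keeps only what survives rescaling: the space, the measurable sets and the null sets. It
  covers a whole space and a normalized restriction at once.\<close>

definition carried_by :: "'x measure \<Rightarrow> 'x measure \<Rightarrow> 'x set \<Rightarrow> bool" where
  "carried_by M1 M U \<longleftrightarrow> U \<in> sets M \<and> space M1 = U \<and> (\<forall>A. A \<in> sets M1 \<longleftrightarrow> A \<in> sets M \<and> A \<subseteq> U) \<and>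
     (\<forall>P. (AE x in M1. P x) \<longleftrightarrow> (AE x in M. x \<in> U \<longrightarrow> P x))"

lemma carried_by_AE:
  "carried_by M1 M U \<Longrightarrow> (AE x in M1. P x) \<longleftrightarrow> (AE x in M. x \<in> U \<longrightarrow> P x)"
  by (simp add: carried_by_def)

lemma carried_by_self: "carried_by M M (space M)"
proof -
  have "(AE x in M. P x) \<longleftrightarrow> (AE x in M. x \<in> space M \<longrightarrow> P x)" for P
    by (rule AE_cong) simp
  then show ?thesis
    using sets.sets_into_space by (auto simp: carried_by_def)
qed

lemma carried_by_normalized_restriction:
  assumes M: "prob_space M" and U: "U \<in> sets M" "emeasure M U > 0"
  shows "carried_by (normalized_restriction M U) M U"
proof -
  interpret prob_space M by fact
  let ?R = "restrict_space M U"
  have UM: "U \<inter> space M = U"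
    using sets.sets_into_space[OF U(1)] by auto
  have "1 / emeasure M U \<noteq> 0"
    using emeasure_finite[of U] by (simp add: ennreal_divide_eq_0_iff)
  then have "null_sets (normalized_restriction M U) = null_sets ?R"
    by (auto simp: normalized_restriction_def null_sets_def)
  then have "(AE x in normalized_restriction M U. P x) \<longleftrightarrow> (AE x in ?R. P x)" for P
    by (simp add: eventually_ae_filter normalized_restriction_def space_scale_measure)
  moreover have "(AE x in ?R. P x) \<longleftrightarrow> (AE x in M. x \<in> U \<longrightarrow> P x)" for P
    by (rule AE_restrict_space_iff) (simp add: UM U)
  ultimately show ?thesis
    unfolding carried_by_def normalized_restriction_def
    using U UM by (auto simp: space_scale_measure space_restrict_space sets_restrict_space_iff)
qed

text \<open>Off the sets where the equivalence is bijective, \<open>T\<close> and its inverse are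
  replaced by constants \<open>y0\<close> and \<open>x0\<close>, which makes both maps total and
  measurable between the full spaces.\<close>

lemma orbit_equivalence_partial:
  assumes X: "free_pmp \<Gamma> M a" and Y: "free_pmp \<Lambda> N b"
    and M1: "carried_by M1 M U" and N1: "carried_by N1 N V"
    and oe: "orbit_equivalence \<Gamma> M1 a \<Lambda> N1 b T"
  obtains T1 T' X' Y' where "partial_orbit_equivalence \<Gamma> M a \<Lambda> N b T1 T' X' Y'"
    "\<And>x. x \<in> X' \<Longrightarrow> T1 x = T x" "AE x in M. x \<in> U \<longrightarrow> x \<in> X'" "AE y in N. y \<in> V \<longrightarrow> y \<in> Y'"
proof -
  interpret X: free_pmp \<Gamma> M a by fact
  interpret Y: free_pmp \<Lambda> N b by fact
  have T: "T \<in> measurable M1 N1" and dT: "distr M1 N1 T = N1"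
    using oe by (auto simp: orbit_equivalence_def)
  obtain X' Y' where XY: "X' \<in> sets M1" "Y' \<in> sets N1" "AE x in M1. x \<in> X'" "AE y in N1. y \<in> Y'"
    "bij_betw T X' Y'"
    "the_inv_into X' T \<in> measurable (restrict_space N1 Y') (restrict_space M1 X')"
    and orb: "\<And>x. x \<in> X' \<Longrightarrow> T ` (orbit \<Gamma> a x \<inter> X') = orbit \<Lambda> b (T x) \<inter> Y'"
    using oe unfolding orbit_equivalence_def by blast
  have X': "X' \<in> sets M" "X' \<subseteq> U" and Y': "Y' \<in> sets N" "Y' \<subseteq> V"
    using XY M1 N1 by (auto simp: carried_by_def)
  have sub: "X' \<subseteq> space M" "Y' \<subseteq> space N"
    using sets.sets_into_space[OF X'(1)] sets.sets_into_space[OF Y'(1)] by auto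
  obtain x0 y0 where x0: "x0 \<in> space M" and y0: "y0 \<in> space N"
    using X.not_empty Y.not_empty by auto
  define T1 where "T1 x = (if x \<in> X' then T x else y0)" for x
  define T' where "T' y = (if y \<in> Y' then the_inv_into X' T y else x0)" for y
  have inj: "inj_on T X'" and im: "T ` X' = Y'"
    using XY(5) by (auto simp: bij_betw_def)
  have T_in: "T1 x \<in> Y'" and T'_T: "T' (T1 x) = x" if "x \<in> X'" for x
    using that im the_inv_into_f_f[OF inj that] by (auto simp: T1_def T'_def)
  have T'_in: "T' y \<in> X'" and T_T': "T1 (T' y) = y" if "y \<in> Y'" for y
    using that im the_inv_into_into[OF inj, of y X'] f_the_inv_into_f[OF inj, of y]
    by (auto simp: T1_def T'_def)
  have T1_meas: "T1 \<in> measurable M N"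
  proof (rule measurableI)
    show "T1 x \<in> space N" for x
      using T_in y0 sub by (cases "x \<in> X'") (auto simp: T1_def)
    fix A assume A: "A \<in> sets N"
    have "A \<inter> V \<in> sets N1"
      using A N1 by (auto simp: carried_by_def)
    from measurable_sets[OF T this] have "T -` (A \<inter> V) \<inter> space M1 \<in> sets M"
      using M1 by (auto simp: carried_by_def)
    then have "(T -` (A \<inter> V) \<inter> space M1) \<inter> X' \<in> sets M"
      using X' by auto
    moreover have "(T -` (A \<inter> V) \<inter> space M1) \<inter> X' = T -` A \<inter> X'"
      using X' Y' im M1 by (auto simp: carried_by_def)
    moreover have "T1 -` A \<inter> space M = (T -` A \<inter> X') \<union> (if y0 \<in> A then space M - X' else {})"
      using sub by (auto simp: T1_def split: if_splits)
    ultimately show "T1 -` A \<inter> space M \<in> sets M"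
      using X' by auto
  qed
  have T'_meas: "T' \<in> measurable N M"
  proof (rule measurableI)
    show "T' y \<in> space M" for y
      using T'_in x0 sub by (cases "y \<in> Y'") (auto simp: T'_def)
    fix A assume A: "A \<in> sets M"
    have X'1: "X' \<inter> space M1 \<in> sets M1" and Y'1: "Y' \<inter> space N1 \<in> sets N1"
      using XY by auto
    have "A \<inter> X' \<in> sets (restrict_space M1 X')"
      using A X' M1 by (auto simp: sets_restrict_space_iff[OF X'1] carried_by_def)
    from measurable_sets[OF XY(6) this]
    have "the_inv_into X' T -` (A \<inter> X') \<inter> space (restrict_space N1 Y') \<in> sets N"
      using N1 by (auto simp: sets_restrict_space_iff[OF Y'1] carried_by_def)
    moreover have "the_inv_into X' T -` (A \<inter> X') \<inter> space (restrict_space N1 Y') = T' -` A \<inter> Y'"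
      using Y' T'_in N1 by (auto simp: space_restrict_space carried_by_def T'_def)
    moreover have "T' -` A \<inter> space N = (T' -` A \<inter> Y') \<union> (if x0 \<in> A then space N - Y' else {})"
      using sub by (auto simp: T'_def split: if_splits)
    ultimately show "T' -` A \<inter> space N \<in> sets N"
      using Y' by auto
  qed
  have T_AE: "AE x in M. x \<in> X' \<longrightarrow> P (T1 x)" if "AE y in N. P y" for P
  proof -
    have "AE y in N. y \<in> V \<longrightarrow> P y"
      using that by eventually_elim simp
    then have "AE y in N1. P y"
      unfolding carried_by_AE[OF N1] .
    then have "AE y in distr M1 N1 T. P y"
      unfolding dT .
    from AE_distrD[OF T this] have "AE x in M. x \<in> U \<longrightarrow> P (T x)"
      unfolding carried_by_AE[OF M1] .
    then show ?thesis
      by eventually_elim (use X' in \<open>auto simp: T1_def\<close>)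
  qed
  have T'_AE: "AE y in N. y \<in> Y' \<longrightarrow> P (T' y)" if "AE x in M. P x" for P
  proof -
    \<comment> \<open>The pushforward criterion used below requires a measurable set, so the
      exceptional set is enlarged to a measurable null set. As \<open>T\<close> pushes
      \<open>M1\<close> to \<open>N1\<close>, the preimage of this set under \<open>T'\<close> can
      be tested by pulling back along \<open>T\<close>, where \<open>T'\<close> undoes
      \<open>T\<close>.\<close>
    obtain S where S: "{x \<in> space M. \<not> P x} \<subseteq> S" "emeasure M S = 0" "S \<in> sets M"
      by (rule AE_E[OF \<open>AE x in M. P x\<close>])
    have meas: "{y \<in> space N1. y \<in> Y' \<longrightarrow> T' y \<notin> S} \<in> sets N1"
    proof -
      have "T' -` S \<inter> space N \<in> sets N"
        by (rule measurable_sets[OF T'_meas S(3)])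
      then have "V - (T' -` S \<inter> space N \<inter> Y') \<in> sets N1"
        using N1 Y' by (auto simp: carried_by_def)
      moreover have "{y \<in> space N1. y \<in> Y' \<longrightarrow> T' y \<notin> S} = V - (T' -` S \<inter> space N \<inter> Y')"
        using N1 sub by (auto simp: carried_by_def)
      ultimately show ?thesis
        by simp
    qed
    have "AE x in M. x \<notin> S"
      using S by (intro AE_not_in) (auto simp: null_sets_def)
    then have "AE x in M. x \<in> U \<longrightarrow> x \<notin> S"
      by eventually_elim simp
    then have "AE x in M1. x \<notin> S"
      unfolding carried_by_AE[OF M1] .
    then have "AE x in M1. T x \<in> Y' \<longrightarrow> T' (T x) \<notin> S"
      using XY(3) by eventually_elim (use T'_T in \<open>auto simp: T1_def\<close>)
    then have "AE y in distr M1 N1 T. y \<in> Y' \<longrightarrow> T' y \<notin> S"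
      using AE_distr_iff[OF T meas] by simp
    then have "AE y in N. y \<in> V \<longrightarrow> y \<in> Y' \<longrightarrow> T' y \<notin> S"
      unfolding dT carried_by_AE[OF N1] .
    then show ?thesis
      by eventually_elim (use S(1) Y' T'_in sub in blast)
  qed
  show thesis
  proof
    show "partial_orbit_equivalence \<Gamma> M a \<Lambda> N b T1 T' X' Y'"
    proof
      fix x x1 assume x: "x \<in> X'" "x1 \<in> X'" "x1 \<in> orbit \<Gamma> a x"
      then show "T1 x1 \<in> orbit \<Lambda> b (T1 x)"
        using orb[OF x(1)] by (auto simp: T1_def)
    next
      fix y y1 assume y: "y \<in> Y'" "y1 \<in> Y'" "y1 \<in> orbit \<Lambda> b y"
      have "T (T' y) = y"
        using T_T'[OF y(1)] T'_in[OF y(1)] by (simp add: T1_def)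
      then have "y1 \<in> T ` (orbit \<Gamma> a (T' y) \<inter> X')"
        using orb[OF T'_in[OF y(1)]] y by simp
      then obtain x where "x \<in> orbit \<Gamma> a (T' y)" "x \<in> X'" "y1 = T x"
        by auto
      then show "T' y1 \<in> orbit \<Gamma> a (T' y)"
        using T'_T[of x] by (simp add: T1_def)
    qed (fact X' Y' T1_meas T'_meas T_in T'_in T'_T T_T' T_AE T'_AE)+
    show "T1 x = T x" if "x \<in> X'" for x
      using that by (simp add: T1_def)
    show "AE x in M. x \<in> U \<longrightarrow> x \<in> X'"
      using XY(3) unfolding carried_by_AE[OF M1] .
    show "AE y in N. y \<in> V \<longrightarrow> y \<in> Y'"
      using XY(4) unfolding carried_by_AE[OF N1] .
  qed
qed

section \<open>The full and the weak case as instances of one correspondence\<close>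

lemma isometric_imp_seminormed_isomorphism:
  "isometric_isomorphism V W \<Phi> \<Longrightarrow> seminormed_isomorphism V W \<Phi>"
  unfolding isometric_isomorphism_def seminormed_isomorphism_def
  by (auto intro!: exI[of _ 1])

text \<open>Nothing has to be moved: \<open>p\<close> and \<open>p'\<close> are the identity. The
  correspondence is built with the given \<open>T\<close>, equal almost everywhere to the adjusted
  \<open>T1\<close>, so that the induced cochain map is exactly the prescribed one.\<close>

lemma orbit_equivalence_cohomology:
  fixes \<Gamma> :: "('g, 'm) monoid_scheme" and \<Lambda> :: "('l, 'n) monoid_scheme"
    and M :: "'x measure" and N :: "'y measure"
    and Lf :: "'l \<times> 'y \<Rightarrow> 'e::{banach, second_countable_topology} \<Rightarrow>\<^sub>L 'e"
  assumes X: "free_pmp \<Gamma> M a" and Y: "free_pmp \<Lambda> N b" and coeff: "coefficient_module \<Lambda> N b Lf"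
    and oe: "orbit_equivalence \<Gamma> M a \<Lambda> N b T"
  defines "L \<equiv> contragredient \<Lambda> b Lf"
  defines "VY \<equiv> linf_module \<Lambda> N b L"
    and "VX \<equiv> linf_module \<Gamma> M a (pullback L (oe_groupoid_map a \<Lambda> b T))"
    and "J \<equiv> oe_cochain_map \<Gamma> M a \<Lambda> b T"
  shows "cochain_map \<Lambda> VY \<Gamma> VX J"
    and "\<exists>\<Phi>. isometric_isomorphism (bounded_cohomology \<Lambda> VY n) (bounded_cohomology \<Gamma> VX n) \<Phi> \<and>
      induced_in_cohomology \<Lambda> VY \<Gamma> VX J n \<Phi>"
proof -
  interpret X: free_pmp \<Gamma> M a by fact
  interpret Y: free_pmp \<Lambda> N b by fact
  obtain T1 T' X' Y' where poe: "partial_orbit_equivalence \<Gamma> M a \<Lambda> N b T1 T' X' Y'"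
    and T1: "\<And>x. x \<in> X' \<Longrightarrow> T1 x = T x"
    and X': "AE x in M. x \<in> space M \<longrightarrow> x \<in> X'" and Y': "AE y in N. y \<in> space N \<longrightarrow> y \<in> Y'"
    using orbit_equivalence_partial[OF X Y carried_by_self carried_by_self oe] by blast
  interpret P: partial_orbit_equivalence \<Gamma> M a \<Lambda> N b T1 T' X' Y' by fact
  have pX: "AE x in M. x \<in> orbit \<Gamma> a x \<inter> X'"
    using X' AE_space by eventually_elim (simp add: X.act.orbit_refl)
  have pY: "AE y in N. y \<in> orbit \<Lambda> b y \<inter> Y'"
    using Y' AE_space by eventually_elim (simp add: Y.act.orbit_refl)
  have T: "T \<in> measurable M N" "AE x in M. T x = T1 x"
    using oe X' AE_space by (auto simp: orbit_equivalence_def T1 elim!: eventually_elim2)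
  have T': "T' \<in> measurable N M" "AE y in N. T' y = T' y"
    using P.T'_measurable by auto
  interpret C: orbit_correspondence \<Gamma> M a \<Lambda> N b T T' Lf "pullback L (oe_groupoid_map a \<Lambda> b T)"
  proof (intro orbit_correspondence.intro orbit_correspondence_axioms.intro)
    show "orbit_return \<Gamma> M a \<Lambda> N b T T'"
      by (rule P.orbit_return_compose[OF pX pY T T'])
    show "orbit_return \<Lambda> N b \<Gamma> M a T' T"
      by (rule partial_orbit_equivalence.orbit_return_compose[OF P.swap pY pX T' T])
    show "linear (pullback L (oe_groupoid_map a \<Lambda> b T) g)" for g
      unfolding pullback_def[abs_def] L_def by (rule linear_contragredient)
    show "AE x in M. \<forall>\<xi>. pullback L (oe_groupoid_map a \<Lambda> b T) (\<gamma>, x) \<xi> =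
        contragredient \<Lambda> b Lf (displacement \<Lambda> b (T (a \<gamma> x)) (T x), T x) \<xi>" for \<gamma>
      by (simp add: pullback_def oe_groupoid_map_def oe_cocycle_displacement L_def)
  qed (rule coeff)
  show "cochain_map \<Lambda> VY \<Gamma> VX J"
    using C.OJ.cochain_map_lift by (simp add: VY_def VX_def J_def L_def C.oe_cochain_map_lift)
  show "\<exists>\<Phi>. isometric_isomorphism (bounded_cohomology \<Lambda> VY n) (bounded_cohomology \<Gamma> VX n) \<Phi> \<and>
      induced_in_cohomology \<Lambda> VY \<Gamma> VX J n \<Phi>"
    using C.cohomology_isomorphism[of n] by (simp add: VY_def VX_def J_def L_def C.oe_cochain_map_lift)
qed

lemma weak_orbit_equivalence_cohomology:
  fixes \<Gamma> :: "('g, 'm) monoid_scheme" and \<Lambda> :: "('l, 'n) monoid_scheme"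
    and M :: "'x measure" and N :: "'y measure"
    and Lf :: "'l \<times> 'y \<Rightarrow> 'e::{banach, second_countable_topology} \<Rightarrow>\<^sub>L 'e"
  assumes X: "free_pmp \<Gamma> M a" and Y: "free_pmp \<Lambda> N b" and coeff: "coefficient_module \<Lambda> N b Lf"
    and erg: "ergodic \<Lambda> N b" and oe: "weak_orbit_equivalence \<Gamma> M a U \<Lambda> N b V T"
    and \<theta>: "return_map \<Gamma> M a U \<theta>"
  defines "L \<equiv> contragredient \<Lambda> b Lf"
  defines "VY \<equiv> linf_module \<Lambda> N b L"
    and "VX \<equiv> linf_module \<Gamma> M a (pullback L (weak_oe_groupoid_map \<Gamma> a \<Lambda> b T \<theta>))"
  shows "\<exists>\<Phi>. isometric_isomorphism (bounded_cohomology \<Lambda> VY n) (bounded_cohomology \<Gamma> VX n) \<Phi>"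
proof -
  interpret X: free_pmp \<Gamma> M a by fact
  interpret Y: free_pmp \<Lambda> N b by fact
  have UV: "U \<in> sets M" "V \<in> sets N" "emeasure M U > 0" "emeasure N V > 0"
    and oe': "orbit_equivalence \<Gamma> (normalized_restriction M U) a \<Lambda> (normalized_restriction N V) b T"
    using oe by (auto simp: weak_orbit_equivalence_def)
  obtain T1 T' X' Y' where poe: "partial_orbit_equivalence \<Gamma> M a \<Lambda> N b T1 T' X' Y'"
    and T1: "\<And>x. x \<in> X' \<Longrightarrow> T1 x = T x"
    and X': "AE x in M. x \<in> U \<longrightarrow> x \<in> X'" and Y': "AE y in N. y \<in> V \<longrightarrow> y \<in> Y'"
    using orbit_equivalence_partial[OF X Y
        carried_by_normalized_restriction[OF X.prob_space_axioms UV(1,3)]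
        carried_by_normalized_restriction[OF Y.prob_space_axioms UV(2,4)] oe'] by blast
  interpret P: partial_orbit_equivalence \<Gamma> M a \<Lambda> N b T1 T' X' Y' by fact
  have \<theta>_meas: "\<theta> \<in> measurable M (count_space (carrier \<Gamma>) \<Otimes>\<^sub>M M)"
    and \<theta>_AE: "AE x in M. snd (\<theta> x) = x \<and> a (fst (\<theta> x)) (snd (\<theta> x)) \<in> U"
    using \<theta> by (simp_all add: return_map_def gd_measure_def gd_source_def gd_target_def)
  \<comment> \<open>The target of the return arrow, so that \<open>q\<close> becomes
    \<open>T1\<close> after the very displacement used to define the pulled back module.\<close>
  define p where "p x = a (fst (\<theta> x)) (snd (\<theta> x))" for x
  have fst\<theta>: "(\<lambda>x. fst (\<theta> x)) \<in> measurable M (count_space (carrier \<Gamma>))"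
    by (rule measurable_compose[OF \<theta>_meas measurable_fst])
  have p_meas: "p \<in> measurable M M"
    unfolding p_def[abs_def]
    by (rule measurable_compose_countable'[OF _ fst\<theta> X.countable_carrier],
        rule measurable_compose[OF measurable_compose[OF \<theta>_meas measurable_snd] X.act_measurable])
  have p_orbit: "AE x in M. p x \<in> orbit \<Gamma> a x"
    using \<theta>_AE AE_space
    by eventually_elim (use measurable_space[OF fst\<theta>] in \<open>auto simp: p_def orbit_def\<close>)
  \<comment> \<open>The return map aims only at \<open>U\<close>; since \<open>X'\<close> fills
    \<open>U\<close> up to a null set and \<open>p\<close> is nonsingular, it lands in
    \<open>X'\<close> almost surely.\<close>
  have pX: "AE x in M. p x \<in> orbit \<Gamma> a x \<inter> X'"
    using X.AE_orbit[OF X' p_orbit] p_orbit \<theta>_AE by eventually_elim (auto simp: p_def)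
  \<comment> \<open>The return map on the other side must aim at \<open>Y'\<close>, where
    \<open>T'\<close> inverts the equivalence, rather than at \<open>V\<close>.\<close>
  have "emeasure N Y' > 0"
  proof -
    have "emeasure N V \<le> emeasure N Y'"
      by (rule emeasure_mono_AE[OF Y' P.Y'_sets])
    then show ?thesis
      using UV(4) by (rule less_le_trans[rotated])
  qed
  then obtain p' where p': "p' \<in> measurable N N" "AE y in N. p' y \<in> orbit \<Lambda> b y \<inter> Y'"
    using Y.ergodic_return[OF erg P.Y'_sets] by blast
  define q where "q x = T1 (p x)" for x
  define q' where "q' y = T' (p' y)" for y
  have q: "q \<in> measurable M N" "AE x in M. q x = T1 (p x)"
    using measurable_compose[OF p_meas P.T_measurable] by (simp_all add: q_def[abs_def])
  have q': "q' \<in> measurable N M" "AE y in N. q' y = T' (p' y)"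
    using measurable_compose[OF p'(1) P.T'_measurable] by (simp_all add: q'_def[abs_def])
  have good: "AE x in M. p x \<in> X' \<and> snd (\<theta> x) = x"
    using pX \<theta>_AE by eventually_elim simp
  interpret C: orbit_correspondence \<Gamma> M a \<Lambda> N b q q' Lf
    "pullback L (weak_oe_groupoid_map \<Gamma> a \<Lambda> b T \<theta>)"
  proof (intro orbit_correspondence.intro orbit_correspondence_axioms.intro)
    show "orbit_return \<Gamma> M a \<Lambda> N b q q'"
      by (rule P.orbit_return_compose[OF pX p'(2) q q'])
    show "orbit_return \<Lambda> N b \<Gamma> M a q' q"
      by (rule partial_orbit_equivalence.orbit_return_compose[OF P.swap p'(2) pX q' q])
    show "linear (pullback L (weak_oe_groupoid_map \<Gamma> a \<Lambda> b T \<theta>) g)" for g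
      unfolding pullback_def[abs_def] L_def by (rule linear_contragredient)
    fix \<gamma> assume \<gamma>: "\<gamma> \<in> carrier \<Gamma>"
    show "AE x in M. \<forall>\<xi>. pullback L (weak_oe_groupoid_map \<Gamma> a \<Lambda> b T \<theta>) (\<gamma>, x) \<xi> =
        contragredient \<Lambda> b Lf (displacement \<Lambda> b (q (a \<gamma> x)) (q x), q x) \<xi>"
      using good X.AE_act[OF \<gamma> good] AE_space
    proof eventually_elim
      case (elim x)
      define g0 g1 where "g0 = fst (\<theta> x)" and "g1 = fst (\<theta> (a \<gamma> x))"
      have \<gamma>x: "a \<gamma> x \<in> space M"
        using \<gamma> elim(3) by (rule X.act_closed)
      have g: "g0 \<in> carrier \<Gamma>" "g1 \<in> carrier \<Gamma>"
        using measurable_space[OF fst\<theta>] elim(3) \<gamma>x by (auto simp: g0_def g1_def)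
      have \<theta>x: "\<theta> x = (g0, x)" "\<theta> (a \<gamma> x) = (g1, a \<gamma> x)"
        using elim by (auto simp: g0_def g1_def prod_eq_iff)
      have px: "p x = a g0 x" "p (a \<gamma> x) = a g1 (a \<gamma> x)"
        by (simp_all add: p_def \<theta>x)
      \<comment> \<open>The arrow conjugated by \<open>\<theta>\<close> runs from \<open>p x\<close>
        to \<open>p (a \<gamma> x)\<close>; its image is therefore the displacement of
        \<open>q\<close> along \<open>\<gamma>\<close>, as the correspondence demands.\<close>
      have "a ((g1 \<otimes>\<^bsub>\<Gamma>\<^esub> \<gamma>) \<otimes>\<^bsub>\<Gamma>\<^esub> inv\<^bsub>\<Gamma>\<^esub> g0) (p x) = p (a \<gamma> x)"
        using g \<gamma> elim(3) by (simp add: px X.act_mult X.act_closed X.act_inv)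
      then have "weak_oe_groupoid_map \<Gamma> a \<Lambda> b T \<theta> (\<gamma>, x) =
          (displacement \<Lambda> b (T (p (a \<gamma> x))) (T (p x)), T (p x))"
        by (simp add: weak_oe_groupoid_map_def gd_target_def gd_source_def gd_mult_def gd_inv_def \<theta>x
            oe_groupoid_map_def oe_cocycle_displacement flip: px(1))
      then show ?case
        using elim T1 by (simp add: pullback_def q_def L_def)
    qed
  qed (rule coeff)
  show ?thesis
    using C.cohomology_isomorphism[of n] by (auto simp: VY_def VX_def L_def)
qed

theorem theorem2:
  fixes \<Gamma> :: "('g, 'm) monoid_scheme" and \<Lambda> :: "('l, 'n) monoid_scheme"
    and M :: "'x measure" and N :: "'y measure"
    and a :: "'g \<Rightarrow> 'x \<Rightarrow> 'x" and b :: "'l \<Rightarrow> 'y \<Rightarrow> 'y"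
    and Lf :: "'l \<times> 'y \<Rightarrow> 'e::{banach, second_countable_topology} \<Rightarrow>\<^sub>L 'e"
  assumes "pmp_action \<Gamma> M a" and "essentially_free \<Gamma> M a"
    and "pmp_action \<Lambda> N b" and "essentially_free \<Lambda> N b"
    and "coefficient_module \<Lambda> N b Lf"
  shows
    "(\<forall>T. orbit_equivalence \<Gamma> M a \<Lambda> N b T \<longrightarrow>
       (let L = contragredient \<Lambda> b Lf;
            VY = linf_module \<Lambda> N b L;
            VX = linf_module \<Gamma> M a (pullback L (oe_groupoid_map a \<Lambda> b T));
            J = oe_cochain_map \<Gamma> M a \<Lambda> b T
        in cochain_map \<Lambda> VY \<Gamma> VX J \<and>
           (\<forall>n. \<exists>\<Phi>. isometric_isomorphism
                      (bounded_cohomology \<Lambda> VY n) (bounded_cohomology \<Gamma> VX n) \<Phi> \<and>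
                    induced_in_cohomology \<Lambda> VY \<Gamma> VX J n \<Phi>)))
     \<and>
     (\<forall>U V T \<theta>. ergodic \<Gamma> M a \<and> ergodic \<Lambda> N b \<and>
         weak_orbit_equivalence \<Gamma> M a U \<Lambda> N b V T \<and> return_map \<Gamma> M a U \<theta> \<longrightarrow>
       (let L = contragredient \<Lambda> b Lf;
            VY = linf_module \<Lambda> N b L;
            VX = linf_module \<Gamma> M a (pullback L (weak_oe_groupoid_map \<Gamma> a \<Lambda> b T \<theta>))
        in \<forall>n. \<exists>\<Phi>. seminormed_isomorphism
                     (bounded_cohomology \<Lambda> VY n) (bounded_cohomology \<Gamma> VX n) \<Phi>))"
proof -
  have X: "free_pmp \<Gamma> M a" and Y: "free_pmp \<Lambda> N b"
    using assms by (simp_all add: free_pmp_def free_pmp_axioms_def pmp_def)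
  show ?thesis
    unfolding Let_def
    using orbit_equivalence_cohomology[OF X Y assms(5)]
      weak_orbit_equivalence_cohomology[OF X Y assms(5)] isometric_imp_seminormed_isomorphism
    by blast
qed

end
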